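(* Let $\omega=(\alpha,\beta,\gamma)$ be such that there is a simple closed loop in $\mathbb C$ around $[-1,1]$ enclosing no zeros of $E^\omega$ (e.g. if $\beta_1<1$). Then the correlation functions of the point process $\widetilde{\mathcal X}^\omega$ are determinantal: for all $k\ge1$ and $z_1,\dots,z_k\in\mathbb Z_{\ge0}\times\mathbb Z_{>0}$, $$\mathbb P(\widetilde{\mathcal X}^\omega\supset\{z_1,\dots,z_k\})=\det[K^\omega(z_i,z_j)]_{i,j=1}^k,$$ where $$K^\omega((s,n),(t,m))=\frac{2^{\alpha_n+1/2}}{\pi}\frac{1}{2\pi i}\int_{-1}^1\oint\frac{E^\omega(x)}{E^\omega(u)}J_{s,\alpha_n}(x)J_{t,\alpha_m}(u)\frac{(1-x)^{r_n+\alpha_n}(1+x)^{1/2}}{(1-u)^{r_m}(x-u)}\,du\,dx$$ $$+1_{(n\ge m)}\frac{2^{\alpha_n+1/2}}{\pi}\int_{-1}^1J_{s,\alpha_n}(x)J_{t,\alpha_m}(x)(1-x)^{r_n-r_m+\alpha_n}(1+x)^{1/2}dx,$$ the $u$-contour being a positively oriented simple loop around $[-1,1]$ containing no zeros of $E^\omega$.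
   Context: For $n\ge1$ let $r_n=\lfloor(n+1)/2\rfloor$, $\alpha_n=1/2$ ($n$ even), $-1/2$ ($n$ odd). $\mathbb J_n$ is the set of partitions $\lambda=(\lambda_1\ge\dots\ge\lambda_{r_n}\ge0)$; for $\lambda\in\mathbb J_n$, $\widetilde\lambda_j=\lambda_j+r_n-j$. For $\lambda\in\mathbb J_n$, $\mu\in\mathbb J_{n+1}$ write $\lambda\prec\mu$ if $\mu_1\ge\lambda_1\ge\mu_2\ge\dots\ge\mu_{r_n}\ge\lambda_{r_n}\ge\mu_{r_n+1}$ (with $\mu_{r_n+1}:=0$ if $r_{n+1}=r_n$). Chebyshev polynomials: $J_{0,\pm1/2}=1$, $J_{1,1/2}(x)=2x$, $J_{1,-1/2}(x)=2x-1$, both satisfying $xp_k=\frac12p_{k+1}+\frac12p_{k-1}$, $k\ge1$. $\langle f,g\rangle_\alpha=\frac{2^{\alpha+1/2}}{\pi}\int_{-1}^1fg(1-x)^\alpha(1+x)^{1/2}dx$. $\omega=(\alpha,\beta,\gamma)$: $\alpha,\beta$ nonincreasing summable nonnegative sequences, $\gamma\ge0$; $E^\omega(x)=e^{\frac\gamma2(z+z^{-1}-2)}\prod_{i}\frac{(1+\frac{\beta_i}{2}(z-1))(1+\frac{\beta_i}{2}(z^{-1}-1))}{(1-\frac{\alpha_i}{2}(z-1))(1-\frac{\alpha_i}{2}(z^{-1}-1))}$ for $x=(z+z^{-1})/2$ (a function of $x$, extended analytically). Plancherel measure on paths: $P^\omega$ is the probability measure on sequences $(u^1,u^2,\dots)$,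 $u^m\in\mathbb J_m$, such that for each $n$ and $u^1,\dots,u^n$, $$P^\omega(\text{first $n$ terms are }u^1,\dots,u^n)=\prod_{m=1}^{n-1}1_{(u^m\prec u^{m+1})}\cdot2^{\binom{r_n}{2}}\det\big[\langle J_{\widetilde{u^n_j},\alpha_n},(x-1)^{r_n-i}E^\omega\rangle_{\alpha_n}\big]_{i,j=1}^{r_n}$$ ($\binom12:=0$); this equals $P^\omega_n(u^n)/\dim_nu^n$ times the interlacing indicator, where $P^\omega_n$ are the Plancherel measures of $Sp(\infty)$. The point process is $\widetilde{\mathcal X}^\omega=\{(\widetilde{u^m_k},m):m\ge1,1\le k\le r_m\}\subset\mathbb Z_{\ge0}\times\mathbb Z_{>0}$ with $(u^m)\sim P^\omega$. *)

theory Defs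
  imports "HOL-Complex_Analysis.Complex_Analysis" "HOL-Probability.Probability"
    "Jordan_Normal_Form.Determinant"
begin

definition rr :: "nat \<Rightarrow> nat" where
  "rr n = (n + 1) div 2"

definition alph :: "nat \<Rightarrow> real" where
  "alph n = (if even n then 1/2 else -1/2)"

definition JJ :: "nat \<Rightarrow> nat list set" where
  "JJ n = {l. length l = rr n \<and> sorted_wrt (\<ge>) l}"

definition part :: "nat list \<Rightarrow> nat \<Rightarrow> nat" where
  "part l j = (if 1 \<le> j \<and> j \<le> length l then l ! (j - 1) else 0)"

definition tld :: "nat \<Rightarrow> nat list \<Rightarrow> nat \<Rightarrow> nat" where
  "tld n l j = part l j + (rr n - j)"

text \<open>lambda in J_n precedes mu in J_(n+1); mu_(r_n+1) is read as 0 when r_(n+1) = r_n.\<close>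
definition interlace :: "nat \<Rightarrow> nat list \<Rightarrow> nat list \<Rightarrow> bool" where
  "interlace n lam mu = (\<forall>j\<in>{1..rr n}. part mu j \<ge> part lam j \<and> part lam j \<ge> part mu (j + 1))"

fun chebJ :: "nat \<Rightarrow> real \<Rightarrow> complex \<Rightarrow> complex" where
  "chebJ 0 a x = 1"
| "chebJ (Suc 0) a x = (if a = 1/2 then 2 * x else 2 * x - 1)"
| "chebJ (Suc (Suc k)) a x = 2 * x * chebJ (Suc k) a x - chebJ k a x"

text \<open>For x, z is any nonzero solution of x = (z + z^{-1})/2; the defining expression is
  symmetric under z to z^{-1}, so this is well defined. E^omega = Enum / Eden.\<close>

definition zOf :: "complex \<Rightarrow> complex" where
  "zOf x = (SOME z. z \<noteq> 0 \<and> (z + inverse z) / 2 = x)"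

definition Enum :: "(nat \<Rightarrow> real) \<Rightarrow> real \<Rightarrow> complex \<Rightarrow> complex" where
  "Enum be ga x = (let z = zOf x in
     exp (complex_of_real (ga / 2) * (z + inverse z - 2)) *
     prodinf (\<lambda>i. (1 + complex_of_real (be i / 2) * (z - 1)) *
                   (1 + complex_of_real (be i / 2) * (inverse z - 1))))"

definition Eden :: "(nat \<Rightarrow> real) \<Rightarrow> complex \<Rightarrow> complex" where
  "Eden al x = (let z = zOf x in
     prodinf (\<lambda>i. (1 - complex_of_real (al i / 2) * (z - 1)) *
                   (1 - complex_of_real (al i / 2) * (inverse z - 1))))"

definition Eom :: "(nat \<Rightarrow> real) \<Rightarrow> (nat \<Rightarrow> real) \<Rightarrow> real \<Rightarrow> complex \<Rightarrow> complex" where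
  "Eom al be ga x = Enum be ga x / Eden al x"

text \<open>Zeros of the meromorphic function E^omega (poles, i.e. zeros of Eden, are not zeros).\<close>
definition Ezeros :: "(nat \<Rightarrow> real) \<Rightarrow> (nat \<Rightarrow> real) \<Rightarrow> real \<Rightarrow> complex set" where
  "Ezeros al be ga = {x. Enum be ga x = 0 \<and> Eden al x \<noteq> 0}"

definition omega_params :: "(nat \<Rightarrow> real) \<Rightarrow> (nat \<Rightarrow> real) \<Rightarrow> real \<Rightarrow> bool" where
  "omega_params al be ga \<longleftrightarrow>
     (\<forall>i. al i \<ge> 0) \<and> (\<forall>i. be i \<ge> 0) \<and> antimono al \<and> antimono be \<and>
     summable al \<and> summable be \<and> ga \<ge> 0"

definition ip :: "real \<Rightarrow> (complex \<Rightarrow> complex) \<Rightarrow> (complex \<Rightarrow> complex) \<Rightarrow> complex" where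
  "ip a f g = complex_of_real (2 powr (a + 1/2) / pi) *
     (LINT x:{-1..1}|lborel. f (of_real x) * g (of_real x) *
        complex_of_real ((1 - x) powr a * sqrt (1 + x)))"

definition detk :: "nat \<Rightarrow> (nat \<Rightarrow> nat \<Rightarrow> complex) \<Rightarrow> complex" where
  "detk k M = Determinant.det (Matrix.mat k k (\<lambda>(i, j). M i j))"

text \<open>Probability that the first n terms of the path are u 1, ..., u n.\<close>
definition path_weight :: "(nat \<Rightarrow> real) \<Rightarrow> (nat \<Rightarrow> real) \<Rightarrow> real \<Rightarrow> nat \<Rightarrow> (nat \<Rightarrow> nat list) \<Rightarrow> complex" where
  "path_weight al be ga n u =
     (if (\<forall>m\<in>{1..n}. u m \<in> JJ m) \<and> (\<forall>m\<in>{1..<n}. interlace m (u m) (u (m + 1)))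
      then 2 ^ (rr n choose 2) *
        detk (rr n) (\<lambda>i j. ip (alph n) (chebJ (tld n (u n) (j + 1)) (alph n))
                              (\<lambda>x. (x - 1) ^ (rr n - (i + 1)) * Eom al be ga x))
      else 0)"

definition pointset :: "(nat \<Rightarrow> nat list) \<Rightarrow> (nat \<times> nat) set" where
  "pointset w = {(tld m (w m) j, m) | m j. 1 \<le> m \<and> 1 \<le> j \<and> j \<le> rr m}"

definition good_loop :: "(nat \<Rightarrow> real) \<Rightarrow> (nat \<Rightarrow> real) \<Rightarrow> real \<Rightarrow> (real \<Rightarrow> complex) \<Rightarrow> bool" where
  "good_loop al be ga g \<longleftrightarrow>
     valid_path g \<and> simple_path g \<and> pathfinish g = pathstart g \<and>
     (\<forall>x\<in>{-1..1::real}. complex_of_real x \<notin> path_image g \<and> winding_number g (of_real x) = 1) \<and>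
     (\<forall>w. (w \<in> path_image g \<or> winding_number g w \<noteq> 0) \<longrightarrow> w \<notin> Ezeros al be ga)"

definition Kern :: "(nat \<Rightarrow> real) \<Rightarrow> (nat \<Rightarrow> real) \<Rightarrow> real \<Rightarrow> (real \<Rightarrow> complex) \<Rightarrow>
    nat \<times> nat \<Rightarrow> nat \<times> nat \<Rightarrow> complex" where
  "Kern al be ga g z1 z2 = (case z1 of (s, n) \<Rightarrow> case z2 of (t, m) \<Rightarrow>
     complex_of_real (2 powr (alph n + 1/2) / pi) * (1 / (2 * pi * \<i>)) *
       (LINT x:{-1..1}|lborel.
          contour_integral g (\<lambda>u.
            Eom al be ga (of_real x) / Eom al be ga u *
            chebJ s (alph n) (of_real x) * chebJ t (alph m) u *
            complex_of_real ((1 - x) powr (real (rr n) + alph n) * sqrt (1 + x)) /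
            ((1 - u) ^ rr m * (of_real x - u))))
     + (if n \<ge> m then
         complex_of_real (2 powr (alph n + 1/2) / pi) *
         (LINT x:{-1..1}|lborel.
            chebJ s (alph n) (of_real x) * chebJ t (alph m) (of_real x) *
            complex_of_real ((1 - x) powr (real (rr n) - real (rr m) + alph n) * sqrt (1 + x)))
       else 0))"

end

theory Submission
  imports Defs
begin

text \<open>
  Write \<open>y = x - 1\<close>. A weight \<open>1 + t\<close> on the points \<open>z\<^sub>1, \<dots>, z\<^sub>k\<close> turns the correlation function into the
  leading coefficient in \<open>t\<close> of an expectation. For fixed lower levels, the sum over the top partition runs over
  a product of intervals, so each column of the determinant is replaced by a difference of tail sums. In terms of
  the functions \<open>E f\<close> whose Chebyshev coefficients form the columns, taking tail sums is the identity
  when the number of particles is unchanged, and is the difference quotient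
  \<open>f \<mapsto> (f - f(1)) / (2 y)\<close> together with the functional \<open>f \<mapsto> f(1)\<close> when a particle disappears. The
  weights are finite rank perturbations. Starting from \<open>f = (2 y)\<^sup>j\<close> one arrives at a determinant
  \<open>det (1 + t a R)\<close>, which Sylvester's identity turns into \<open>det (1 + t K)\<close>. The kernel \<open>K\<close> contains iterated
  difference quotients of \<open>J / E\<close> at \<open>1\<close>, and these are contour integrals by Cauchy's formula.

  The loop may surround a point at which numerator and denominator of \<open>E\<close> both vanish. Nonnegativity of
  the cylinder probabilities makes the Chebyshev coefficients of \<open>E\<close> totally positive; as for
  Polya frequency sequences, the poles can then be removed one by one, and positivity on the axis excludes any zero
  \<open>x > 1\<close> of \<open>E\<close>. So \<open>1 / E\<close> extends holomorphically to the inside of the loop.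
\<close>

section \<open>Determinants\<close>

text \<open>Sums over the top partition are truncated at a bound \<open>R\<close> for the first row.
  The measure side converges by dominated convergence, the column side because Chebyshev
  coefficients of continuous functions decay, so no absolute summability of coefficients has to be
  established. Powers of \<open>2 y\<close> rather than \<open>y\<close> absorb the factor
  \<open>2 ^ (r choose 2)\<close> of the cylinder formula and fit the connection formulas between
  the two Chebyshev families. The price is a gauge factor \<open>(-2) ^ r_n\<close> between the
  kernel found and the stated one, which drops out of determinants. Positivity is needed for the
  following reason. The numerator of \<open>E\<close> has factors \<open>1 + (b - b^2/2) y\<close>,
  and \<open>b > 2\<close> puts the zero at some \<open>y > 0\<close>, on the half line that carries
  the poles \<open>y = 1 / (a + a^2/2)\<close>. Such a zero can sit on top of a pole, where the loop
  condition is silent; if its order exceeded that of the pole, \<open>1 / E\<close> would be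
  singular inside the loop and Cauchy's formula would break down. Only the existence of the
  probability measure rules this out.\<close>

lemma detk_leibniz:
  "detk k M = (\<Sum>p | p permutes {0..<k}. of_int (sign p) * (\<Prod>i<k. M i (p i)))"
  unfolding detk_def
  by (subst det_def'[of _ k]) (auto intro!: sum.cong prod.cong simp: atLeast0LessThan permutes_in_image)

lemma detk_cong:
  assumes "\<And>i j. i < k \<Longrightarrow> j < k \<Longrightarrow> M i j = M' i j"
  shows "detk k M = detk k M'"
  unfolding detk_def by (rule arg_cong[where f = Determinant.det]) (auto intro!: eq_matI simp: assms)

lemma detk_0 [simp]: "detk 0 M = 1"
  by (simp add: detk_leibniz)

lemma detk_transpose: "detk k (\<lambda>i j. M j i) = detk k M"
proof -
  have "Matrix.mat k k (\<lambda>(i, j). M j i) = transpose_mat (Matrix.mat k k (\<lambda>(i, j). M i j))"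
    by (auto intro!: eq_matI)
  then show ?thesis unfolding detk_def by (simp add: det_transpose[of _ k])
qed

lemma detk_mult:
  "detk k (\<lambda>i j. \<Sum>l<k. A i l * B l j) = detk k A * detk k B"
proof -
  have "Matrix.mat k k (\<lambda>(i, j). \<Sum>l<k. A i l * B l j)
      = Matrix.mat k k (\<lambda>(i, j). A i j) * Matrix.mat k k (\<lambda>(i, j). B i j)"
    by (auto intro!: eq_matI sum.cong simp: scalar_prod_def atLeast0LessThan)
  then show ?thesis unfolding detk_def by (simp add: det_mult[of _ k])
qed

text \<open>A nontrivial permutation contributing to the expansion would have to lower the total height.\<close>
lemma detk_graded_unitriangular:
  fixes h :: "nat \<Rightarrow> nat"
  assumes diag: "\<And>i. i < k \<Longrightarrow> M i i = 1"
    and tri: "\<And>i j. i < k \<Longrightarrow> j < k \<Longrightarrow> i \<noteq> j \<Longrightarrow> h i \<le> h j \<Longrightarrow> M i j = 0"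
  shows "detk k M = 1"
proof -
  have *: "(\<Prod>i<k. M i (p i)) = 0" if p: "p permutes {0..<k}" and ne: "p \<noteq> id" for p
  proof (rule ccontr)
    assume nz: "(\<Prod>i<k. M i (p i)) \<noteq> 0"
    have lt: "p i < k" if "i < k" for i
      using permutes_in_image[OF p, of i] that by simp
    have le: "h (p i) \<le> h i" if "i < k" for i
      using nz tri[of i "p i"] that lt by (cases "p i = i") force+
    obtain i where i: "p i \<noteq> i" using ne by (auto simp: fun_eq_iff)
    then have "i < k" using permutes_not_in[OF p, of i] by force
    then have "h (p i) < h i"
      using nz tri[of i "p i"] lt[of i] i by (metis finite_lessThan lessThan_iff not_le prod_zero_iff)
    then have "(\<Sum>i\<in>{0..<k}. h (p i)) < (\<Sum>i\<in>{0..<k}. h i)"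
      using \<open>i < k\<close> le by (intro sum_strict_mono_ex1) auto
    moreover have "(\<Sum>i\<in>{0..<k}. h (p i)) = (\<Sum>i\<in>{0..<k}. h i)"
      using sum.permute[OF p, of h] by (simp add: o_def)
    ultimately show False by simp
  qed
  have "detk k M = (\<Sum>p\<in>{id}. of_int (sign p) * (\<Prod>i<k. M i (p i)))"
    unfolding detk_leibniz
    by (rule sum.mono_neutral_right) (auto simp: finite_permutations permutes_id *)
  then show ?thesis using diag by simp
qed

text \<open>The factors cancel along every permutation. This makes the powers of \<open>-2\<close>
  by which \<open>KT\<close> and \<open>Kern\<close> differ invisible to the correlation
  functions.\<close>

lemma detk_gauge:
  assumes "\<And>i. i < k \<Longrightarrow> c i \<noteq> 0"
  shows "detk k (\<lambda>i j. c i * M i j / c j) = detk k M"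
proof -
  have "(\<Prod>i<k. c i * M i (p i) / c (p i)) = (\<Prod>i<k. M i (p i))" if p: "p permutes {0..<k}" for p
  proof -
    have "(\<Prod>i<k. c (p i)) = (\<Prod>i<k. c i)"
      using prod.permute[OF p, of c] by (simp add: o_def atLeast0LessThan)
    moreover have "(\<Prod>i<k. c i) \<noteq> 0" using assms by simp
    ultimately show ?thesis by (simp add: prod.distrib prod_dividef)
  qed
  then show ?thesis unfolding detk_leibniz by (intro sum.cong) auto
qed

lemma detk_scale_rows: "detk k (\<lambda>i j. c i * M i j) = (\<Prod>i<k. c i) * detk k M"
  unfolding detk_leibniz by (simp add: prod.distrib sum_distrib_left mult_ac)

lemma detk_scale_cols: "detk k (\<lambda>i j. c j * M i j) = (\<Prod>i<k. c i) * detk k M"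
  using detk_scale_rows[of k c "\<lambda>i j. M j i"] detk_transpose[of k M]
    detk_transpose[of k "\<lambda>i j. c j * M i j"] by simp

text \<open>When a particle disappears, each remaining column picks up a multiple of the newly
  created constant column; such multiples are removed here. The multiplier matrix is unitriangular
  once \<open>q\<close> is given the larger height.\<close>

lemma detk_add_multiple_of_col:
  assumes "q < k" "q \<notin> S"
  shows "detk k (\<lambda>i j. if j \<in> S then M i j + e j * M i q else M i j) = detk k M"
proof -
  define V where "V = (\<lambda>l j. if l = j then 1 else if j \<in> S \<and> l = q then e j else (0::complex))"
  have "detk k V = 1"
    using assms by (intro detk_graded_unitriangular[where h = "\<lambda>i. if i = q then 1 else 0"])
      (auto simp: V_def)
  moreover have "detk k (\<lambda>i j. \<Sum>l<k. M i l * V l j)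
      = detk k (\<lambda>i j. if j \<in> S then M i j + e j * M i q else M i j)"
  proof (rule detk_cong)
    fix i j assume ij: "i < k" "j < k"
    have "(\<Sum>l<k. M i l * V l j) = (\<Sum>l<k. (if l = j then M i l else 0)
       + (if l = q then (if j \<in> S then e j * M i l else 0) else 0))"
      using assms by (intro sum.cong) (auto simp: V_def)
    also have "\<dots> = (if j \<in> S then M i j + e j * M i q else M i j)"
      using ij assms by (simp add: sum.distrib)
    finally show "(\<Sum>l<k. M i l * V l j) = \<dots>" .
  qed
  ultimately show ?thesis using detk_mult[of k M V] by simp
qed

text \<open>Exchanges a determinant whose size is the number of particles for one indexed by marked
  points. The two sides are the determinants of the products \<open>?X * ?Y\<close> and
  \<open>?Y * ?X\<close> of the same two block matrices.\<close>

lemma detk_sylvester: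
  "detk r (\<lambda>i j. (if i = j then 1 else 0) + (\<Sum>l<k. A i l * B l j))
 = detk k (\<lambda>i j. (if i = j then 1 else 0) + (\<Sum>l<r. B i l * A l j))"
proof -
  define MA MB where "MA = Matrix.mat r k (\<lambda>(i, j). A i j)" and "MB = Matrix.mat k r (\<lambda>(i, j). B i j)"
  have c: "MA \<in> carrier_mat r k" "MB \<in> carrier_mat k r"
    by (auto simp: MA_def MB_def)
  let ?X = "four_block_mat (1\<^sub>m r) (- MA) MB (1\<^sub>m k)"
  let ?Y = "four_block_mat (1\<^sub>m r) (0\<^sub>m r k) (- MB) (1\<^sub>m k)"
  have X: "?X \<in> carrier_mat (r + k) (r + k)" and Y: "?Y \<in> carrier_mat (r + k) (r + k)"
    using c by auto
  have dY: "Determinant.det ?Y = 1"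
    using c by (subst det_four_block_mat_upper_right_zero[of _ r _ k]) auto
  have XY: "?X * ?Y = four_block_mat (1\<^sub>m r + MA * MB) (- MA) (0\<^sub>m k r) (1\<^sub>m k)"
    using c by (subst mult_four_block_mat[of _ r r _ k _ k _ _ r _ k]) 
      (auto simp: uminus_add_minus_mat[symmetric] simp flip: minus_add_uminus_mat)
  have YX: "?Y * ?X = four_block_mat (1\<^sub>m r) (- MA) (0\<^sub>m k r) (1\<^sub>m k + MB * MA)"
    using c by (subst mult_four_block_mat[of _ r r _ k _ k _ _ r _ k])
      (auto simp: comm_add_mat)
  have 1: "Determinant.det (?X * ?Y) = Determinant.det (1\<^sub>m r + MA * MB)"
    unfolding XY using c by (subst det_four_block_mat_lower_left_zero[of _ r _ k]) auto
  have 2: "Determinant.det (?Y * ?X) = Determinant.det (1\<^sub>m k + MB * MA)"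
    unfolding YX using c by (subst det_four_block_mat_lower_left_zero[of _ r _ k]) auto
  have "Determinant.det (1\<^sub>m r + MA * MB) = Determinant.det (1\<^sub>m k + MB * MA)"
    by (metis 1 2 det_mult[OF X Y] det_mult[OF Y X] mult.commute)
  moreover have "1\<^sub>m r + MA * MB = Matrix.mat r r (\<lambda>(i, j). (if i = j then 1 else 0) + (\<Sum>l<k. A i l * B l j))"
    by (auto intro!: eq_matI sum.cong simp: MA_def MB_def scalar_prod_def atLeast0LessThan)
  moreover have "1\<^sub>m k + MB * MA = Matrix.mat k k (\<lambda>(i, j). (if i = j then 1 else 0) + (\<Sum>l<r. B i l * A l j))"
    by (auto intro!: eq_matI sum.cong simp: MA_def MB_def scalar_prod_def atLeast0LessThan)
  ultimately show ?thesis by (simp add: detk_def)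
qed

text \<open>Levels descend along nonzero entries of \<open>U\<close>, so \<open>1 - U\<close> is unimodular.\<close>
lemma detk_resolvent:
  fixes h :: "nat \<Rightarrow> nat"
  assumes eq: "\<And>i l. i < r \<Longrightarrow> l < k \<Longrightarrow> a i l = Psi i l + (\<Sum>l'<k. a i l' * U l' l)"
    and tri: "\<And>l l'. l < k \<Longrightarrow> l' < k \<Longrightarrow> h l' \<le> h l \<Longrightarrow> U l' l = 0"
  shows "detk r (\<lambda>i j. (if i = j then 1 else 0) + (\<Sum>l<k. a i l * R l j))
       = detk k (\<lambda>l' l. (if l' = l then 1 else 0) + ((\<Sum>i<r. R l' i * Psi i l) - U l' l))"
proof -
  \<comment> \<open>\<open>X\<close> is \<open>1 - U\<close>. The hypothesis reads
    \<open>a X = Psi\<close>, so \<open>(1 + R a) X = X + R Psi\<close>: multiplying by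
    \<open>X\<close> eliminates the unknown \<open>a\<close> without inverting anything.\<close>
  define X where "X = (\<lambda>l' l. (if l' = l then 1 else 0) - U l' l)"
  have X: "detk k X = 1"
    by (rule detk_graded_unitriangular[where h = h]) (auto simp: X_def tri)
  have aX: "(\<Sum>l'<k. a i l' * X l' l) = Psi i l" if "i < r" "l < k" for i l
  proof -
    have "(\<Sum>l'<k. a i l' * X l' l) = (\<Sum>l'<k. (if l' = l then a i l' else 0)) - (\<Sum>l'<k. a i l' * U l' l)"
      unfolding sum_subtractf[symmetric] by (intro sum.cong) (auto simp: X_def algebra_simps)
    then show ?thesis using eq[OF that] that by simp
  qed
  let ?Y = "\<lambda>l' l. (if l' = l then 1 else 0) + (\<Sum>i<r. R l' i * a i l)"
  have "detk r (\<lambda>i j. (if i = j then 1 else 0) + (\<Sum>l<k. a i l * R l j)) = detk k ?Y * detk k X"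
    unfolding X by (simp add: detk_sylvester)
  also have "\<dots> = detk k (\<lambda>i j. \<Sum>l<k. ?Y i l * X l j)"
    by (simp add: detk_mult)
  also have "\<dots> = detk k (\<lambda>l' l. (if l' = l then 1 else 0) + ((\<Sum>i<r. R l' i * Psi i l) - U l' l))"
  proof (rule detk_cong)
    fix i j assume ij: "i < k" "j < k"
    have "(\<Sum>l<k. ?Y i l * X l j) = (\<Sum>l<k. (if l = i then X l j else 0)) + (\<Sum>l<k. \<Sum>m<r. R i m * (a m l * X l j))"
      unfolding sum.distrib[symmetric] by (intro sum.cong) (auto simp: algebra_simps sum_distrib_left)
    also have "(\<Sum>l<k. \<Sum>m<r. R i m * (a m l * X l j)) = (\<Sum>m<r. R i m * Psi m j)"
      by (subst sum.swap) (use ij in \<open>simp add: sum_distrib_left[symmetric] aX\<close>)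
    finally show "(\<Sum>l<k. ?Y i l * X l j) = (if i = j then 1 else 0) + ((\<Sum>m<r. R i m * Psi m j) - U i j)"
      using ij by (simp add: X_def)
  qed
  finally show ?thesis .
qed

lemma tendsto_detk:
  assumes "\<And>i j. i < k \<Longrightarrow> j < k \<Longrightarrow> ((\<lambda>x. M x i j) \<longlongrightarrow> L i j) F"
  shows "((\<lambda>x. detk k (M x)) \<longlongrightarrow> detk k L) F"
  unfolding detk_leibniz
proof (intro tendsto_intros)
  fix p i assume "p \<in> {p. p permutes {0..<k}}" "i \<in> {..<k}"
  then show "((\<lambda>x. M x i (p i)) \<longlongrightarrow> L i (p i)) F"
    using permutes_in_image[of p "{0..<k}" i] by (intro assms) auto
qed

section \<open>Chebyshev polynomials and their inner products\<close>

definition wt :: "real \<Rightarrow> real \<Rightarrow> real" where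
  "wt a x = (1 - x) powr a * sqrt (1 + x)"

text \<open>Continuity is asked only on the segment of integration, since \<open>E\<close> may have
  poles elsewhere in the plane.\<close>

definition nice :: "(complex \<Rightarrow> complex) \<Rightarrow> bool" where
  "nice h \<longleftrightarrow> continuous_on {-1..1} (\<lambda>x::real. h (of_real x))"

lemma niceI: "continuous_on (of_real ` {-1..1::real}) h \<Longrightarrow> nice h"
  unfolding nice_def by (rule continuous_on_compose2[where g = h]) (auto intro!: continuous_intros)

lemma nice_const [simp, intro]: "nice (\<lambda>x. c)"
  and nice_id [simp, intro]: "nice (\<lambda>x. x)"
  and nice_add [simp, intro]: "nice f \<Longrightarrow> nice g \<Longrightarrow> nice (\<lambda>x. f x + g x)"
  and nice_diff [simp, intro]: "nice f \<Longrightarrow> nice g \<Longrightarrow> nice (\<lambda>x. f x - g x)"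
  and nice_minus [simp, intro]: "nice f \<Longrightarrow> nice (\<lambda>x. - f x)"
  and nice_mult [simp, intro]: "nice f \<Longrightarrow> nice g \<Longrightarrow> nice (\<lambda>x. f x * g x)"
  and nice_power [simp, intro]: "nice f \<Longrightarrow> nice (\<lambda>x. f x ^ n)"
  unfolding nice_def by (auto intro!: continuous_intros)

lemma nice_sum [simp, intro]: "(\<And>i. i \<in> I \<Longrightarrow> nice (f i)) \<Longrightarrow> nice (\<lambda>x. \<Sum>i\<in>I. f i x)"
  unfolding nice_def by (auto intro!: continuous_intros)

lemma holomorphic_chebJ: "chebJ s a holomorphic_on A"
proof (induction s a "0::complex" rule: chebJ.induct)
  case (3 k a)
  have "(\<lambda>x. 2 * x * chebJ (Suc k) a x - chebJ k a x) holomorphic_on A"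
    by (intro holomorphic_intros 3)
  moreover have "chebJ (Suc (Suc k)) a = (\<lambda>x. 2 * x * chebJ (Suc k) a x - chebJ k a x)"
    by (rule ext) simp
  ultimately show ?case by simp
next
  case (1 a)
  have "chebJ 0 a = (\<lambda>x. 1)" by (rule ext) simp
  then show ?case by simp
next
  case (2 a)
  have "chebJ (Suc 0) a = (\<lambda>x. if a = 1/2 then 2 * x else 2 * x - 1)" by (rule ext) simp
  moreover have "(\<lambda>x::complex. if a = 1/2 then 2 * x else 2 * x - 1) holomorphic_on A"
    by (cases "a = 1/2") (auto intro!: holomorphic_intros)
  ultimately show ?case by simp
qed

lemma nice_chebJ [simp, intro]: "nice (chebJ s a)"
  by (intro niceI holomorphic_on_imp_continuous_on holomorphic_chebJ)

lemma chebJ_of_real: "chebJ s a (of_real x) = of_real (Re (chebJ s a (of_real x)))"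
proof -
  have "chebJ s a (of_real x) \<in> \<real>"
    by (induction s a "0::complex" rule: chebJ.induct) auto
  then show ?thesis by (metis of_real_Re)
qed

section \<open>Integrability of the two weights\<close>

lemma wt_nonneg: "x \<in> {-1..1} \<Longrightarrow> 0 \<le> wt a x"
  by (simp add: wt_def)

lemma wt_half: "x \<le> 1 \<Longrightarrow> wt (1/2) x = (1 - x) * wt (-1/2) x"
proof (cases "x = 1")
  case False
  assume "x \<le> 1"
  then have "(1 - x) powr (1/2) = (1 - x) powr (1 + (-1/2))" by simp
  also have "\<dots> = (1 - x) * (1 - x) powr (-1/2)"
    unfolding powr_add using False \<open>x \<le> 1\<close> by simp
  finally show ?thesis by (simp add: wt_def)
qed (simp add: wt_def)

lemma wt_minus_half:
  "set_integrable lborel {-1..1} (wt (-1/2))"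
  "(LINT x:{-1..1}|lborel. wt (-1/2) x) = pi"
proof -
  \<comment> \<open>The weight equals \<open>(1 + x) / sqrt (1 - x^2)\<close>, hence this primitive.
    It is continuous up to \<open>x = 1\<close>, where the weight is unbounded; its increment
    \<open>pi\<close> is that of \<open>arcsin\<close>.\<close>
  define F where "F = (\<lambda>x::real. arcsin x - sqrt (1 - x^2))"
  have deriv: "(F has_real_derivative wt (-1/2) x) (at x)" if "-1 < x" "x < 1" for x
  proof -
    have x2: "x^2 < 1" using that by (simp add: power_less_one_iff abs_square_less_1 abs_less_iff)
    have eq: "wt (-1/2) x = 1 / sqrt (1 - x^2) + x / sqrt (1 - x^2)"
    proof -
      have "sqrt (1 - x^2) = sqrt (1 - x) * sqrt (1 + x)"
        by (simp add: real_sqrt_mult[symmetric] power2_eq_square algebra_simps)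
      moreover have "(1 - x) powr (-1/2) = 1 / sqrt (1 - x)"
        using that powr_minus[of "1 - x" "1/2"] by (simp add: powr_half_sqrt inverse_eq_divide)
      moreover have "(1 + x) / sqrt (1 + x) = sqrt (1 + x)"
        using that by (simp add: real_div_sqrt)
      ultimately show ?thesis using that
        unfolding wt_def add_divide_distrib[symmetric] by (metis divide_divide_eq_left mult.commute mult_1 times_divide_eq_left)
    qed
    show ?thesis unfolding F_def eq using that x2
      by (auto intro!: derivative_eq_intros simp: field_simps)
  qed
  have lims: "((F \<circ> real_of_ereal) \<longlongrightarrow> -(pi/2)) (at_right (ereal (-1)))" "((F \<circ> real_of_ereal) \<longlongrightarrow> pi/2) (at_left (ereal 1))"
  proof -
    have c: "continuous_on {-1..1} F"
      unfolding F_def by (intro continuous_intros) auto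
    have 1: "(F \<longlongrightarrow> F (-1)) (at_right (-1))" "(F \<longlongrightarrow> F 1) (at_left 1)"
      using c by (auto simp: continuous_on_Icc_at_rightD continuous_on_Icc_at_leftD)
    have 2: "F (-1) = - (pi/2)" "F 1 = pi/2" by (auto simp: F_def)
    show "((F \<circ> real_of_ereal) \<longlongrightarrow> -(pi/2)) (at_right (ereal (-1)))" "((F \<circ> real_of_ereal) \<longlongrightarrow> pi/2) (at_left (ereal 1))"
      using 1 unfolding ereal_tendsto_simps1 2 .
  qed
  have cont: "isCont (wt (-1/2)) x" if "-1 < x" "x < 1" for x
    unfolding wt_def using that by (intro continuous_intros) auto
  have nn: "AE x in lborel. ereal (-1) < ereal x \<longrightarrow> ereal x < ereal 1 \<longrightarrow> 0 \<le> wt (-1/2) x"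
    by (rule AE_I2) (auto intro!: wt_nonneg)
  have lt: "ereal (-1) < ereal 1" by simp
  have d: "ereal (-1) < ereal x \<Longrightarrow> ereal x < ereal 1 \<Longrightarrow> (F has_real_derivative wt (-1/2) x) (at x)" for x
    using deriv by simp
  have c: "ereal (-1) < ereal x \<Longrightarrow> ereal x < ereal 1 \<Longrightarrow> isCont (wt (-1/2)) x" for x
    using cont by simp
  note main = interval_integral_FTC_nonneg[OF lt d c nn lims]
  have e: "einterval (ereal (-1)) (ereal 1) = {-1<..<1::real}"
    by (auto simp: einterval_def)
  have "AE x in lborel. x \<noteq> (1::real) \<and> x \<noteq> -1"
    by (intro AE_conjI AE_lborel_singleton)
  then have ae: "AE x in lborel. indicat_real {-1<..<1} x *\<^sub>R wt (-1/2) x = indicat_real {-1..1} x *\<^sub>R wt (-1/2) x"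
    by eventually_elim (auto simp: indicator_def)
  have m: "wt (-1/2) \<in> borel_measurable borel" unfolding wt_def by measurable
  show "set_integrable lborel {-1..1} (wt (-1/2))"
    using main(1) integrable_cong_AE[OF _ _ ae] m unfolding e set_integrable_def by simp
  have "(LINT x:{-1..1}|lborel. wt (-1/2) x) = (LINT x:{-1<..<1}|lborel. wt (-1/2) x)"
    unfolding set_lebesgue_integral_def by (rule integral_cong_AE[symmetric]) (use m ae in simp_all)
  also have "\<dots> = pi"
    using main(2) unfolding interval_lebesgue_integral_def e by simp
  finally show "(LINT x:{-1..1}|lborel. wt (-1/2) x) = pi" .
qed

lemma wt_integrable:
  assumes "a \<in> {1/2, -1/2}"
  shows "set_integrable lborel {-1..1} (wt a)"
proof (cases "a = 1/2")
  case True
  have "set_integrable lborel {-1..1} (\<lambda>x::real. sqrt (1 - x) * sqrt (1 + x))"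
    by (intro borel_integrable_atLeastAtMost' continuous_intros)
  moreover have "wt a x = sqrt (1 - x) * sqrt (1 + x)" if "x \<in> {-1..1}" for x
    using that by (simp add: True wt_def powr_half_sqrt)
  ultimately show ?thesis
    by (subst set_integrable_cong[OF refl refl]) auto
qed (use assms wt_minus_half in auto)

lemma wt_nice_integrable:
  assumes a: "a \<in> {1/2, -1/2}" and h: "nice h"
  shows "set_integrable lborel {-1..1} (\<lambda>x. h (of_real x) * of_real (wt a x))"
proof -
  have c: "continuous_on {-1..1} (\<lambda>x::real. h (of_real x))" using h by (simp add: nice_def)
  then have "bounded ((\<lambda>x::real. h (of_real x)) ` {-1..1})"
    by (intro compact_imp_bounded compact_continuous_image) auto
  then obtain B where B: "\<And>x. x \<in> {-1..1::real} \<Longrightarrow> norm (h (of_real x)) \<le> B"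
    unfolding bounded_iff by (metis imageI)
  have m1: "(\<lambda>x. indicator {-1..1} x *\<^sub>R h (of_real x)) \<in> borel_measurable borel"
    by (rule borel_measurable_continuous_on_indicator) (use c in auto)
  have m2: "wt a \<in> borel_measurable borel" unfolding wt_def by measurable
  have m: "(\<lambda>x. (indicator {-1..1} x *\<^sub>R h (of_real x)) * of_real (wt a x)) \<in> borel_measurable borel"
    using m1 m2 by measurable
  have "set_integrable lborel {-1..1} (\<lambda>x. B * wt a x)"
    using wt_integrable[OF a] by simp
  then show ?thesis
    unfolding set_integrable_def
    by (rule Bochner_Integration.integrable_bound)
      (use m in \<open>simp_all\<close>, auto simp: indicator_def norm_mult abs_mult wt_nonneg intro!: AE_I2 mult_mono order_trans[OF B])
qed

text \<open>The constant gives both weights, \<open>a = 1/2\<close> and \<open>a = -1/2\<close>,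
  total mass 1.\<close>

definition Lp :: "real \<Rightarrow> (complex \<Rightarrow> complex) \<Rightarrow> complex" where
  "Lp a h = complex_of_real (2 powr (a + 1/2) / pi) *
     (LINT x:{-1..1}|lborel. h (of_real x) * of_real (wt a x))"

lemma ip_eq_Lp: "ip a f g = Lp a (\<lambda>x. f x * g x)"
  by (simp add: ip_def Lp_def wt_def)

lemma Lp_cong:
  assumes "\<And>x. x \<in> {-1..1::real} \<Longrightarrow> f (of_real x) = g (of_real x)"
  shows "Lp a f = Lp a g"
  unfolding Lp_def using assms by (intro arg_cong2[where f="(*)"] refl set_lebesgue_integral_cong) auto

context
  fixes a :: real assumes a: "a \<in> {1/2, -1/2}"
begin

lemma Lp_add: "nice f \<Longrightarrow> nice g \<Longrightarrow> Lp a (\<lambda>x. f x + g x) = Lp a f + Lp a g"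
  using wt_nice_integrable[OF a, of f] wt_nice_integrable[OF a, of g]
  by (simp add: Lp_def distrib_right set_integral_add(2) distrib_left)

lemma Lp_cmult: "Lp a (\<lambda>x. c * f x) = c * Lp a f"
  by (simp add: Lp_def mult.assoc set_integral_mult_right mult.left_commute)

lemma Lp_diff: "nice f \<Longrightarrow> nice g \<Longrightarrow> Lp a (\<lambda>x. f x - g x) = Lp a f - Lp a g"
  using Lp_add[of f "\<lambda>x. (-1) * g x"] Lp_cmult[of "-1" g] by simp

lemma Lp_zero: "Lp a (\<lambda>x. 0) = 0"
  by (simp add: Lp_def)

lemma Lp_sum: "finite I \<Longrightarrow> (\<And>i. i \<in> I \<Longrightarrow> nice (f i)) \<Longrightarrow> Lp a (\<lambda>x. \<Sum>i\<in>I. f i x) = (\<Sum>i\<in>I. Lp a (f i))"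
  by (induction I rule: finite_induct) (simp_all add: Lp_zero Lp_add nice_sum)

end

lemma Lp_half: "Lp (1/2) h = Lp (-1/2) (\<lambda>x. 2 * (1 - x) * h x)"
proof -
  have "(LINT x:{-1..1}|lborel. h (of_real x) * of_real (wt (1/2) x))
      = (LINT x:{-1..1}|lborel. (1 - of_real x) * h (of_real x) * of_real (wt (-1/2) x))"
    by (intro set_lebesgue_integral_cong) (auto simp: wt_half)
  moreover have "(LINT x:{-1..1}|lborel. 2 * (1 - of_real x) * h (of_real x) * of_real (wt (-1/2) x))
      = 2 * (LINT x:{-1..1}|lborel. (1 - of_real x) * h (of_real x) * of_real (wt (-1/2) x))"
    by (subst set_integral_mult_right[symmetric]) (simp only: mult.assoc)
  ultimately show ?thesis by (simp add: Lp_def)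
qed

section \<open>Connection formulas and orthonormality of the two Chebyshev families\<close>

lemma three_term_unique:
  fixes f g :: "nat \<Rightarrow> complex"
  assumes "f 0 = g 0" "f (Suc 0) = g (Suc 0)"
    and "\<And>k. f (Suc (Suc k)) = 2 * x * f (Suc k) - f k"
    and "\<And>k. g (Suc (Suc k)) = 2 * x * g (Suc k) - g k"
  shows "f k = g k"
  using assms by (induction k rule: induct_nat_012) simp_all

text \<open>Together with \<open>chebJ_W_U\<close> this is the analytic form of branching: after
  integration, coefficients at one level become differences of coefficients for the adjacent weight.
  With \<open>x = cos t\<close> the two families are \<open>sin ((s + 1) t) / sin t\<close> and
  \<open>cos ((s + 1/2) t) / cos (t / 2)\<close>.\<close>

lemma chebJ_U_W: "2 * (1 - x) * chebJ s (1/2) x = chebJ s (-1/2) x - chebJ (Suc s) (-1/2) x"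
  by (rule three_term_unique[where x = x]) (simp_all, simp_all add: algebra_simps power2_eq_square)

lemma chebJ_W_U: "chebJ (Suc s) (-1/2) x = chebJ (Suc s) (1/2) x - chebJ s (1/2) x"
  by (rule three_term_unique[where x = x and f = "\<lambda>s. chebJ (Suc s) (-1/2) x"]) (simp_all, simp_all add: algebra_simps)

lemma chebU_sin: "chebJ s (1/2) (of_real (cos t)) * of_real (sin t) = of_real (sin (real (Suc s) * t))"
proof (induction s rule: induct_nat_012)
  case 1
  show ?case by (simp add: sin_double)
next
  case (ge2 s)
  have "sin (real (Suc (Suc (Suc s))) * t) = 2 * cos t * sin (real (Suc (Suc s)) * t) - sin (real (Suc s) * t)"
  proof -
    have *: "real (Suc (Suc (Suc s))) * t = real (Suc (Suc s)) * t + t" "real (Suc s) * t = real (Suc (Suc s)) * t - t"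
      by (simp_all add: algebra_simps)
    show ?thesis unfolding * sin_add sin_diff by simp
  qed
  then show ?case using ge2 by (simp add: left_diff_distrib mult.assoc)
qed simp

lemma Lp_chebU: "Lp (1/2) (chebJ s (1/2)) = (if s = 0 then 1 else 0)"
proof -
  \<comment> \<open>With \<open>x = cos t\<close> the integrand is \<open>sin ((s + 1) t)\<close>,
    and \<open>dx\<close> brings another \<open>sin t\<close>; the product formula yields this
    primitive. For \<open>s = 0\<close> the term \<open>sin (s t) / s\<close> is replaced by its
    limit \<open>t\<close>.\<close>
  define h where "h = (\<lambda>x. if s = 0 then -(1/2) * (arccos x - sin (2 * arccos x) / 2)
     else -(1/2) * (sin (real s * arccos x) / real s - sin (real (s+2) * arccos x) / real (s+2)))"
  define f where "f = (\<lambda>x. sin (real (Suc s) * arccos x))"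
  have "(f has_integral (h 1 - h (-1))) {-1..1}"
  proof (rule fundamental_theorem_of_calculus_interior)
    show "continuous_on {-1..1} h"
      unfolding h_def by (cases "s = 0") (auto intro!: continuous_intros)
    fix x :: real assume x: "x \<in> {-1<..<1}"
    define t where "t = arccos x"
    have s0: "sqrt (1 - x^2) \<noteq> 0" using x
      by (auto simp: power2_eq_1_iff)
    have st: "sin t = sqrt (1 - x^2)" using x by (simp add: t_def sin_arccos_abs sin_arccos)
    have cs: "cos (real s * t) - cos (real (s+2) * t) = 2 * sin (real (Suc s) * t) * sin t"
    proof -
      have "real s * t = real (Suc s) * t - t" "real (s+2) * t = real (Suc s) * t + t"
        by (simp_all add: algebra_simps)
      then show ?thesis by (simp only: cos_add cos_diff)
    qed
    have "(h has_real_derivative f x) (at x)"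
    proof (cases "s = 0")
      case True
      then have "(h has_real_derivative (-(1/2) * (inverse (- sqrt (1 - x^2)) - cos (2 * t) * (2 * inverse (- sqrt (1 - x^2))) / 2))) (at x)"
        unfolding h_def using x s0 by (auto intro!: derivative_eq_intros simp: t_def)
      moreover have "-(1/2) * (inverse (- sqrt (1 - x^2)) - cos (2 * t) * (2 * inverse (- sqrt (1 - x^2))) / 2) = f x"
        using cs s0 st True by (simp add: f_def t_def[symmetric] field_simps)
      ultimately show ?thesis by simp
    next
      case False
      then have "(h has_real_derivative (-(1/2) * (cos (real s * t) * inverse (- sqrt (1 - x^2))
            - cos (real (s+2) * t) * inverse (- sqrt (1 - x^2))))) (at x)"
        unfolding h_def using x s0 by (auto intro!: derivative_eq_intros simp: t_def)
      moreover have "-(1/2) * (cos (real s * t) * inverse (- sqrt (1 - x^2))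
            - cos (real (s+2) * t) * inverse (- sqrt (1 - x^2))) = (1/2) * (cos (real s * t) - cos (real (s+2) * t)) / sqrt (1 - x^2)"
        using s0 by (simp add: field_simps)
      moreover have "\<dots> = f x"
        unfolding cs using s0 st by (simp add: f_def t_def[symmetric])
      ultimately show ?thesis by simp
    qed
    then show "(h has_vector_derivative f x) (at x)"
      by (simp add: has_real_derivative_iff_has_vector_derivative)
  qed simp
  moreover have "set_integrable lborel {-1..1} f"
    unfolding f_def by (intro borel_integrable_atLeastAtMost' continuous_intros) auto
  ultimately have "(LINT x:{-1..1}|lborel. f x) = h 1 - h (-1)"
    using set_borel_integral_eq_integral(2)[of "{-1..1}" f] by (simp add: integral_unique)
  also have "\<dots> = (if s = 0 then pi / 2 else 0)"
    by (auto simp: h_def sin_npi) (metis mult.commute of_nat_Suc sin_npi add.commute add_2_eq_Suc' of_nat_add of_nat_numeral)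
  finally have *: "(LINT x:{-1..1}|lborel. f x) = (if s = 0 then pi / 2 else 0)" .
  have "chebJ s (1/2) (of_real x) * of_real (wt (1/2) x) = of_real (f x)" if "x \<in> {-1..1}" for x
  proof -
    have "wt (1/2) x = sin (arccos x)"
      using that by (simp add: wt_def powr_half_sqrt sin_arccos real_sqrt_mult[symmetric] power2_eq_square algebra_simps)
    then show ?thesis using chebU_sin[of s "arccos x"] that by (simp add: f_def)
  qed
  then have "(LINT x:{-1..1}|lborel. chebJ s (1/2) (of_real x) * of_real (wt (1/2) x)) = (LINT x:{-1..1}|lborel. complex_of_real (f x))"
    by (intro set_lebesgue_integral_cong) auto
  also have "\<dots> = of_real (LINT x:{-1..1}|lborel. f x)"
    by (simp add: set_integral_complex_of_real)
  finally show ?thesis unfolding Lp_def * by simp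
qed

text \<open>The integrated connection formula relates consecutive \<open>s\<close>, so only the
  total mass of the weight has to be computed directly.\<close>

lemma Lp_chebW: "Lp (-1/2) (chebJ s (-1/2)) = (if s = 0 then 1 else 0)"
proof (induction s)
  case 0
  have "(LINT x:{-1..1}|lborel. complex_of_real (wt (-1/2) x)) = of_real pi"
    using wt_minus_half(2) by (simp add: set_integral_complex_of_real)
  then show ?case by (simp add: Lp_def)
next
  case (Suc s)
  have "Lp (1/2) (chebJ s (1/2)) = Lp (-1/2) (\<lambda>x. chebJ s (-1/2) x - chebJ (Suc s) (-1/2) x)"
    unfolding Lp_half chebJ_U_W ..
  also have "\<dots> = Lp (-1/2) (chebJ s (-1/2)) - Lp (-1/2) (chebJ (Suc s) (-1/2))"
    by (rule Lp_diff) auto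
  finally show ?case using Suc by (simp add: Lp_chebU split: if_splits)
qed

lemma Lp_cheb: "a \<in> {1/2, -1/2} \<Longrightarrow> Lp a (chebJ s a) = (if s = 0 then 1 else 0)"
  by (elim insertE emptyE) (simp_all only: Lp_chebU Lp_chebW)

lemma Lp_orthonormal:
  assumes a: "a \<in> {1/2, -1/2}"
  shows "Lp a (\<lambda>x. chebJ s a x * chebJ t a x) = (if s = t then 1 else 0)"
proof (induction t arbitrary: s rule: induct_nat_012)
  case 0
  then show ?case using Lp_cheb[OF a] by simp
next
  case 1
  show ?case
  proof (cases s)
    case 0
    then show ?thesis using Lp_cheb[OF a, of "Suc 0"] by (simp only: chebJ.simps(1) mult_1_left One_nat_def) simp
  next
    case (Suc r)
    \<comment> \<open>The first polynomial is \<open>2 * x - e\<close>, so multiplying by it is the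
      three-term recurrence with a correction by \<open>e\<close>.\<close>
    define e :: complex where "e = (if a = 1/2 then 0 else 1)"
    have "(\<lambda>x. chebJ s a x * chebJ 1 a x) = (\<lambda>x. chebJ (Suc s) a x + chebJ r a x - e * chebJ s a x)"
      by (auto simp: Suc e_def fun_eq_iff algebra_simps)
    then have "Lp a (\<lambda>x. chebJ s a x * chebJ 1 a x) = Lp a (chebJ (Suc s) a) + Lp a (chebJ r a) - e * Lp a (chebJ s a)"
      by (simp add: Lp_diff[OF a] Lp_add[OF a] Lp_cmult[OF a] nice_add nice_mult)
    then show ?thesis unfolding Lp_cheb[OF a] using Suc by auto
  qed
next
  case (ge2 t)
  show ?case
  proof (cases s)
    case 0
    then show ?thesis using Lp_cheb[OF a, of "Suc (Suc t)"] by (simp only: chebJ.simps(1) mult_1_left) simp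
  next
    case (Suc r)
    have "(\<lambda>x. chebJ s a x * chebJ (Suc (Suc t)) a x) = (\<lambda>x. chebJ (Suc s) a x * chebJ (Suc t) a x + chebJ r a x * chebJ (Suc t) a x - chebJ s a x * chebJ t a x)"
      by (auto simp: Suc fun_eq_iff algebra_simps)
    then have "Lp a (\<lambda>x. chebJ s a x * chebJ (Suc (Suc t)) a x) = Lp a (\<lambda>x. chebJ (Suc s) a x * chebJ (Suc t) a x) + Lp a (\<lambda>x. chebJ r a x * chebJ (Suc t) a x) - Lp a (\<lambda>x. chebJ s a x * chebJ t a x)"
      by (simp only: Lp_diff[OF a] Lp_add[OF a] nice_add nice_mult nice_chebJ)
    then show ?thesis unfolding ge2 using Suc by auto
  qed
qed

section \<open>Decay of Chebyshev coefficients of continuous functions\<close>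

lemma Lp_power_eq_0:
  assumes a: "a \<in> {1/2, -1/2}" and "n < s"
  shows "Lp a (\<lambda>x. chebJ s a x * x ^ n) = 0"
  using assms(2)
proof (induction n arbitrary: s)
  case 0
  then show ?case using Lp_cheb[OF a] by simp
next
  case (Suc n)
  then obtain r where r: "s = Suc r" "n < r" by (cases s) auto
  have "(\<lambda>x. chebJ s a x * x ^ Suc n) = (\<lambda>x. (1/2) * (chebJ (Suc s) a x * x ^ n + chebJ r a x * x ^ n))"
    by (auto simp: r fun_eq_iff algebra_simps)
  then have "Lp a (\<lambda>x. chebJ s a x * x ^ Suc n) = (1/2) * (Lp a (\<lambda>x. chebJ (Suc s) a x * x ^ n) + Lp a (\<lambda>x. chebJ r a x * x ^ n))"
    by (simp only: Lp_cmult[OF a] Lp_add[OF a] nice_mult nice_chebJ nice_power nice_id)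
  then show ?case using Suc.IH[of r] Suc.IH[of "Suc s"] r by simp
qed

text \<open>The bound must not depend on \<open>s\<close>. It comes from
  \<open>2 |J| <= 1 + J^2\<close>, since \<open>1\<close> and \<open>J^2\<close> both integrate to 1
  against the normalized weight.\<close>

lemma norm_Lp_chebJ_le:
  assumes a: "a \<in> {1/2, -1/2}" and h: "nice h"
    and B: "\<And>x. x \<in> {-1..1::real} \<Longrightarrow> norm (h (of_real x)) \<le> B"
  shows "norm (Lp a (\<lambda>x. chebJ s a x * h x)) \<le> B"
proof -
  let ?c = "2 powr (a + 1/2) / pi"
  let ?J = "\<lambda>x. Re (chebJ s a (of_real x))"
  have B0: "0 \<le> B" by (rule order_trans[OF norm_ge_zero B[of 0]]) simp
  have i1: "set_integrable lborel {-1..1} (wt a)" by (rule wt_integrable[OF a])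
  have "set_integrable lborel {-1..1} (\<lambda>x. chebJ s a (of_real x) * chebJ s a (of_real x) * of_real (wt a x))"
    by (rule wt_nice_integrable[OF a]) auto
  then have "set_integrable lborel {-1..1} (\<lambda>x. complex_of_real (?J x * ?J x * wt a x))"
    by (simp only: of_real_mult chebJ_of_real[symmetric])
  then have i2: "set_integrable lborel {-1..1} (\<lambda>x. ?J x * ?J x * wt a x)"
    by (simp only: set_integrable_def scaleR_conv_of_real of_real_mult[symmetric] complex_of_real_integrable_eq) simp
  have v1: "?c * (LINT x:{-1..1}|lborel. wt a x) = 1"
  proof -
    have "complex_of_real (?c * (LINT x:{-1..1}|lborel. wt a x)) = Lp a (\<lambda>x. 1)"
      by (simp add: Lp_def set_integral_complex_of_real)
    also have "\<dots> = 1" using Lp_cheb[OF a, of 0] by (simp add: chebJ.simps(1)[abs_def])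
    finally show ?thesis by (metis of_real_eq_1_iff)
  qed
  have v2: "?c * (LINT x:{-1..1}|lborel. ?J x * ?J x * wt a x) = 1"
  proof -
    have "complex_of_real (?c * (LINT x:{-1..1}|lborel. ?J x * ?J x * wt a x)) 
       = of_real ?c * (LINT x:{-1..1}|lborel. complex_of_real (?J x * ?J x * wt a x))"
      by (simp only: of_real_mult[of ?c] set_integral_complex_of_real)
    also have "\<dots> = Lp a (\<lambda>x. chebJ s a x * chebJ s a x)"
      by (simp only: Lp_def of_real_mult chebJ_of_real[symmetric])
    also have "\<dots> = 1" using Lp_orthonormal[OF a, of s s] by simp
    finally show ?thesis by (metis of_real_eq_1_iff)
  qed
  have i3: "set_integrable lborel {-1..1} (\<lambda>x. chebJ s a (of_real x) * h (of_real x) * of_real (wt a x))"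
    using h by (intro wt_nice_integrable[OF a]) auto
  have "norm (LINT x:{-1..1}|lborel. chebJ s a (of_real x) * h (of_real x) * of_real (wt a x))
     \<le> (LINT x:{-1..1}|lborel. norm (chebJ s a (of_real x) * h (of_real x) * of_real (wt a x)))"
    by (rule set_integral_norm_bound[OF i3])
  also have "\<dots> \<le> (LINT x:{-1..1}|lborel. B / 2 * wt a x + B / 2 * (?J x * ?J x * wt a x))"
  proof (rule set_integral_mono)
    show "set_integrable lborel {-1..1} (\<lambda>x. norm (chebJ s a (of_real x) * h (of_real x) * of_real (wt a x)))"
      using set_integrable_norm[OF i3] .
    show "set_integrable lborel {-1..1} (\<lambda>x. B / 2 * wt a x + B / 2 * (?J x * ?J x * wt a x))"
      using i1 i2 by (intro set_integral_add set_integrable_mult_right) auto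
    fix x :: real assume x: "x \<in> {-1..1}"
    have j: "norm (chebJ s a (of_real x)) = \<bar>?J x\<bar>"
      by (subst chebJ_of_real) simp
    have "\<bar>?J x\<bar> \<le> (1 + ?J x * ?J x) / 2"
      using zero_le_power2[of "\<bar>?J x\<bar> - 1"] by (simp add: power2_eq_square algebra_simps)
    then have "norm (chebJ s a (of_real x)) * norm (h (of_real x)) * wt a x \<le> (1 + ?J x * ?J x) / 2 * B * wt a x"
      unfolding j using B[OF x] wt_nonneg[OF x, of a] B0 by (intro mult_mono mult_right_mono) auto
    then show "norm (chebJ s a (of_real x) * h (of_real x) * of_real (wt a x)) \<le> B / 2 * wt a x + B / 2 * (?J x * ?J x * wt a x)"
      using wt_nonneg[OF x, of a] by (simp add: norm_mult field_simps)
  qed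
  also have "\<dots> = B / 2 * (LINT x:{-1..1}|lborel. wt a x) + B / 2 * (LINT x:{-1..1}|lborel. ?J x * ?J x * wt a x)"
    using i1 i2 by (subst set_integral_add(2)) (auto intro!: set_integrable_mult_right)
  finally have "?c * norm (LINT x:{-1..1}|lborel. chebJ s a (of_real x) * h (of_real x) * of_real (wt a x))
    \<le> ?c * (B / 2 * (LINT x:{-1..1}|lborel. wt a x) + B / 2 * (LINT x:{-1..1}|lborel. ?J x * ?J x * wt a x))"
    by (intro mult_left_mono) auto
  also have "\<dots> = B / 2 * (?c * (LINT x:{-1..1}|lborel. wt a x)) + B / 2 * (?c * (LINT x:{-1..1}|lborel. ?J x * ?J x * wt a x))"
    by (simp only: algebra_simps)
  also have "\<dots> = B" unfolding v1 v2 by simp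
  finally show ?thesis by (simp add: Lp_def norm_mult norm_divide)
qed

text \<open>Approximate \<open>h\<close> uniformly by a polynomial: its coefficients vanish beyond
  the degree, and those of the error are small uniformly in \<open>s\<close> by
  \<open>norm_Lp_chebJ_le\<close>. The convergence of the tail sums in the descent rests on
  this.\<close>

lemma Lp_chebJ_tendsto_0:
  assumes a: "a \<in> {1/2, -1/2}" and h: "nice h"
  shows "(\<lambda>s. Lp a (\<lambda>x. chebJ s a x * h x)) \<longlonglongrightarrow> 0"
proof (rule LIMSEQ_I)
  fix e :: real assume e: "0 < e"
  have "continuous_on {-1..1} (\<lambda>x::real. h (of_real x))" using h by (simp add: nice_def)
  from Stone_Weierstrass_polynomial_function[OF _ this, of "e/2"] obtain g where
    g: "polynomial_function g" "\<And>x. x \<in> {-1..1::real} \<Longrightarrow> norm (h (of_real x) - g x) < e / 2"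
    using e by auto
  have "real_polynomial_function (\<lambda>x. Re (g x))" "real_polynomial_function (\<lambda>x. Im (g x))"
    using g(1) unfolding polynomial_function_def by (auto simp: o_def intro: bounded_linear_Re bounded_linear_Im)
  then obtain A n B m where "(\<lambda>x. Re (g x)) = (\<lambda>x. \<Sum>i\<le>n. A i * x ^ i)" "(\<lambda>x. Im (g x)) = (\<lambda>x. \<Sum>i\<le>m. B i * x ^ i)"
    unfolding real_polynomial_function_iff_sum by blast
  then have AB: "\<And>x. Re (g x) = (\<Sum>i\<le>n. A i * x ^ i)" "\<And>x. Im (g x) = (\<Sum>i\<le>m. B i * x ^ i)"
    by (simp_all add: fun_eq_iff)
  define P where "P = (\<lambda>x::complex. (\<Sum>i\<le>n. of_real (A i) * x ^ i) + \<i> * (\<Sum>i\<le>m. of_real (B i) * x ^ i))"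
  have gP: "g x = P (of_real x)" for x
    by (simp add: P_def complex_eq_iff AB flip: of_real_power of_real_mult of_real_sum)
  have nP: "nice P" unfolding P_def by auto
  have 0: "Lp a (\<lambda>x. chebJ s a x * P x) = 0" if "s > max n m" for s
  proof -
    have "(\<lambda>x. chebJ s a x * P x) = (\<lambda>x. (\<Sum>i\<le>n. of_real (A i) * (chebJ s a x * x ^ i)) + \<i> * (\<Sum>i\<le>m. of_real (B i) * (chebJ s a x * x ^ i)))"
      by (simp add: P_def fun_eq_iff sum_distrib_left algebra_simps)
    then have "Lp a (\<lambda>x. chebJ s a x * P x) = (\<Sum>i\<le>n. of_real (A i) * Lp a (\<lambda>x. chebJ s a x * x ^ i)) + \<i> * (\<Sum>i\<le>m. of_real (B i) * Lp a (\<lambda>x. chebJ s a x * x ^ i))"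
      by (simp add: Lp_add[OF a] Lp_cmult[OF a] Lp_sum[OF a])
    then show ?thesis using that by (simp add: Lp_power_eq_0[OF a])
  qed
  show "\<exists>no. \<forall>s\<ge>no. norm (Lp a (\<lambda>x. chebJ s a x * h x) - 0) < e"
  proof (intro exI allI impI)
    fix s assume s: "Suc (max n m) \<le> s"
    have "(\<lambda>x. chebJ s a x * h x) = (\<lambda>x. chebJ s a x * (h x - P x) + chebJ s a x * P x)"
      by (simp add: fun_eq_iff algebra_simps)
    then have "Lp a (\<lambda>x. chebJ s a x * h x) = Lp a (\<lambda>x. chebJ s a x * (h x - P x)) + Lp a (\<lambda>x. chebJ s a x * P x)"
      using h nP by (simp only: Lp_add[OF a] nice_mult nice_chebJ nice_diff)
    also have "Lp a (\<lambda>x. chebJ s a x * P x) = 0" by (intro 0) (use s in linarith)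
    finally have "Lp a (\<lambda>x. chebJ s a x * h x) = Lp a (\<lambda>x. chebJ s a x * (h x - P x))" by simp
    moreover have "norm (Lp a (\<lambda>x. chebJ s a x * (h x - P x))) \<le> e / 2"
      using h nP g(2) by (intro norm_Lp_chebJ_le[OF a]) (auto simp: gP less_imp_le)
    ultimately show "norm (Lp a (\<lambda>x. chebJ s a x * h x) - 0) < e" using e by simp
  qed
qed

lemma Lp_U_telescope:
  assumes "nice h"
  shows "Lp (1/2) (\<lambda>x. chebJ s (1/2) x * h x)
       = Lp (-1/2) (\<lambda>x. chebJ s (-1/2) x * h x) - Lp (-1/2) (\<lambda>x. chebJ (Suc s) (-1/2) x * h x)"
proof -
  have "Lp (1/2) (\<lambda>x. chebJ s (1/2) x * h x) = Lp (-1/2) (\<lambda>x. 2 * (1 - x) * chebJ s (1/2) x * h x)"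
    unfolding Lp_half by (simp only: mult.assoc)
  also have "\<dots> = Lp (-1/2) (\<lambda>x. chebJ s (-1/2) x * h x - chebJ (Suc s) (-1/2) x * h x)"
    unfolding chebJ_U_W by (simp only: left_diff_distrib)
  also have "\<dots> = Lp (-1/2) (\<lambda>x. chebJ s (-1/2) x * h x) - Lp (-1/2) (\<lambda>x. chebJ (Suc s) (-1/2) x * h x)"
    using assms by (intro Lp_diff) auto
  finally show ?thesis .
qed

text \<open>The second identity is the first continued to index -1, where the polynomial of the
  second kind is 0; it is the boundary term at position 0.\<close>

lemma Lp_W_telescope:
  assumes "nice h"
  shows "Lp (-1/2) (\<lambda>x. chebJ (Suc s) (-1/2) x * (2 * (x - 1) * h x))
       = Lp (1/2) (\<lambda>x. chebJ s (1/2) x * h x) - Lp (1/2) (\<lambda>x. chebJ (Suc s) (1/2) x * h x)"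
    "Lp (-1/2) (\<lambda>x. chebJ 0 (-1/2) x * (2 * (x - 1) * h x)) = - Lp (1/2) (\<lambda>x. chebJ 0 (1/2) x * h x)"
proof -
  have "Lp (1/2) (\<lambda>x. chebJ s (1/2) x * h x) - Lp (1/2) (\<lambda>x. chebJ (Suc s) (1/2) x * h x)
      = Lp (1/2) (\<lambda>x. chebJ s (1/2) x * h x - chebJ (Suc s) (1/2) x * h x)"
    using assms by (intro Lp_diff[symmetric]) auto
  also have "\<dots> = Lp (-1/2) (\<lambda>x. chebJ (Suc s) (-1/2) x * (2 * (x - 1) * h x))"
    unfolding Lp_half chebJ_W_U by (rule Lp_cong) (simp only: algebra_simps)
  finally show "Lp (-1/2) (\<lambda>x. chebJ (Suc s) (-1/2) x * (2 * (x - 1) * h x))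
       = Lp (1/2) (\<lambda>x. chebJ s (1/2) x * h x) - Lp (1/2) (\<lambda>x. chebJ (Suc s) (1/2) x * h x)" ..
  have "- Lp (1/2) (\<lambda>x. chebJ 0 (1/2) x * h x) = (-1) * Lp (1/2) (\<lambda>x. chebJ 0 (1/2) x * h x)" by simp
  also have "\<dots> = Lp (1/2) (\<lambda>x. (-1) * (chebJ 0 (1/2) x * h x))" by (rule Lp_cmult[symmetric]) simp
  also have "\<dots> = Lp (-1/2) (\<lambda>x. chebJ 0 (-1/2) x * (2 * (x - 1) * h x))"
    unfolding Lp_half by (rule Lp_cong) (simp add: algebra_simps)
  finally show "Lp (-1/2) (\<lambda>x. chebJ 0 (-1/2) x * (2 * (x - 1) * h x)) = - Lp (1/2) (\<lambda>x. chebJ 0 (1/2) x * h x)" ..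
qed

section \<open>Summing determinants over interlacing partitions\<close>

lemma detk_leibniz_cols:
  "detk k M = (\<Sum>p | p permutes {0..<k}. of_int (sign p) * (\<Prod>j<k. M (p j) j))"
  by (subst detk_transpose[symmetric]) (rule detk_leibniz)

text \<open>Column \<open>j\<close> depends on \<open>\<mu>\<close> only through
  \<open>\<mu> j\<close>, so the sum over the product set distributes over the columns by
  multilinearity. The columns from \<open>q\<close> on are constants left by particles that have
  already disappeared.\<close>

lemma sum_PiE_detk:
  fixes a :: "nat \<Rightarrow> nat \<Rightarrow> complex"
  assumes "q \<le> r" and fin: "\<And>j. j < q \<Longrightarrow> finite (I j)"
  shows "(\<Sum>\<mu>\<in>PiE {..<q} I. detk r (\<lambda>i j. if j < q then a i (\<mu> j) else c i j))
       = detk r (\<lambda>i j. if j < q then (\<Sum>t\<in>I j. a i t) else c i j)"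
proof -
  have split: "(\<Prod>j<r. if j < q then f j else g j) = (\<Prod>j<q. f j) * (\<Prod>j\<in>{q..<r}. g j)" for f g :: "nat \<Rightarrow> complex"
  proof -
    have "{..<r} = {..<q} \<union> {q..<r}" using assms(1) by auto
    then have "(\<Prod>j<r. if j < q then f j else g j)
        = (\<Prod>j<q. if j < q then f j else g j) * (\<Prod>j\<in>{q..<r}. if j < q then f j else g j)"
      by (simp add: prod.union_disjoint ivl_disj_int)
    then show ?thesis by simp
  qed
  have "(\<Sum>\<mu>\<in>PiE {..<q} I. detk r (\<lambda>i j. if j < q then a i (\<mu> j) else c i j))
     = (\<Sum>p | p permutes {0..<r}. \<Sum>\<mu>\<in>PiE {..<q} I. of_int (sign p) * ((\<Prod>j<q. a (p j) (\<mu> j)) * (\<Prod>j\<in>{q..<r}. c (p j) j)))"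
    unfolding detk_leibniz_cols split by (rule sum.swap)
  also have "\<dots> = (\<Sum>p | p permutes {0..<r}. of_int (sign p) * ((\<Prod>j<q. \<Sum>t\<in>I j. a (p j) t) * (\<Prod>j\<in>{q..<r}. c (p j) j)))"
    using fin by (subst prod_sum_PiE) (auto simp: sum_distrib_left sum_distrib_right)
  finally show ?thesis unfolding detk_leibniz_cols split .
qed

lemma sum_telescope_Ico:
  fixes A :: "nat \<Rightarrow> complex"
  assumes "m \<le> n" "\<And>t. a t = A t - A (Suc t)"
  shows "(\<Sum>t\<in>{m..<n}. a t) = A m - A n"
  unfolding assms(2) using assms(1) sum_Suc_diff'[of m n "\<lambda>t. - A t"] by simp

text \<open>The range of the first row is unbounded above; \<open>R\<close> truncates it.\<close>

definition ivls :: "(nat \<Rightarrow> nat) \<Rightarrow> nat \<Rightarrow> nat \<Rightarrow> nat set" where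
  "ivls e R j = {e j..<(if j = 0 then R else e (j - 1))}"

text \<open>Each column is a sum over an interval between consecutive endpoints, hence a difference of
  tail sums; column operations remove the subtracted tails.\<close>
lemma tendsto_sum_interlacing_detk:
  fixes a A :: "nat \<Rightarrow> nat \<Rightarrow> complex"
  assumes "q \<le> r" and mono: "\<And>j. Suc j < q \<Longrightarrow> e (Suc j) \<le> e j"
    and tele: "\<And>i t. a i t = A i t - A i (Suc t)"
    and lim: "\<And>i. A i \<longlonglongrightarrow> 0"
  shows "(\<lambda>R. \<Sum>\<mu>\<in>PiE {..<q} (ivls e R). detk r (\<lambda>i j. if j < q then a i (\<mu> j) else c i j))
     \<longlonglongrightarrow> detk r (\<lambda>i j. if j < q then A i (e j) else c i j)"
proof -
  let ?N = "\<lambda>i j. if j < q then A i (e j) - (if j = 0 then 0 else A i (e (j - 1))) else c i j"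
  let ?M = "\<lambda>i j. if j < q then A i (e j) else c i j"
  define V :: "nat \<Rightarrow> nat \<Rightarrow> complex" where
    "V = (\<lambda>l j. if l = j then 1 else if j < q \<and> Suc l = j then -1 else 0)"
  have "detk r V = 1"
    by (rule detk_graded_unitriangular[where h = "\<lambda>i. r - i"]) (auto simp: V_def)
  moreover have "detk r (\<lambda>i j. \<Sum>l<r. ?M i l * V l j) = detk r ?N"
  proof (rule detk_cong)
    fix i j assume ij: "i < r" "j < r"
    have "(\<Sum>l<r. ?M i l * V l j) = (\<Sum>l<r. (if l = j then ?M i l else 0)
         + (if j < q \<and> j \<noteq> 0 then (if l = j - 1 then - ?M i l else 0) else 0))"
      by (intro sum.cong) (auto simp: V_def)
    also have "\<dots> = ?N i j"
      using ij by (auto simp: sum.distrib)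
    finally show "(\<Sum>l<r. ?M i l * V l j) = ?N i j" .
  qed
  ultimately have eq: "detk r ?N = detk r ?M"
    using detk_mult[of r ?M V] by simp
  have "(\<lambda>R. detk r (\<lambda>i j. if j < q then A i (e j) - (if j = 0 then A i R else A i (e (j - 1))) else c i j))
     \<longlonglongrightarrow> detk r ?N"
    using lim by (intro tendsto_detk) (auto intro!: tendsto_eq_intros)
  moreover have "\<forall>\<^sub>F R in sequentially. detk r (\<lambda>i j. if j < q then A i (e j) - (if j = 0 then A i R else A i (e (j - 1))) else c i j)
    = (\<Sum>\<mu>\<in>PiE {..<q} (ivls e R). detk r (\<lambda>i j. if j < q then a i (\<mu> j) else c i j))"
    \<comment> \<open>Telescoping over the first interval needs an upper end \<open>R\<close> that
      does not lie below \<open>e 0\<close>.\<close>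
    using eventually_ge_at_top[of "e 0"]
  proof eventually_elim
    case (elim R)
    have "(\<Sum>t\<in>ivls e R j. a i t) = A i (e j) - (if j = 0 then A i R else A i (e (j - 1)))" if "j < q" for i j
      using that elim mono[of "j - 1"] unfolding ivls_def
      by (cases "j = 0") (auto intro!: sum_telescope_Ico simp: tele)
    then have "detk r (\<lambda>i j. if j < q then (\<Sum>t\<in>ivls e R j. a i t) else c i j) =
      detk r (\<lambda>i j. if j < q then A i (e j) - (if j = 0 then A i R else A i (e (j - 1))) else c i j)"
      by (intro detk_cong) auto
    then show ?case
      using sum_PiE_detk[OF assms(1), of "ivls e R"] by (simp add: ivls_def)
  qed
  ultimately show ?thesis unfolding eq by (rule Lim_transform_eventually)
qed

section \<open>Interlacing in shifted coordinates\<close>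

lemma tld_nth:
  assumes "v \<in> JJ n" "j < rr n"
  shows "tld n v (Suc j) = v ! j + (rr n - 1 - j)"
  using assms by (simp add: tld_def part_def JJ_def)

lemma tld_strict_decreasing:
  assumes "v \<in> JJ n" "i < j" "j < rr n"
  shows "tld n v (Suc j) < tld n v (Suc i)"
proof -
  have "v ! j \<le> v ! i"
    using assms sorted_wrt_nth_less[of "(\<ge>)" v i j] by (simp add: JJ_def)
  then show ?thesis using assms by (simp add: tld_nth)
qed

lemma inj_on_tld: "v \<in> JJ n \<Longrightarrow> inj_on (\<lambda>j. tld n v (Suc j)) {..<rr n}"
  by (rule linorder_inj_onI') (metis lessThan_iff less_irrefl tld_strict_decreasing)

text \<open>Lower ends of the ranges of the rows at level \<open>n\<close>. If this level has one
  row more than \<open>lam\<close>, the range of that row starts at 0.\<close>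

definition endpts :: "nat \<Rightarrow> nat list \<Rightarrow> nat \<Rightarrow> nat" where
  "endpts n lam j = (if j < length lam then lam ! j + (rr n - 1 - j) else 0)"

text \<open>The staircase shift drops by one when the number of rows drops; this is why tail sums
  are read at a successor index for odd \<open>n\<close>.\<close>

lemma endpts_tld:
  assumes "lam \<in> JJ (n - 1)" "1 \<le> n" "j < rr (n - 1)"
  shows "endpts n lam j = tld (n - 1) lam (Suc j) + (if odd n then 1 else 0)"
proof -
  obtain m where "n = Suc m" using assms(2) by (cases n) auto
  then show ?thesis using assms
    by (auto simp: endpts_def tld_nth JJ_def rr_def elim!: oddE evenE)
qed

lemma endpts_mono:
  assumes "lam \<in> JJ (n - 1)" "Suc j < rr n"
  shows "endpts n lam (Suc j) \<le> endpts n lam j"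
  using assms sorted_wrt_nth_less[of "(\<ge>)" lam j "Suc j"] by (auto simp: endpts_def JJ_def)

text \<open>The shift turns the upper bound of each row after the first into a strict inequality, so
  interlacing says that the rows range independently over disjoint half-open intervals, and the
  monotonicity of the partition comes for free. Beyond the last row the argument of \<open>f\<close>
  gets a default value so that the two sides agree as functions.\<close>

lemma sum_interlacing_eq_sum_PiE:
  assumes n: "1 \<le> n" and lam: "lam \<in> JJ (n - 1)"
  shows "(\<Sum>v | v \<in> JJ n \<and> interlace (n - 1) lam v \<and> tld n v 1 < R. f (\<lambda>j. tld n v (Suc j)) )
       = (\<Sum>\<mu>\<in>PiE {..<rr n} (ivls (endpts n lam) R). f (\<lambda>j. if j < rr n then \<mu> j else tld n [] (Suc j)))"
    (is "?L = ?R")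
proof -
  let ?q = "rr n"
  have q: "1 \<le> ?q" using n by (simp add: rr_def)
  have ll: "length lam = rr (n - 1)" using lam by (simp add: JJ_def)
  have ql: "rr (n - 1) = ?q \<or> Suc (rr (n - 1)) = ?q"
    using n by (cases n) (auto simp: rr_def)
  have ep: "endpts n lam j = (if j < rr (n - 1) then lam ! j + (?q - 1 - j) else 0)" for j
    by (simp add: endpts_def ll)
  have int: "interlace (n - 1) lam v \<longleftrightarrow> (\<forall>j < rr (n - 1). lam ! j \<le> v ! j \<and> (Suc j < ?q \<longrightarrow> v ! Suc j \<le> lam ! j))"
    if v: "length v = ?q" for v
  proof -
    have "interlace (n - 1) lam v \<longleftrightarrow> (\<forall>j < rr (n - 1). part v (Suc j) \<ge> part lam (Suc j) \<and> part lam (Suc j) \<ge> part v (Suc (Suc j)))"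
      unfolding interlace_def by (auto simp: Ball_def) (metis Suc_le_D Suc_le_eq)+
    then show ?thesis using v ql by (auto simp: part_def ll)
  qed
  define F where "F = (\<lambda>v::nat list. restrict (\<lambda>j. v ! j + (?q - 1 - j)) {..<?q})"
  define B where "B = (\<lambda>\<mu>. map (\<lambda>j. \<mu> j - (?q - 1 - j)) [0..<?q])"
  \<comment> \<open>Guards the truncated subtraction in \<open>B\<close>: no interval reaches below
    the staircase value subtracted there, so \<open>B\<close> inverts \<open>F\<close>.\<close>
  have low: "?q - 1 - j \<le> endpts n lam j" if "j < ?q" for j
    using that ql by (auto simp: ep)
  show ?thesis
  proof (rule sum.reindex_bij_witness[of _ B F])
    fix v assume v: "v \<in> {v. v \<in> JJ n \<and> interlace (n - 1) lam v \<and> tld n v 1 < R}"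
    then have len: "length v = ?q" and vJ: "v \<in> JJ n" by (auto simp: JJ_def)
    show "B (F v) = v" by (rule nth_equalityI) (auto simp: B_def F_def len)
    have I: "lam ! j \<le> v ! j" "Suc j < ?q \<longrightarrow> v ! Suc j \<le> lam ! j" if "j < rr (n - 1)" for j
      using v int[OF len] that by auto
    show "F v \<in> PiE {..<?q} (ivls (endpts n lam) R)"
    proof (rule PiE_I)
      fix j assume j: "j \<in> {..<?q}"
      have "endpts n lam j \<le> F v j" using I(1)[of j] j by (auto simp: F_def ep)
      moreover have "F v j < (if j = 0 then R else endpts n lam (j - 1))"
      proof (cases j)
        case 0
        then show ?thesis using v j tld_nth[OF vJ, of 0] by (auto simp: F_def)
      next
        case (Suc i)
        then have "i < rr (n - 1)" using j ql by auto
        then show ?thesis using I(2)[of i] j Suc by (auto simp: F_def ep)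
      qed
      ultimately show "F v j \<in> ivls (endpts n lam) R j" by (simp add: ivls_def)
    qed (simp add: F_def)
    have "(\<lambda>j. if j < ?q then F v j else tld n [] (Suc j)) = (\<lambda>j. tld n v (Suc j))"
      using vJ by (auto simp: fun_eq_iff F_def tld_nth) (auto simp: tld_def part_def len)
    then show "f (\<lambda>j. if j < ?q then F v j else tld n [] (Suc j)) = f (\<lambda>j. tld n v (Suc j))"
      by simp
  next
    fix \<mu> assume \<mu>: "\<mu> \<in> PiE {..<?q} (ivls (endpts n lam) R)"
    then have lo: "endpts n lam j \<le> \<mu> j" and hi: "\<mu> j < (if j = 0 then R else endpts n lam (j - 1))" if "j < ?q" for j
      using that by (auto simp: PiE_iff ivls_def)
    have len: "length (B \<mu>) = ?q" by (simp add: B_def)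
    have nth: "B \<mu> ! j = \<mu> j - (?q - 1 - j)" if "j < ?q" for j using that by (simp add: B_def)
    have bk: "B \<mu> ! j + (?q - 1 - j) = \<mu> j" if "j < ?q" for j
      using nth[OF that] low[OF that] lo[OF that] by simp
    show "F (B \<mu>) = \<mu>"
    proof (rule ext)
      fix x show "F (B \<mu>) x = \<mu> x"
      proof (cases "x < ?q")
        case True
        then show ?thesis unfolding F_def by (simp only: restrict_apply lessThan_iff if_True bk)
      next
        case False
        then show ?thesis using \<mu> by (auto simp: F_def PiE_iff extensional_def)
      qed
    qed
    have I: "lam ! j \<le> B \<mu> ! j" "Suc j < ?q \<longrightarrow> B \<mu> ! Suc j \<le> lam ! j" if "j < rr (n - 1)" for j
    proof -
      have jq: "j < ?q" using that ql by auto
      show "lam ! j \<le> B \<mu> ! j" using lo[OF jq] bk[OF jq] that by (simp add: ep)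
      show "Suc j < ?q \<longrightarrow> B \<mu> ! Suc j \<le> lam ! j"
        using hi[of "Suc j"] bk[of "Suc j"] that by (auto simp: ep)
    qed
    have srt: "sorted_wrt (\<ge>) (B \<mu>)"
      unfolding sorted_wrt_iff_nth_Suc_transp[OF transp_on_ge]
    proof (intro allI impI)
      fix j assume "Suc j < length (B \<mu>)"
      then have "j < rr (n - 1)" "Suc j < ?q" using len ql by auto
      then show "B \<mu> ! j \<ge> B \<mu> ! Suc j" using I[of j] by auto
    qed
    then have BJ: "B \<mu> \<in> JJ n" using len by (simp add: JJ_def)
    moreover have "interlace (n - 1) lam (B \<mu>)" using int[OF len] I by blast
    moreover have "tld n (B \<mu>) 1 < R" using tld_nth[OF BJ, of 0] bk[of 0] hi[of 0] q by simp
    ultimately show "B \<mu> \<in> {v. v \<in> JJ n \<and> interlace (n - 1) lam v \<and> tld n v 1 < R}" by simp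
  qed
qed

lemma finite_interlacing:
  assumes n: "1 \<le> n" and lam: "lam \<in> JJ (n - 1)"
  shows "finite {v. v \<in> JJ n \<and> interlace (n - 1) lam v \<and> tld n v 1 < R}"
proof (rule finite_subset)
  show "{v. v \<in> JJ n \<and> interlace (n - 1) lam v \<and> tld n v 1 < R} \<subseteq> {v. set v \<subseteq> {..R} \<and> length v = rr n}"
  proof safe
    fix v x assume v: "v \<in> JJ n" "tld n v 1 < R" "x \<in> set v"
    then obtain j where j: "j < rr n" "x = v ! j" by (auto simp: JJ_def in_set_conv_nth)
    have "v ! j \<le> v ! 0"
      using v j sorted_wrt_nth_less[of "(\<ge>)" v 0 j] by (cases "j = 0") (auto simp: JJ_def)
    also have "\<dots> \<le> tld n v 1" using tld_nth[OF v(1), of 0] j by simp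
    finally show "x \<le> R" using v j by simp
  qed (auto simp: JJ_def)
qed (rule finite_lists_length_eq, simp)

section \<open>Descending through the levels\<close>

definition okpath :: "nat \<Rightarrow> (nat \<Rightarrow> nat list) \<Rightarrow> bool" where
  "okpath n u \<longleftrightarrow> (\<forall>m\<in>{1..n}. u m \<in> JJ m) \<and> (\<forall>m\<in>{1..<n}. interlace m (u m) (u (m + 1)))"

locale path_measure = prob_space M for M :: "(nat \<Rightarrow> nat list) measure" +
  assumes sets_M: "sets M = sets (PiM UNIV (\<lambda>_::nat. count_space (UNIV :: nat list set)))"
begin

lemma space_M [simp]: "space M = UNIV"
  using sets_eq_imp_space_eq[OF sets_M] by (simp add: space_PiM)

lemma measurable_coord [measurable]: "(\<lambda>w. w m) \<in> measurable M (count_space UNIV)"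
proof -
  have "(\<lambda>w. w m) \<in> measurable (PiM UNIV (\<lambda>_::nat. count_space (UNIV :: nat list set))) (count_space UNIV)"
    by (rule measurable_component_singleton) simp
  then show ?thesis using measurable_cong_sets[OF sets_M refl] by blast
qed

text \<open>Not normalized by the probability of the initial segment: values for the continuations
  then simply add up, and no division by a null probability arises.\<close>

definition fut :: "(nat \<Rightarrow> nat list \<Rightarrow> complex) \<Rightarrow> nat \<Rightarrow> nat \<Rightarrow> (nat \<Rightarrow> nat list) \<Rightarrow> complex" where
  "fut g N n u = (\<integral>w. (if \<forall>m\<in>{1..n}. w m = u m then \<Prod>m\<in>{n<..N}. g m (w m) else 0) \<partial>M)"

lemma fut_top: "fut g N N u = of_real (measure M {w \<in> space M. \<forall>m\<in>{1..N}. w m = u m})"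
proof -
  have m: "{w. \<forall>m\<in>{1..N}. w m = u m} \<in> sets M"
  proof -
    have "{w \<in> space M. \<forall>m\<in>{1..N}. w m = u m} \<in> sets M" by measurable
    then show ?thesis by simp
  qed
  have "fut g N N u = (\<integral>w. complex_of_real (indicator {w. \<forall>m\<in>{1..N}. w m = u m} w) \<partial>M)"
    unfolding fut_def by (intro Bochner_Integration.integral_cong) (auto simp: indicator_def)
  also have "\<dots> = of_real (measure M {w. \<forall>m\<in>{1..N}. w m = u m})"
    using m by (subst integral_complex_of_real) simp
  finally show ?thesis by simp
qed

text \<open>Summation over the next partition along any finite exhaustion \<open>B R\<close> of all
  lists. The weights are complex, so the limit comes from dominated convergence and not from
  monotonicity.\<close>

lemma fut_step:
  fixes B :: "nat \<Rightarrow> nat list set"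
  assumes n: "1 \<le> n" "n \<le> N" and C: "\<And>m v. norm (g m v) \<le> C"
    and fin: "\<And>R. finite (B R)" and ev: "\<And>v. eventually (\<lambda>R. v \<in> B R) sequentially"
  shows "(\<lambda>R. \<Sum>v\<in>B R. g n v * fut g N n (u(n := v))) \<longlonglongrightarrow> fut g N (n - 1) u"
proof -
  have C0: "0 \<le> C" using C[of 0 "[]"] norm_ge_zero order_trans by blast
  let ?F = "\<lambda>k w. if \<forall>m\<in>{1..k}. w m = u m then \<Prod>m\<in>{k<..N}. g m (w m) else 0"
  have meas: "(\<lambda>w. if \<forall>m\<in>{1..k}. w m = u' m then \<Prod>m\<in>{k<..N}. g m (w m) else 0) \<in> borel_measurable M" for k u'
    by measurable
  have bd: "norm (\<Prod>m\<in>S. g m (w m)) \<le> max 1 C ^ N" if "S \<subseteq> {1..N}" for S and w :: "nat \<Rightarrow> nat list"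
  proof -
    have "norm (\<Prod>m\<in>S. g m (w m)) \<le> (\<Prod>m\<in>S. max 1 C)"
      unfolding prod_norm[symmetric] by (intro prod_mono) (auto intro: order_trans[OF C])
    also have "\<dots> = max 1 C ^ card S" by simp
    also have "\<dots> \<le> max 1 C ^ N"
      using that card_mono[OF _ that] by (intro power_increasing) auto
    finally show ?thesis .
  qed
  have sub: "{k<..N} \<subseteq> {1..N}" for k by auto
  have int: "integrable M (\<lambda>w. if \<forall>m\<in>{1..k}. w m = u' m then \<Prod>m\<in>{k<..N}. g m (w m) else 0)" for k u'
    by (rule integrable_const_bound[where B = "max 1 C ^ N"], rule AE_I2)
      (use bd[OF sub] meas C0 in auto)
  have eq: "(\<Sum>v\<in>B R. g n v * fut g N n (u(n := v))) = (\<integral>w. (if w n \<in> B R then ?F (n - 1) w else 0) \<partial>M)" for R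
  proof -
    have "(\<Sum>v\<in>B R. g n v * fut g N n (u(n := v)))
      = (\<integral>w. (\<Sum>v\<in>B R. g n v * (if \<forall>m\<in>{1..n}. w m = (u(n := v)) m then \<Prod>m\<in>{n<..N}. g m (w m) else 0)) \<partial>M)"
      unfolding fut_def using int by (subst Bochner_Integration.integral_sum) auto
    also have "\<dots> = (\<integral>w. (if w n \<in> B R then ?F (n - 1) w else 0) \<partial>M)"
    proof (rule Bochner_Integration.integral_cong[OF refl])
      fix w
      have s1: "{n - 1<..N} = insert n {n<..N}" and s2: "{1..n} = insert n {1..n-1}" using n by auto
      have iff: "(\<forall>m\<in>{1..n}. w m = (u(n := v)) m) \<longleftrightarrow> w n = v \<and> (\<forall>m\<in>{1..n-1}. w m = u m)" for v
      proof -
        have "(\<forall>m\<in>{1..n-1}. w m = (u(n := v)) m) \<longleftrightarrow> (\<forall>m\<in>{1..n-1}. w m = u m)"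
          by (rule ball_cong[OF refl]) (use n in auto)
        then show ?thesis unfolding s2 using fun_upd_same[of u n v] by (auto simp del: fun_upd_apply)
      qed
      have pr: "(\<Prod>m\<in>{n - 1<..N}. g m (w m)) = g n (w n) * (\<Prod>m\<in>{n<..N}. g m (w m))"
        unfolding s1 by simp
      have "(\<Sum>v\<in>B R. g n v * (if \<forall>m\<in>{1..n}. w m = (u(n := v)) m then \<Prod>m\<in>{n<..N}. g m (w m) else 0))
        = (\<Sum>v\<in>B R. if v = w n then ?F (n - 1) w else 0)"
        by (rule sum.cong[OF refl]) (simp only: iff pr, auto)
      also have "\<dots> = (if w n \<in> B R then ?F (n - 1) w else 0)"
        using fin by (simp add: sum.delta)
      finally show "(\<Sum>v\<in>B R. g n v * (if \<forall>m\<in>{1..n}. w m = (u(n := v)) m then \<Prod>m\<in>{n<..N}. g m (w m) else 0)) = \<dots>" .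
    qed
    finally show ?thesis .
  qed
  have "(\<lambda>R. \<integral>w. (if w n \<in> B R then ?F (n - 1) w else 0) \<partial>M) \<longlonglongrightarrow> fut g N (n - 1) u"
    unfolding fut_def
  proof (rule integral_dominated_convergence[where w = "\<lambda>_. max 1 C ^ N"])
    show "AE w in M. (\<lambda>R. if w n \<in> B R then ?F (n - 1) w else 0) \<longlonglongrightarrow> ?F (n - 1) w"
    proof (rule AE_I2)
      fix w
      show "(\<lambda>R. if w n \<in> B R then ?F (n - 1) w else 0) \<longlonglongrightarrow> ?F (n - 1) w"
        by (rule tendsto_eventually) (use ev[of "w n"] in eventually_elim, auto)
    qed
    show "(\<lambda>w. if w n \<in> B R then ?F (n - 1) w else 0) \<in> borel_measurable M" for R
      using meas[of "n - 1" u] by measurable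
    show "AE w in M. norm (if w n \<in> B R then ?F (n - 1) w else 0) \<le> max 1 C ^ N" for R
      by (rule AE_I2) (use bd[OF sub] C0 in auto)
  qed (use meas in auto)
  then show ?thesis unfolding eq .
qed

end

text \<open>\<open>A n i\<close> are the tail sums of the columns \<open>a n i\<close>; they are the columns of the next lower level,
  up to a multiple of the new constant column that appears when the number of particles drops.\<close>
locale path_descent = path_measure M for M :: "(nat \<Rightarrow> nat list) measure" +
  fixes g :: "nat \<Rightarrow> nat list \<Rightarrow> complex" and N r :: nat and Cb :: real
    and p a A :: "nat \<Rightarrow> nat \<Rightarrow> nat \<Rightarrow> complex" and c :: "nat \<Rightarrow> nat \<Rightarrow> complex" and eps :: "nat \<Rightarrow> complex"
  assumes r: "r = rr N" and bound: "\<And>m v. norm (g m v) \<le> Cb"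
    and top: "\<And>u. fut g N N u = (if okpath N u then detk r (\<lambda>i j. p N i (tld N (u N) (Suc j))) else 0)"
    and weight: "\<And>n v. 1 \<le> n \<Longrightarrow> n \<le> N \<Longrightarrow> v \<in> JJ n \<Longrightarrow> g n v * detk r (\<lambda>i j. if j < rr n then p n i (tld n v (Suc j)) else c i j)
        = detk r (\<lambda>i j. if j < rr n then a n i (tld n v (Suc j)) else c i j)"
    and tele: "\<And>n i t. 1 \<le> n \<Longrightarrow> n \<le> N \<Longrightarrow> a n i t = A n i t - A n i (Suc t)"
    and lim: "\<And>n i. 1 \<le> n \<Longrightarrow> n \<le> N \<Longrightarrow> A n i \<longlonglongrightarrow> 0"
    and even_tail: "\<And>n i t. 1 \<le> n \<Longrightarrow> n \<le> N \<Longrightarrow> even n \<Longrightarrow> A n i t = p (n - 1) i t"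
    and odd_tail: "\<And>n i t. 1 \<le> n \<Longrightarrow> n \<le> N \<Longrightarrow> odd n \<Longrightarrow> A n i (Suc t) = p (n - 1) i t + eps t * c i (rr n - 1)"
    and odd_total: "\<And>n i. 1 \<le> n \<Longrightarrow> n \<le> N \<Longrightarrow> odd n \<Longrightarrow> A n i 0 = c i (rr n - 1)"
begin

text \<open>Downward induction on the level. At level \<open>n\<close> the first \<open>rr n\<close>
  columns still depend on the partition; the others are the constants \<open>c\<close> left by the
  particles that disappeared above.\<close>

lemma fut_eq_detk:
  "n \<le> N \<Longrightarrow> fut g N n u = (if okpath n u then detk r (\<lambda>i j. if j < rr n then p n i (tld n (u n) (Suc j)) else c i j) else 0)"
proof (induction "N - n" arbitrary: n u)
  case 0
  then have nN: "n = N" by simp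
  have "detk r (\<lambda>i j. if j < rr N then p N i (tld N (u N) (Suc j)) else c i j) = detk r (\<lambda>i j. p N i (tld N (u N) (Suc j)))"
    by (rule detk_cong) (simp add: r)
  then show ?case unfolding nN using top[of u] by simp
next
  case (Suc d)
  define k where "k = Suc n"
  have k: "1 \<le> k" "k \<le> N" "n = k - 1" using Suc by (auto simp: k_def)
  have kn: "k - 1 = n" "k - Suc 0 = n" by (simp_all add: k_def)
  have IH: "fut g N k u = (if okpath k u then detk r (\<lambda>i j. if j < rr k then p k i (tld k (u k) (Suc j)) else c i j) else 0)" for u
    by (rule Suc.hyps(1)) (use Suc in \<open>simp_all add: k_def\<close>)
  define lam where "lam = (if n = 0 then [] else u n)"
  have okk: "okpath k (u(k := v)) \<longleftrightarrow> okpath n u \<and> v \<in> JJ k \<and> interlace n lam v" for v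
  proof -
    have 1: "{1..k} = insert k {1..n}" by (auto simp: k_def)
    have 2: "{1..<k} = (if n = 0 then {} else insert n {1..<n})" by (auto simp: k_def)
    have 3: "interlace 0 x y" for x y by (simp add: interlace_def rr_def)
    show ?thesis
      by (cases "n = 0") (auto simp: okpath_def 1 2 3 lam_def k_def)
  qed
  define S where "S = (\<lambda>R. {v. v \<in> JJ k \<and> interlace n lam v \<and> tld k v 1 < R})"
  \<comment> \<open>Lists that cannot continue the path contribute 0, but an exhaustion of all lists
    must contain them; they are added along an enumeration.\<close>
  define Bd where "Bd = (\<lambda>R::nat. {v. \<not> (v \<in> JJ k \<and> interlace n lam v) \<and> to_nat v < R})"
  show ?case
  proof (cases "okpath n u")
    case ok: True
    have lam: "lam \<in> JJ (k - 1)"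
    proof (cases "n = 0")
      case True
      then show ?thesis by (simp add: lam_def JJ_def rr_def k_def)
    next
      case False
      then show ?thesis using ok by (simp add: lam_def okpath_def k_def)
    qed
    have finS: "finite (S R)" for R
      unfolding S_def k(3) using finite_interlacing[OF k(1) lam] by simp
    have finB: "finite (Bd R)" for R
    proof (rule finite_subset)
      show "Bd R \<subseteq> from_nat ` {..<R}" unfolding Bd_def by (force simp: image_iff intro: from_nat_to_nat[symmetric])
    qed simp
    have ev: "eventually (\<lambda>R. v \<in> S R \<union> Bd R) sequentially" for v
      using eventually_gt_at_top[of "max (tld k v 1) (to_nat v)"]
      by eventually_elim (auto simp: S_def Bd_def)
    have "(\<lambda>R. \<Sum>v\<in>S R \<union> Bd R. g k v * fut g N k (u(k := v))) \<longlonglongrightarrow> fut g N (k - 1) u"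
      by (rule fut_step[OF k(1,2) bound]) (use finS finB ev in auto)
    moreover have "(\<Sum>v\<in>S R \<union> Bd R. g k v * fut g N k (u(k := v)))
       = (\<Sum>\<mu>\<in>PiE {..<rr k} (ivls (endpts k lam) R). detk r (\<lambda>i j. if j < rr k then a k i (\<mu> j) else c i j))" for R
    proof -
      have "(\<Sum>v\<in>S R \<union> Bd R. g k v * fut g N k (u(k := v))) = (\<Sum>v\<in>S R. g k v * fut g N k (u(k := v)))"
        by (rule sum.mono_neutral_right) (use finS finB in \<open>auto simp: IH okk Bd_def S_def\<close>)
      also have "\<dots> = (\<Sum>v\<in>S R. detk r (\<lambda>i j. if j < rr k then a k i (tld k v (Suc j)) else c i j))"
      proof (rule sum.cong[OF refl])
        fix v assume "v \<in> S R"
        then have v: "v \<in> JJ k" "okpath k (u(k := v))" using ok by (auto simp: S_def okk)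
        then show "g k v * fut g N k (u(k := v)) = detk r (\<lambda>i j. if j < rr k then a k i (tld k v (Suc j)) else c i j)"
          using IH[of "u(k := v)"] weight[OF k(1,2) v(1)] by (simp cong: if_cong)
      qed
      also have "\<dots> = (\<Sum>\<mu>\<in>PiE {..<rr k} (ivls (endpts k lam) R).
          detk r (\<lambda>i j. if j < rr k then a k i (if j < rr k then \<mu> j else tld k [] (Suc j)) else c i j))"
        unfolding S_def k(3)
        by (rule sum_interlacing_eq_sum_PiE[OF k(1) lam, where f = "\<lambda>m. detk r (\<lambda>i j. if j < rr k then a k i (m j) else c i j)"])
      also have "\<dots> = (\<Sum>\<mu>\<in>PiE {..<rr k} (ivls (endpts k lam) R). detk r (\<lambda>i j. if j < rr k then a k i (\<mu> j) else c i j))"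
        by (intro sum.cong[OF refl] detk_cong) auto
      finally show ?thesis .
    qed
    moreover have "(\<lambda>R. \<Sum>\<mu>\<in>PiE {..<rr k} (ivls (endpts k lam) R). detk r (\<lambda>i j. if j < rr k then a k i (\<mu> j) else c i j))
      \<longlonglongrightarrow> detk r (\<lambda>i j. if j < rr k then A k i (endpts k lam j) else c i j)"
    proof (rule tendsto_sum_interlacing_detk)
      show "rr k \<le> r" using k by (simp add: r rr_def div_le_mono)
    qed (use k tele lim endpts_mono[OF lam] in auto)
    ultimately have fut: "fut g N n u = detk r (\<lambda>i j. if j < rr k then A k i (endpts k lam j) else c i j)"
      using LIMSEQ_unique unfolding k(3) by auto
    have rk: "rr n = (if even k then rr k else rr k - 1)" "1 \<le> rr k" "rr k \<le> r"
    proof -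
      show "rr n = (if even k then rr k else rr k - 1)"
        by (auto simp: k_def rr_def elim!: evenE oddE)
      show "1 \<le> rr k" by (simp add: k_def rr_def)
      show "rr k \<le> r" using k(2) by (simp add: r rr_def div_le_mono)
    qed
    have ep: "endpts k lam j = tld n (u n) (Suc j) + (if odd k then 1 else 0)" if "j < rr n" for j
    proof -
      have "n \<noteq> 0" using that by (auto simp: rr_def)
      then show ?thesis using endpts_tld[OF lam k(1), of j] that by (simp add: kn lam_def)
    qed
    have "detk r (\<lambda>i j. if j < rr k then A k i (endpts k lam j) else c i j)
      = detk r (\<lambda>i j. if j < rr n then p n i (tld n (u n) (Suc j)) else c i j)"
    proof (cases "even k")
      case True
      then show ?thesis using ep rk even_tail[OF k(1,2)] by (intro detk_cong) (auto simp: kn)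
    next
      case False
      \<comment> \<open>One particle disappears: the column with endpoint 0 becomes the new constant
        column with index \<open>rr n\<close>, and the columns before it differ from those of level
        \<open>n\<close> by \<open>eps\<close> times this one.\<close>
      let ?M = "\<lambda>i j. if j < rr n then p n i (tld n (u n) (Suc j)) else c i j"
      have ll: "length lam = rr n" using lam by (simp add: JJ_def kn)
      have "detk r (\<lambda>i j. if j < rr k then A k i (endpts k lam j) else c i j)
          = detk r (\<lambda>i j. if j \<in> {..<rr n} then ?M i j + eps (tld n (u n) (Suc j)) * ?M i (rr n) else ?M i j)"
      proof (rule detk_cong)
        fix i j assume "i < r" "j < r"
        consider "j < rr n" | "j = rr n" | "j > rr n" by linarith
        then show "(if j < rr k then A k i (endpts k lam j) else c i j) =
            (if j \<in> {..<rr n} then ?M i j + eps (tld n (u n) (Suc j)) * ?M i (rr n) else ?M i j)"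
        proof cases
          case 1
          then show ?thesis using ep[OF 1] False rk odd_tail[OF k(1,2) False, of i] by (auto simp: kn)
        next
          case 2
          then show ?thesis using False rk odd_total[OF k(1,2) False, of i] by (auto simp: endpts_def ll)
        next
          case 3
          then show ?thesis using False rk by auto
        qed
      qed
      also have "\<dots> = detk r ?M"
        by (rule detk_add_multiple_of_col) (use rk False in auto)
      finally show ?thesis .
    qed
    then show ?thesis using fut ok by simp
  next
    case False
    \<comment> \<open>Every term vanishes, so any exhaustion will do.\<close>
    have "(\<lambda>R. \<Sum>v\<in>from_nat ` {..<R}. g k v * fut g N k (u(k := v))) \<longlonglongrightarrow> fut g N (k - 1) u"
    proof (rule fut_step[OF k(1,2) bound])
      show "eventually (\<lambda>R. v \<in> from_nat ` {..<R}) sequentially" for v :: "nat list"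
        using eventually_gt_at_top[of "to_nat v"] by eventually_elim (metis imageI lessThan_iff from_nat_to_nat)
    qed simp
    moreover have "fut g N k (u(k := v)) = 0" for v using False by (simp add: IH okk)
    ultimately have "fut g N n u = 0" by (simp add: kn LIMSEQ_const_iff)
    then show ?thesis using False by simp
  qed
qed

lemma expectation_eq_detk: "(\<integral>w. (\<Prod>m\<in>{1..N}. g m (w m)) \<partial>M) = detk r c"
proof -
  have "fut g N 0 u = (\<integral>w. (\<Prod>m\<in>{1..N}. g m (w m)) \<partial>M)" for u
    unfolding fut_def by (simp add: atLeastSucAtMost_greaterThanAtMost[symmetric])
  then show ?thesis using fut_eq_detk[of 0 "\<lambda>_. []"] by (simp add: okpath_def rr_def)
qed

end

section \<open>Difference quotients and tail sums\<close>

lemma alph_cases: "alph n \<in> {1/2, -1/2}"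
  by (simp add: alph_def)

lemma nice_cong:
  assumes "nice f" "\<And>x. x \<in> {-1..1::real} \<Longrightarrow> f (of_real x) = g (of_real x)"
  shows "nice g"
  using assms unfolding nice_def by (subst continuous_on_cong[OF refl, symmetric]) auto

text \<open>The factor 2 matches the connection formula with \<open>2 * (1 - x)\<close>; the value
  at 1 makes the quotient holomorphic there, so that it can be iterated.\<close>

definition dq :: "(complex \<Rightarrow> complex) \<Rightarrow> complex \<Rightarrow> complex" where
  "dq f = (\<lambda>x. if x = 1 then deriv f 1 / 2 else (f x - f 1) / (2 * (x - 1)))"

lemma dq_decomp: "f x = f 1 + 2 * (x - 1) * dq f x"
  by (simp add: dq_def)

lemma dq_holomorphic:
  assumes "f holomorphic_on S" "open S"
  shows "dq f holomorphic_on S"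
proof -
  have "(\<lambda>z. (if z = 1 then deriv f 1 else (f z - f 1) / (z - 1)) / 2) holomorphic_on S"
    using pole_lemma_open[OF assms, of 1] by (intro holomorphic_intros) auto
  then show ?thesis
    by (rule holomorphic_transform)
      (simp only: dq_def divide_divide_eq_left mult.commute[of 2] if_distrib[of "\<lambda>q. q / 2"])
qed

lemma dq_pow_holomorphic: "f holomorphic_on S \<Longrightarrow> open S \<Longrightarrow> (dq ^^ n) f holomorphic_on S"
  by (induction n) (auto intro: dq_holomorphic)

lemma dq_linear:
  assumes "f field_differentiable at 1" "\<And>i. i \<in> I \<Longrightarrow> g i field_differentiable at 1" "finite I"
  shows "dq (\<lambda>x. f x + (\<Sum>i\<in>I. c i * g i x)) = (\<lambda>x. dq f x + (\<Sum>i\<in>I. c i * dq (g i) x))"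
proof (rule ext)
  fix x :: complex
  show "dq (\<lambda>x. f x + (\<Sum>i\<in>I. c i * g i x)) x = dq f x + (\<Sum>i\<in>I. c i * dq (g i) x)"
  proof (cases "x = 1")
    case True
    have "((\<lambda>x. f x + (\<Sum>i\<in>I. c i * g i x)) has_field_derivative (deriv f 1 + (\<Sum>i\<in>I. c i * deriv (g i) 1))) (at 1)"
      using assms by (intro derivative_intros DERIV_cmult) (auto simp: field_differentiable_derivI)
    then show ?thesis using True
      by (simp add: dq_def DERIV_imp_deriv add_divide_distrib sum_divide_distrib)
  next
    case False
    have "(f x + (\<Sum>i\<in>I. c i * g i x)) - (f 1 + (\<Sum>i\<in>I. c i * g i 1)) = (f x - f 1) + (\<Sum>i\<in>I. c i * (g i x - g i 1))"
      by (simp add: sum_subtractf right_diff_distrib)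
    then show ?thesis using False
      by (simp only: dq_def if_False add_divide_distrib sum_divide_distrib times_divide_eq_right)
  qed
qed

lemma dq_power: "dq (\<lambda>x. (2 * (x - 1)) ^ Suc j) = (\<lambda>x. (2 * (x - 1)) ^ j)"
proof (rule ext)
  fix x :: complex
  show "dq (\<lambda>x. (2 * (x - 1)) ^ Suc j) x = (2 * (x - 1)) ^ j"
  proof (cases "x = 1")
    case True
    have "((\<lambda>x::complex. (2 * (x - 1)) ^ Suc j) has_field_derivative (of_nat (Suc j) * (2 * (1 - 1)) ^ j * 2)) (at 1)"
      by (rule derivative_eq_intros refl | simp)+
    then have "deriv (\<lambda>x::complex. (2 * (x - 1)) ^ Suc j) 1 = of_nat (Suc j) * (2 * (1 - 1)) ^ j * 2"
      by (rule DERIV_imp_deriv)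
    then show ?thesis using True unfolding dq_def by (cases j) simp_all
  qed (simp add: dq_def)
qed

lemma dq_const: "dq (\<lambda>x. c) = (\<lambda>x. 0)"
  by (auto simp: dq_def fun_eq_iff)

lemma dq_pow_power:
  "(dq ^^ n) (\<lambda>x. (2 * (x - 1)) ^ j) = (\<lambda>x. if n \<le> j then (2 * (x - 1)) ^ (j - n) else 0)"
proof (induction n)
  case (Suc n)
  have "(dq ^^ Suc n) (\<lambda>x. (2 * (x - 1)) ^ j) = dq (\<lambda>x. if n \<le> j then (2 * (x - 1)) ^ (j - n) else 0)"
    by (simp only: funpow.simps o_apply Suc)
  also have "\<dots> = (\<lambda>x. if Suc n \<le> j then (2 * (x - 1)) ^ (j - Suc n) else 0)"
  proof -
    consider "Suc n \<le> j" | "n = j" | "n > j" by linarith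
    then show ?thesis
    proof cases
      case 1
      then have *: "j - n = Suc (j - Suc n)" "(n \<le> j) = True" "(Suc n \<le> j) = True" by simp_all
      show ?thesis by (simp only: * dq_power if_True)
    qed (simp_all add: dq_const)
  qed
  finally show ?case .
qed simp

text \<open>Taylor's formula at 1 in the variable \<open>2 * (x - 1)\<close> with exact
  remainder.\<close>

lemma dq_expansion:
  "f x = (\<Sum>i<b. (dq ^^ i) f 1 * (2 * (x - 1)) ^ i) + (2 * (x - 1)) ^ b * (dq ^^ b) f x"
proof (induction b)
  case (Suc b)
  have "(2 * (x - 1)) ^ b * (dq ^^ b) f x = (dq ^^ b) f 1 * (2 * (x - 1)) ^ b + (2 * (x - 1)) ^ Suc b * (dq ^^ Suc b) f x"
    by (subst dq_decomp[of "(dq ^^ b) f" x]) (simp add: distrib_left mult_ac del: right_diff_distrib_numeral)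
  then show ?case using Suc by (simp only: sum.lessThan_Suc add.assoc)
qed simp

text \<open>The descent sees \<open>E\<close> only on the segment, while the kernel involves only
  its inverse off the segment. So \<open>E\<close> may have poles in \<open>Om\<close>; what is
  asked for there is a holomorphic \<open>G\<close> that inverts \<open>E\<close> on the segment.
  \<open>E'\<close> plays the part of the difference quotient of \<open>E\<close>, normalized by
  \<open>E 1 = 1\<close>.\<close>

locale level_system =
  fixes E E' G :: "complex \<Rightarrow> complex" and Om :: "complex set"
  assumes open_Om: "open Om" and seg: "of_real ` {-1..1::real} \<subseteq> Om"
    and G_holo: "G holomorphic_on Om"
    and EG: "\<And>x. x \<in> {-1..1::real} \<Longrightarrow> E (of_real x) * G (of_real x) = 1"
    and nice_E': "nice E'"
    and E_eq: "\<And>x. x \<in> {-1..1::real} \<Longrightarrow> E (of_real x) = 1 + 2 * (of_real x - 1) * E' (of_real x)"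
begin

lemma nice_E [simp, intro]: "nice E"
  by (rule nice_cong[of "\<lambda>x. 1 + 2 * (x - 1) * E' x"]) (use nice_E' E_eq in auto)

lemma one_in_Om: "1 \<in> Om"
proof -
  have "complex_of_real 1 \<in> of_real ` {-1..1::real}" by (rule imageI) simp
  then show ?thesis using seg by auto
qed

lemma holo_nice: "f holomorphic_on Om \<Longrightarrow> nice f"
  by (intro niceI holomorphic_on_imp_continuous_on) (rule holomorphic_on_subset[OF _ seg])

lemma holo_diff: "f holomorphic_on Om \<Longrightarrow> f field_differentiable at 1"
  using open_Om one_in_Om holomorphic_on_imp_differentiable_at by blast

definition cf :: "nat \<Rightarrow> nat \<Rightarrow> (complex \<Rightarrow> complex) \<Rightarrow> complex" where
  "cf n s f = Lp (alph n) (\<lambda>x. chebJ s (alph n) x * (E x * f x))"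

lemma cf_linear:
  assumes "nice f" "\<And>i. i \<in> I \<Longrightarrow> nice (h i)" "finite I"
  shows "cf n s (\<lambda>x. f x + (\<Sum>i\<in>I. c i * h i x)) = cf n s f + (\<Sum>i\<in>I. c i * cf n s (h i))"
proof -
  have "cf n s (\<lambda>x. f x + (\<Sum>i\<in>I. c i * h i x)) = Lp (alph n) (\<lambda>x. chebJ s (alph n) x * (E x * f x) + (\<Sum>i\<in>I. c i * (chebJ s (alph n) x * (E x * h i x))))"
    unfolding cf_def by (rule Lp_cong) (simp add: algebra_simps sum_distrib_left)
  also have "\<dots> = cf n s f + (\<Sum>i\<in>I. c i * cf n s (h i))"
    unfolding cf_def using assms
    by (subst Lp_add[OF alph_cases], simp, simp, subst Lp_sum[OF alph_cases], simp, simp)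
      (simp add: Lp_cmult[OF alph_cases])
  finally show ?thesis .
qed

lemma cf_cong: "(\<And>x. x \<in> {-1..1::real} \<Longrightarrow> f (of_real x) = h (of_real x)) \<Longrightarrow> cf n s f = cf n s h"
  unfolding cf_def by (rule Lp_cong) simp

lemma cf_zero [simp]: "cf n s (\<lambda>x. 0) = 0"
  by (simp add: cf_def Lp_zero[OF alph_cases])

lemma cf_tendsto_0: "nice f \<Longrightarrow> (\<lambda>s. cf n s f) \<longlonglongrightarrow> 0"
  unfolding cf_def by (rule Lp_chebJ_tendsto_0[OF alph_cases]) simp

text \<open>On the segment \<open>E * hz z\<close> is the Chebyshev polynomial belonging to
  \<open>z\<close>, so by orthonormality the coefficients at the level of \<open>z\<close> form a
  unit vector. Adding a multiple of \<open>hz z\<close> changes a single coefficient at that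
  level.\<close>

definition hz :: "nat \<times> nat \<Rightarrow> complex \<Rightarrow> complex" where
  "hz z x = chebJ (fst z) (alph (snd z)) x * G x"

lemma hz_holo: "hz z holomorphic_on Om"
proof -
  have "(\<lambda>x. chebJ (fst z) (alph (snd z)) x * G x) holomorphic_on Om"
    by (intro holomorphic_intros holomorphic_chebJ G_holo)
  then show ?thesis by (simp add: hz_def[abs_def])
qed

lemma cf_hz: "cf n t (hz (s, n)) = (if t = s then 1 else 0)"
proof -
  have "cf n t (hz (s, n)) = Lp (alph n) (\<lambda>x. chebJ t (alph n) x * chebJ s (alph n) x)"
    unfolding cf_def
  proof (rule Lp_cong)
    fix x :: real assume "x \<in> {-1..1}"
    then show "chebJ t (alph n) (of_real x) * (E (of_real x) * hz (s, n) (of_real x)) = chebJ t (alph n) (of_real x) * chebJ s (alph n) (of_real x)"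
      using EG[of x] by (simp add: hz_def mult.left_commute)
  qed
  then show ?thesis by (simp add: Lp_orthonormal[OF alph_cases])
qed

text \<open>For constant \<open>f\<close> the quotient \<open>dq f\<close> is zero and only
  \<open>E'\<close> is left: these are the tails produced by the constant part of
  \<open>f\<close>.\<close>

definition eps :: "nat \<Rightarrow> complex" where
  "eps t = Lp (1/2) (\<lambda>x. chebJ t (1/2) x * E' x)"

text \<open>For odd \<open>n\<close> the entry at 0 is the sum of all coefficients, the functional
  \<open>f 1\<close>; the later entries are moved by one position because the staircase shift
  changes with the number of rows.\<close>

definition tail :: "nat \<Rightarrow> (complex \<Rightarrow> complex) \<Rightarrow> nat \<Rightarrow> complex" where
  "tail n f t = (if even n then cf (n - 1) t f
     else case t of 0 \<Rightarrow> f 1 | Suc t \<Rightarrow> cf (n - 1) t (dq f) + eps t * f 1)"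

lemma eps_tendsto_0: "eps \<longlonglongrightarrow> 0"
  unfolding eps_def[abs_def] by (rule Lp_chebJ_tendsto_0) (use nice_E' in auto)

lemma tail_tendsto_0:
  assumes "f holomorphic_on Om"
  shows "tail n f \<longlonglongrightarrow> 0"
proof (cases "even n")
  case True
  then show ?thesis using cf_tendsto_0[OF holo_nice[OF assms], of "n - 1"] by (simp add: tail_def[abs_def])
next
  case False
  have "(\<lambda>t. cf (n - 1) t (dq f) + eps t * f 1) \<longlonglongrightarrow> 0 + 0 * f 1"
    using assms open_Om by (intro tendsto_intros cf_tendsto_0 eps_tendsto_0 holo_nice dq_holomorphic)
  then have "(\<lambda>t. tail n f (Suc t)) \<longlonglongrightarrow> 0" using False by (simp add: tail_def)
  then show ?thesis by (rule LIMSEQ_imp_Suc)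
qed

text \<open>For even \<open>n\<close> this is the connection formula. For odd \<open>n\<close> write
  \<open>E f = f 1 + 2 (x - 1) h\<close> with \<open>h = f 1 * E' + E * dq f\<close>: the constant
  part contributes only to the coefficient at 0, and the rest telescopes.\<close>

lemma cf_eq_tail_diff:
  assumes f: "f holomorphic_on Om" and n: "1 \<le> n"
  shows "cf n t f = tail n f t - tail n f (Suc t)"
proof (cases "even n")
  case True
  then have "odd (n - 1)" using n by simp
  then have al: "alph n = 1/2" "alph (n - 1) = -1/2" using True by (simp_all add: alph_def)
  show ?thesis unfolding tail_def cf_def al using True
    by (simp only: if_True) (rule Lp_U_telescope, use holo_nice[OF f] in auto)
next
  case False
  then have "even (n - 1)" by simp
  then have al: "alph n = -1/2" "alph (n - 1) = 1/2" using False by (simp_all add: alph_def)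
  have nd: "nice (dq f)" using f open_Om by (intro holo_nice dq_holomorphic)
  let ?h = "\<lambda>x. f 1 * E' x + E x * dq f x"
  have nh: "nice ?h" using nd nice_E' by auto
  have split: "cf n t f = f 1 * Lp (-1/2) (chebJ t (-1/2)) + Lp (-1/2) (\<lambda>x. chebJ t (-1/2) x * (2 * (x - 1) * ?h x))" for t
  proof -
    have "cf n t f = Lp (-1/2) (\<lambda>x. f 1 * chebJ t (-1/2) x + chebJ t (-1/2) x * (2 * (x - 1) * ?h x))"
      unfolding cf_def al
    proof (rule Lp_cong)
      fix x :: real assume x: "x \<in> {-1..1}"
      let ?x = "of_real x :: complex"
      have "E ?x * f ?x = E ?x * f 1 + E ?x * (2 * (?x - 1) * dq f ?x)"
        by (subst dq_decomp[of f]) (simp add: distrib_left)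
      also have "E ?x * f 1 = (1 + 2 * (?x - 1) * E' ?x) * f 1" by (simp only: E_eq[OF x])
      finally have *: "E ?x * f ?x = f 1 + 2 * (?x - 1) * ?h ?x" by (simp add: algebra_simps)
      show "chebJ t (-1/2) ?x * (E ?x * f ?x) = f 1 * chebJ t (-1/2) ?x + chebJ t (-1/2) ?x * (2 * (?x - 1) * ?h ?x)"
        unfolding * by (simp only: distrib_left mult.commute)
    qed
    also have "\<dots> = Lp (-1/2) (\<lambda>x. f 1 * chebJ t (-1/2) x) + Lp (-1/2) (\<lambda>x. chebJ t (-1/2) x * (2 * (x - 1) * ?h x))"
      using nh by (intro Lp_add) auto
    finally show ?thesis by (simp add: Lp_cmult)
  qed
  have tl: "tail n f (Suc t) = Lp (1/2) (\<lambda>x. chebJ t (1/2) x * ?h x)" for t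
  proof -
    have "Lp (1/2) (\<lambda>x. chebJ t (1/2) x * ?h x) = Lp (1/2) (\<lambda>x. f 1 * (chebJ t (1/2) x * E' x) + chebJ t (1/2) x * (E x * dq f x))"
      by (rule Lp_cong) (simp add: algebra_simps)
    also have "\<dots> = Lp (1/2) (\<lambda>x. f 1 * (chebJ t (1/2) x * E' x)) + Lp (1/2) (\<lambda>x. chebJ t (1/2) x * (E x * dq f x))"
      using nd nice_E' by (intro Lp_add) auto
    finally show ?thesis unfolding tail_def cf_def eps_def al using False by (simp add: Lp_cmult)
  qed
  show ?thesis
  proof (cases t)
    case 0
    have "cf n 0 f = f 1 - Lp (1/2) (\<lambda>x. chebJ 0 (1/2) x * ?h x)"
      unfolding split Lp_W_telescope(2)[OF nh] Lp_chebW by simp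
    moreover have "tail n f 0 = f 1" using False by (simp add: tail_def)
    ultimately show ?thesis unfolding 0 tl by simp
  next
    case (Suc m)
    show ?thesis unfolding Suc tl split Lp_W_telescope(1)[OF nh] Lp_chebW by simp
  qed
qed

end

section \<open>The correlation kernel\<close>

lemma rr_mono: "m \<le> n \<Longrightarrow> rr m \<le> rr n"
  by (simp add: rr_def div_le_mono)

lemma rr_pred: "1 \<le> n \<Longrightarrow> rr n = rr (n - 1) + (if odd n then 1 else 0)"
  by (cases n) (auto simp: rr_def elim!: evenE oddE)

text \<open>Level \<open>2 * i + 1\<close> is the lowest one with more than \<open>i\<close> rows,
  hence the level below which column \<open>i\<close> is constant.\<close>

lemma less_rr_iff: "i < rr n \<longleftrightarrow> 2 * i + 1 \<le> n"
  by (auto simp: rr_def)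

text \<open>\<open>lev l\<close> and \<open>sp l\<close> are the coordinates of the \<open>l\<close>-th point, whose occupation is weighted by
  \<open>1 + t\<close>; \<open>Phi n i\<close> are the functions whose coefficients form the columns at level \<open>n\<close>.\<close>
locale weighted_levels = level_system +
  fixes zs :: "(nat \<times> nat) list" and t :: complex and N :: nat
  assumes dist: "distinct zs" and lev_range: "\<And>z. z \<in> set zs \<Longrightarrow> 1 \<le> snd z \<and> snd z \<le> N"
begin

abbreviation "k \<equiv> length zs"
abbreviation "r \<equiv> rr N"
abbreviation "lev l \<equiv> snd (zs ! l)"
abbreviation "sp l \<equiv> fst (zs ! l)"

text \<open>Finite rank operator that realizes the weights at level \<open>n\<close>: on
  coefficients it multiplies the marked positions by \<open>1 + t\<close>.\<close>

definition Dz :: "nat \<Rightarrow> (complex \<Rightarrow> complex) \<Rightarrow> complex \<Rightarrow> complex" where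
  "Dz n f = (\<lambda>x. f x + (\<Sum>l\<in>{l. l < k \<and> lev l = n}. (t * cf n (sp l) f) * hz (zs ! l) x))"

lemma Dz_holo: "f holomorphic_on Om \<Longrightarrow> Dz n f holomorphic_on Om"
  unfolding Dz_def by (intro holomorphic_intros hz_holo) auto

lemma cf_Dz:
  assumes "f holomorphic_on Om"
  shows "cf n s (Dz n f) = (if (s, n) \<in> set zs then 1 + t else 1) * cf n s f"
proof -
  have "cf n s (Dz n f) = cf n s f + (\<Sum>l\<in>{l. l < k \<and> lev l = n}. (t * cf n (sp l) f) * cf n s (hz (zs ! l)))"
    unfolding Dz_def using assms by (intro cf_linear holo_nice hz_holo) auto
  also have "(\<Sum>l\<in>{l. l < k \<and> lev l = n}. (t * cf n (sp l) f) * cf n s (hz (zs ! l)))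
     = (\<Sum>l\<in>{l. l < k \<and> lev l = n}. if zs ! l = (s, n) then t * cf n s f else 0)"
  proof (rule sum.cong[OF refl])
    fix l assume "l \<in> {l. l < k \<and> lev l = n}"
    then have "zs ! l = (sp l, n)" by (metis (mono_tags, lifting) mem_Collect_eq prod.collapse)
    then show "(t * cf n (sp l) f) * cf n s (hz (zs ! l)) = (if zs ! l = (s, n) then t * cf n s f else 0)"
      using cf_hz[of n s "sp l"] by (cases "s = sp l") auto
  qed
  also have "\<dots> = (\<Sum>l\<in>{l. l < k \<and> zs ! l = (s, n)}. t * cf n s f)"
    by (rule sum.mono_neutral_cong_right) auto
  \<comment> \<open>Marked points are distinct, so at most one index matches and the weight is
    \<open>1 + t\<close>, not \<open>1 + 2 * t\<close> or more.\<close>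
  also have "\<dots> = (if (s, n) \<in> set zs then t * cf n s f else 0)"
  proof (cases "(s, n) \<in> set zs")
    case True
    then obtain l where l: "l < k" "zs ! l = (s, n)" by (metis in_set_conv_nth)
    then have "{l. l < k \<and> zs ! l = (s, n)} = {l}"
      using dist nth_eq_iff_index_eq by fastforce
    then show ?thesis using True by simp
  next
    case False
    then have "{l. l < k \<and> zs ! l = (s, n)} = {}" using nth_mem by fastforce
    then show ?thesis using False by simp
  qed
  finally show ?thesis by (simp add: algebra_simps)
qed

primrec PhiD :: "nat \<Rightarrow> nat \<Rightarrow> complex \<Rightarrow> complex" where
  "PhiD 0 = (\<lambda>i x. (2 * (x - 1)) ^ (r - 1 - i))"
| "PhiD (Suc d) = (\<lambda>i. if odd (N - d) then dq (Dz (N - d) (PhiD d i)) else Dz (N - d) (PhiD d i))"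

definition Phi :: "nat \<Rightarrow> nat \<Rightarrow> complex \<Rightarrow> complex" where
  "Phi n = PhiD (N - n)"

lemma Phi_top: "Phi N i = (\<lambda>x. (2 * (x - 1)) ^ (r - 1 - i))"
  unfolding Phi_def by (simp only: diff_self_eq_0 PhiD.simps)

lemma Phi_step:
  assumes "1 \<le> n" "n \<le> N"
  shows "Phi (n - 1) i = (if odd n then dq (Dz n (Phi n i)) else Dz n (Phi n i))"
proof -
  have "N - (n - 1) = Suc (N - n)" "N - (N - n) = n" using assms by auto
  then show ?thesis unfolding Phi_def by (simp only: PhiD.simps)
qed

lemma Phi_holo: "Phi n i holomorphic_on Om"
proof -
  have "PhiD d i holomorphic_on Om" for d
  proof (induction d)
    case 0
    show ?case unfolding PhiD.simps by (intro holomorphic_intros)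
  next
    case (Suc d)
    then show ?case unfolding PhiD.simps using open_Om by (auto intro: dq_holomorphic Dz_holo)
  qed
  then show ?thesis by (simp add: Phi_def)
qed

text \<open>Amplitude with which marked point \<open>l\<close> perturbs column \<open>i\<close>. It
  depends on the perturbations made at higher levels and stays unknown until
  \<open>detk_resolvent\<close> eliminates it.\<close>

definition ac :: "nat \<Rightarrow> nat \<Rightarrow> complex" where
  "ac i l = cf (lev l) (sp l) (Phi (lev l) i)"

lemma lev_bounds: "l < k \<Longrightarrow> 1 \<le> lev l \<and> lev l \<le> N"
  using lev_range nth_mem by blast

lemma Dz_Phi_of_Phi:
  assumes "n \<le> N"
    and "Phi n i = (\<lambda>x. (dq ^^ (r - rr n)) (Phi N i) x
      + (\<Sum>l\<in>{l. l < k \<and> n < lev l}. (t * ac i l) * (dq ^^ (rr (lev l) - rr n)) (hz (zs ! l)) x))"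
  shows "Dz n (Phi n i) = (\<lambda>x. (dq ^^ (r - rr n)) (Phi N i) x
      + (\<Sum>l\<in>{l. l < k \<and> n \<le> lev l}. (t * ac i l) * (dq ^^ (rr (lev l) - rr n)) (hz (zs ! l)) x))"
proof (rule ext)
  fix x
  have s: "{l. l < k \<and> n \<le> lev l} = {l. l < k \<and> n < lev l} \<union> {l. l < k \<and> lev l = n}" by auto
  have "Dz n (Phi n i) x = Phi n i x + (\<Sum>l\<in>{l. l < k \<and> lev l = n}. (t * ac i l) * (dq ^^ (rr (lev l) - rr n)) (hz (zs ! l)) x)"
    unfolding Dz_def by (intro arg_cong2[where f = "(+)"] refl sum.cong) (auto simp: ac_def)
  also have "Phi n i x = (dq ^^ (r - rr n)) (Phi N i) x
      + (\<Sum>l\<in>{l. l < k \<and> n < lev l}. (t * ac i l) * (dq ^^ (rr (lev l) - rr n)) (hz (zs ! l)) x)"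
    by (subst assms(2)) (rule refl)
  finally show "Dz n (Phi n i) x = (dq ^^ (r - rr n)) (Phi N i) x
      + (\<Sum>l\<in>{l. l < k \<and> n \<le> lev l}. (t * ac i l) * (dq ^^ (rr (lev l) - rr n)) (hz (zs ! l)) x)"
    unfolding s by (subst sum.union_disjoint) (auto simp: add.assoc)
qed

text \<open>By linearity of \<open>dq\<close>, the perturbation made at level \<open>lev l\<close>
  is carried down with one difference quotient for each particle lost on the way.\<close>

lemma Phi_eq:
  assumes "n \<le> N"
  shows "Phi n i = (\<lambda>x. (dq ^^ (r - rr n)) (Phi N i) x
      + (\<Sum>l\<in>{l. l < k \<and> n < lev l}. (t * ac i l) * (dq ^^ (rr (lev l) - rr n)) (hz (zs ! l)) x))"
  using assms
proof (induction "N - n" arbitrary: n)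
  case 0
  then have n: "n = N" by simp
  have e: "{l. l < k \<and> N < lev l} = {}" using lev_bounds by fastforce
  show ?case unfolding n e by simp
next
  case (Suc d)
  define m where "m = Suc n"
  have m: "1 \<le> m" "m \<le> N" "m - 1 = n" "d = N - m" using Suc by (auto simp: m_def)
  have D: "Dz m (Phi m i) = (\<lambda>x. (dq ^^ (r - rr m)) (Phi N i) x
      + (\<Sum>l\<in>{l. l < k \<and> m \<le> lev l}. (t * ac i l) * (dq ^^ (rr (lev l) - rr m)) (hz (zs ! l)) x))"
    by (rule Dz_Phi_of_Phi[OF m(2) Suc.hyps(1)[OF m(4) m(2)]])
  have s: "{l. l < k \<and> m \<le> lev l} = {l. l < k \<and> n < lev l}" by (auto simp: m_def)
  show ?case
  proof (cases "odd m")
    case True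
    then have rm: "rr m = Suc (rr n)" using rr_pred[OF m(1)] m(3) by simp
    have e1: "Suc (r - rr m) = r - rr n" using rm rr_mono[OF m(2)] by simp
    have e2: "Suc (rr (lev l) - rr m) = rr (lev l) - rr n" if "m \<le> lev l" for l
      using rm rr_mono[OF that] by simp
    have hd: "(dq ^^ j) f field_differentiable at 1" if "f holomorphic_on Om" for j f
      using that open_Om by (intro holo_diff dq_pow_holomorphic)
    have "Phi n i = dq (Dz m (Phi m i))" using Phi_step[OF m(1,2), of i] True m(3) by simp
    also have "\<dots> = (\<lambda>x. dq ((dq ^^ (r - rr m)) (Phi N i)) x
      + (\<Sum>l\<in>{l. l < k \<and> m \<le> lev l}. (t * ac i l) * dq ((dq ^^ (rr (lev l) - rr m)) (hz (zs ! l))) x))"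
      unfolding D by (rule dq_linear) (auto intro: hd hz_holo Phi_holo)
    also have "\<dots> = (\<lambda>x. (dq ^^ (r - rr n)) (Phi N i) x
      + (\<Sum>l\<in>{l. l < k \<and> m \<le> lev l}. (t * ac i l) * (dq ^^ (rr (lev l) - rr n)) (hz (zs ! l)) x))"
      unfolding e1[symmetric] by (intro ext arg_cong2[where f = "(+)"] sum.cong refl) (auto simp: e2[symmetric])
    finally show ?thesis unfolding s .
  next
    case False
    then have rm: "rr m = rr n" using rr_pred[OF m(1)] m(3) by simp
    have "Phi n i = Dz m (Phi m i)" using Phi_step[OF m(1,2), of i] False m(3) by simp
    then show ?thesis using D unfolding s rm by simp
  qed
qed

text \<open>Column \<open>j\<close> becomes constant on descending from level
  \<open>2 * j + 1\<close>, and the functional that survives is evaluation at 1.\<close>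

definition cc :: "nat \<Rightarrow> nat \<Rightarrow> complex" where
  "cc i j = Dz (2 * j + 1) (Phi (2 * j + 1) i) 1"

text \<open>\<open>Rm\<close> collects Taylor coefficients at 1 of the perturbing functions,
  \<open>Psi\<close> the amplitudes without any perturbation, and \<open>Um\<close> the effect of a
  marked point on marked points at lower levels.\<close>

definition Rm :: "nat \<Rightarrow> nat \<Rightarrow> complex" where
  "Rm l j = (if j < rr (lev l) then (dq ^^ (rr (lev l) - Suc j)) (hz (zs ! l)) 1 else 0)"

definition Psi :: "nat \<Rightarrow> nat \<Rightarrow> complex" where
  "Psi i l = (if i < rr (lev l) then cf (lev l) (sp l) (\<lambda>x. (2 * (x - 1)) ^ (rr (lev l) - 1 - i)) else 0)"

definition Um :: "nat \<Rightarrow> nat \<Rightarrow> complex" where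
  "Um l' l = (if lev l < lev l' then cf (lev l) (sp l) ((dq ^^ (rr (lev l') - rr (lev l))) (hz (zs ! l'))) else 0)"

lemma cc_eq:
  assumes "i < r" "j < r"
  shows "cc i j = (if i = j then 1 else 0) + (\<Sum>l<k. ac i l * (t * Rm l j))"
proof -
  let ?n = "2 * j + 1"
  have n: "?n \<le> N" using assms less_rr_iff by blast
  have rn: "rr ?n = Suc j" by (simp add: rr_def)
  have "cc i j = (dq ^^ (r - rr ?n)) (Phi N i) 1
      + (\<Sum>l\<in>{l. l < k \<and> ?n \<le> lev l}. (t * ac i l) * (dq ^^ (rr (lev l) - rr ?n)) (hz (zs ! l)) 1)"
    unfolding cc_def by (subst Dz_Phi_of_Phi[OF n Phi_eq[OF n]]) (rule refl)
  also have "(dq ^^ (r - rr ?n)) (Phi N i) 1 = (if i = j then 1 else 0)"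
    unfolding Phi_top dq_pow_power rn using assms by (auto simp: power_0_left)
  also have "(\<Sum>l\<in>{l. l < k \<and> ?n \<le> lev l}. (t * ac i l) * (dq ^^ (rr (lev l) - rr ?n)) (hz (zs ! l)) 1)
     = (\<Sum>l<k. ac i l * (t * Rm l j))"
    by (rule sum.mono_neutral_cong_left) (use rn in \<open>auto simp: Rm_def less_rr_iff\<close>)
  finally show ?thesis .
qed

text \<open>Self-consistency of the amplitudes. \<open>Um\<close> acts only from a level to strictly
  lower ones, which is the triangularity that \<open>detk_resolvent\<close> asks for.\<close>

lemma ac_eq:
  assumes "i < r" "l < k"
  shows "ac i l = Psi i l + (\<Sum>l'<k. ac i l' * (t * Um l' l))"
proof -
  let ?n = "lev l"
  have n: "?n \<le> N" using lev_bounds[OF assms(2)] by simp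
  have "ac i l = cf ?n (sp l) ((dq ^^ (r - rr ?n)) (Phi N i))
     + (\<Sum>l'\<in>{l'. l' < k \<and> ?n < lev l'}. (t * ac i l') * cf ?n (sp l) ((dq ^^ (rr (lev l') - rr ?n)) (hz (zs ! l'))))"
    unfolding ac_def[of i l]
    by (subst Phi_eq[OF n], rule cf_linear)
      (auto intro!: holo_nice dq_pow_holomorphic Phi_holo hz_holo open_Om)
  also have "cf ?n (sp l) ((dq ^^ (r - rr ?n)) (Phi N i)) = Psi i l"
  proof (cases "i < rr ?n")
    case True
    then have "r - rr ?n \<le> r - 1 - i" "r - 1 - i - (r - rr ?n) = rr ?n - 1 - i"
      using rr_mono[OF n] by auto
    then show ?thesis unfolding Phi_top dq_pow_power Psi_def using True by (simp only: if_True)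
  next
    case False
    then have "\<not> r - rr ?n \<le> r - 1 - i" using assms by auto
    then show ?thesis unfolding Phi_top dq_pow_power Psi_def using False by (simp only: if_False cf_zero)
  qed
  also have "(\<Sum>l'\<in>{l'. l' < k \<and> ?n < lev l'}. (t * ac i l') * cf ?n (sp l) ((dq ^^ (rr (lev l') - rr ?n)) (hz (zs ! l'))))
     = (\<Sum>l'<k. ac i l' * (t * Um l' l))"
    by (rule sum.mono_neutral_cong_left) (auto simp: Um_def)
  finally show ?thesis .
qed

end

section \<open>Identification of the kernel by Taylor expansion at 1\<close>

context level_system begin

text \<open>The kernel before the contour integral is introduced: the iterated quotient of order
  \<open>rr m\<close> stands for that integral, and powers of \<open>2 * (x - 1)\<close> for those
  of \<open>1 - x\<close>.\<close>

definition KT :: "nat \<times> nat \<Rightarrow> nat \<times> nat \<Rightarrow> complex" where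
  "KT z z' = (case z of (s, n) \<Rightarrow> case z' of (_, m) \<Rightarrow>
     (if m \<le> n then cf n s (\<lambda>x. (2 * (x - 1)) ^ (rr n - rr m) * hz z' x) else 0)
     - cf n s (\<lambda>x. (2 * (x - 1)) ^ rr n * (dq ^^ rr m) (hz z') x))"

lemma cf_dq_expansion:
  assumes "f holomorphic_on Om"
  shows "cf n s (\<lambda>x. (2 * (x - 1)) ^ e * f x) = (\<Sum>i<b. (dq ^^ i) f 1 * cf n s (\<lambda>x. (2 * (x - 1)) ^ (e + i)))
      + cf n s (\<lambda>x. (2 * (x - 1)) ^ (e + b) * (dq ^^ b) f x)"
proof -
  have "cf n s (\<lambda>x. (2 * (x - 1)) ^ e * f x) = cf n s (\<lambda>x. (2 * (x - 1)) ^ (e + b) * (dq ^^ b) f x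
      + (\<Sum>i\<in>{..<b}. (dq ^^ i) f 1 * (2 * (x - 1)) ^ (e + i)))"
    by (rule cf_cong, subst dq_expansion[of f _ b])
      (simp only: distrib_left sum_distrib_left power_add mult_ac add.commute)
  also have "\<dots> = cf n s (\<lambda>x. (2 * (x - 1)) ^ (e + b) * (dq ^^ b) f x)
      + (\<Sum>i\<in>{..<b}. (dq ^^ i) f 1 * cf n s (\<lambda>x. (2 * (x - 1)) ^ (e + i)))"
    using assms open_Om by (intro cf_linear nice_mult holo_nice[of "(dq ^^ b) f"] dq_pow_holomorphic) auto
  finally show ?thesis by simp
qed

end

context weighted_levels begin

text \<open>The sum over \<open>i\<close> is the polynomial part of a Taylor expansion at 1. For
  \<open>m <= n\<close> it is the function minus its remainder. For \<open>m > n\<close> the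
  expansion is that of the quotient of order \<open>rr m - rr n\<close>, whose coefficient is
  exactly \<open>Um\<close>, and subtracting it leaves the remainder alone.\<close>

lemma KT_eq:
  assumes "l < k" "l' < k"
  shows "(\<Sum>i<r. Rm l' i * Psi i l) - Um l' l = KT (zs ! l) (zs ! l')"
proof -
  obtain s n where z: "zs ! l = (s, n)" by fastforce
  obtain s' m where z': "zs ! l' = (s', m)" by fastforce
  have nm: "rr n \<le> r" "rr m \<le> r"
    using lev_bounds[OF assms(1)] lev_bounds[OF assms(2)] z z' by (auto intro: rr_mono)
  let ?h = "hz (s', m)"
  let ?c = "\<lambda>j. cf n s (\<lambda>x. (2 * (x - 1)) ^ j)"
  have sum: "(\<Sum>i<r. Rm l' i * Psi i l) = (\<Sum>i<min (rr n) (rr m). (dq ^^ (rr m - Suc i)) ?h 1 * ?c (rr n - 1 - i))"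
    by (rule sum.mono_neutral_cong_right) (use nm z z' in \<open>auto simp: Rm_def Psi_def\<close>)
  show ?thesis
  proof (cases "m \<le> n")
    case True
    then have rmn: "rr m \<le> rr n" by (rule rr_mono)
    have "cf n s (\<lambda>x. (2 * (x - 1)) ^ (rr n - rr m) * ?h x)
       = (\<Sum>i<rr m. (dq ^^ i) ?h 1 * ?c (rr n - rr m + i)) + cf n s (\<lambda>x. (2 * (x - 1)) ^ (rr n - rr m + rr m) * (dq ^^ rr m) ?h x)"
      by (rule cf_dq_expansion[OF hz_holo])
    also have "(\<Sum>i<rr m. (dq ^^ i) ?h 1 * ?c (rr n - rr m + i)) = (\<Sum>i<rr m. (dq ^^ (rr m - Suc i)) ?h 1 * ?c (rr n - rr m + (rr m - Suc i)))"
      by (rule sum.nat_diff_reindex[symmetric])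
    also have "\<dots> = (\<Sum>i<min (rr n) (rr m). (dq ^^ (rr m - Suc i)) ?h 1 * ?c (rr n - 1 - i))"
      by (rule sum.cong) (use rmn in auto)
    also have "rr n - rr m + rr m = rr n" using rmn by simp
    finally show ?thesis
      unfolding sum KT_def z z' prod.case using True by (simp add: Um_def z z' del: right_diff_distrib_numeral)
  next
    case False
    then have rnm: "rr n \<le> rr m" by (intro rr_mono) simp
    let ?p = "rr m - rr n"
    have "cf n s ((dq ^^ ?p) ?h) = cf n s (\<lambda>x. (2 * (x - 1)) ^ 0 * (dq ^^ ?p) ?h x)" by simp
    also have "\<dots> = (\<Sum>i<rr n. (dq ^^ i) ((dq ^^ ?p) ?h) 1 * ?c (0 + i)) + cf n s (\<lambda>x. (2 * (x - 1)) ^ (0 + rr n) * (dq ^^ rr n) ((dq ^^ ?p) ?h) x)"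
      by (rule cf_dq_expansion) (intro dq_pow_holomorphic hz_holo open_Om)
    also have "(dq ^^ rr n) ((dq ^^ ?p) ?h) = (dq ^^ rr m) ?h"
      using rnm by (simp flip: funpow_add o_apply[of "dq ^^ rr n"])
    also have "(\<Sum>i<rr n. (dq ^^ i) ((dq ^^ ?p) ?h) 1 * ?c (0 + i)) = (\<Sum>i<rr n. (dq ^^ (i + ?p)) ?h 1 * ?c i)"
      by (simp only: funpow_add o_apply add_0)
    also have "\<dots> = (\<Sum>i<rr n. (dq ^^ (rr n - Suc i + ?p)) ?h 1 * ?c (rr n - Suc i))"
      by (rule sum.nat_diff_reindex[symmetric])
    also have "\<dots> = (\<Sum>i<min (rr n) (rr m). (dq ^^ (rr m - Suc i)) ?h 1 * ?c (rr n - 1 - i))"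
      by (rule sum.cong) (use rnm in auto)
    finally show ?thesis
      unfolding sum KT_def z z' prod.case using False by (simp add: Um_def z z' del: right_diff_distrib_numeral)
  qed
qed

lemma detk_cc:
  "detk r cc = detk k (\<lambda>i j. (if i = j then 1 else 0) + t * KT (zs ! i) (zs ! j))"
proof -
  have "detk r cc = detk r (\<lambda>i j. (if i = j then 1 else 0) + (\<Sum>l<k. ac i l * (t * Rm l j)))"
    by (rule detk_cong) (rule cc_eq)
  also have "\<dots> = detk k (\<lambda>l' l. (if l' = l then 1 else 0) + ((\<Sum>i<r. (t * Rm l' i) * Psi i l) - t * Um l' l))"
    by (rule detk_resolvent[where h = lev]) (use ac_eq in \<open>auto simp: Um_def\<close>)
  also have "\<dots> = detk k (\<lambda>l' l. (if l = l' then 1 else 0) + t * KT (zs ! l) (zs ! l'))"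
    by (rule detk_cong) (auto simp: KT_eq[symmetric] sum_distrib_left mult.assoc right_diff_distrib)
  \<comment> \<open>The resolvent formula lists the perturbing point first, the kernel the point at
    which the coefficient is taken; a transposition reconciles the two.\<close>
  also have "\<dots> = detk k (\<lambda>l l'. (if l = l' then 1 else 0) + t * KT (zs ! l) (zs ! l'))"
    by (rule detk_transpose)
  finally show ?thesis .
qed

end

section \<open>From weighted paths to correlation functions\<close>

definition lvl_points :: "nat \<Rightarrow> nat list \<Rightarrow> (nat \<times> nat) set" where
  "lvl_points m v = {(tld m v j, m) | j. 1 \<le> j \<and> j \<le> rr m}"

lemma mem_pointset_iff: "1 \<le> snd z \<Longrightarrow> z \<in> pointset w \<longleftrightarrow> z \<in> lvl_points (snd z) (w (snd z))"
  by (auto simp: pointset_def lvl_points_def)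

lemma lvl_points_eq: "lvl_points m v = (\<lambda>s. (s, m)) ` ((\<lambda>j. tld m v (Suc j)) ` {..<rr m})"
  by (auto simp: lvl_points_def image_iff) (metis Suc_le_D lessThan_iff Suc_le_eq)

locale plancherel_process = level_system E E' G Om + path_measure M
  for E E' G :: "complex \<Rightarrow> complex" and Om :: "complex set" and M :: "(nat \<Rightarrow> nat list) measure" +
  assumes cylinder: "\<And>n u. 1 \<le> n \<Longrightarrow> complex_of_real (measure M {w \<in> space M. \<forall>m\<in>{1..n}. w m = u m}) =
     (if okpath n u then detk (rr n) (\<lambda>i j. cf n (tld n (u n) (Suc j)) (\<lambda>x. (2 * (x - 1)) ^ (rr n - 1 - i))) else 0)"
begin

lemma generating_function:
  fixes zs :: "(nat \<times> nat) list" and t :: complex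
  assumes dist: "distinct zs" and lev: "\<And>z. z \<in> set zs \<Longrightarrow> 1 \<le> snd z"
  shows "(\<integral>w. (\<Prod>z\<in>set zs. if z \<in> pointset w then 1 + t else 1) \<partial>M)
       = detk (length zs) (\<lambda>i j. (if i = j then 1 else 0) + t * KT (zs ! i) (zs ! j))"
proof -
  \<comment> \<open>Any level above all marked ones can serve as top; the sum of the levels is an
    easy bound.\<close>
  define N where "N = Suc (sum_list (map snd zs))"
  have N: "1 \<le> N" by (simp add: N_def)
  interpret weighted_levels E E' G Om zs t N
  proof
    fix z assume "z \<in> set zs"
    then show "1 \<le> snd z \<and> snd z \<le> N"
      using lev member_le_sum_list[of "snd z" "map snd zs"] by (auto simp: N_def)
  qed (rule dist)
  define g where "g = (\<lambda>m v. \<Prod>z\<in>{z \<in> set zs. snd z = m}. if z \<in> lvl_points m v then 1 + t else 1)"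
  have gb: "norm (g m v) \<le> (1 + norm t) ^ length zs" for m v
  proof -
    have "norm (g m v) \<le> (\<Prod>z\<in>{z \<in> set zs. snd z = m}. 1 + norm t)"
      unfolding g_def prod_norm[symmetric]
      by (intro prod_mono) (auto intro: order_trans[OF norm_triangle_ineq])
    also have "\<dots> = (1 + norm t) ^ card {z \<in> set zs. snd z = m}" by simp
    also have "\<dots> \<le> (1 + norm t) ^ length zs"
      by (intro power_increasing) (auto intro: order_trans[OF card_mono card_length])
    finally show ?thesis .
  qed
  \<comment> \<open>The rows of one partition occupy distinct positions, so the product over marked
    points can be taken over rows, and each factor is absorbed by one column.\<close>
  have gk: "g n v = (\<Prod>j<rr n. if (tld n v (Suc j), n) \<in> set zs then 1 + t else 1)" if v: "v \<in> JJ n" for n v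
  proof -
    let ?A = "{z \<in> set zs. snd z = n}" and ?S = "(\<lambda>j. tld n v (Suc j)) ` {..<rr n}"
    have "g n v = (\<Prod>z\<in>?A \<inter> lvl_points n v. 1 + t)"
      unfolding g_def by (rule prod.inter_restrict[symmetric]) simp
    also have "?A \<inter> lvl_points n v = (\<lambda>s. (s, n)) ` (?S \<inter> {s. (s, n) \<in> set zs})"
      unfolding lvl_points_eq by auto
    also have "(\<Prod>z\<in>\<dots>. 1 + t) = (\<Prod>s\<in>?S \<inter> {s. (s, n) \<in> set zs}. 1 + t)"
      by (subst prod.reindex) (auto simp: inj_on_def)
    also have "\<dots> = (\<Prod>s\<in>?S. if s \<in> {s. (s, n) \<in> set zs} then 1 + t else 1)"
      by (rule prod.inter_restrict) simp
    also have "\<dots> = (\<Prod>j<rr n. if (tld n v (Suc j), n) \<in> set zs then 1 + t else 1)"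
      by (subst prod.reindex[OF inj_on_tld[OF v]]) simp
    finally show ?thesis .
  qed
  interpret path_descent M g N r "(1 + norm t) ^ length zs" "\<lambda>n i s. cf n s (Phi n i)"
    "\<lambda>n i s. cf n s (Dz n (Phi n i))" "\<lambda>n i. tail n (Dz n (Phi n i))" cc eps
  proof
    fix u
    show "fut g N N u = (if okpath N u then detk r (\<lambda>i j. cf N (tld N (u N) (Suc j)) (Phi N i)) else 0)"
      unfolding fut_top cylinder[OF N] Phi_top ..
  next
    fix n v assume n: "1 \<le> n" "n \<le> N" and v: "v \<in> JJ n"
    let ?\<kappa> = "\<lambda>j. if j < rr n then (if (tld n v (Suc j), n) \<in> set zs then 1 + t else 1) else 1"
    have "{..<r} = {..<rr n} \<union> {rr n..<r}" using rr_mono[OF n(2)] by auto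
    then have "(\<Prod>j<r. ?\<kappa> j) = (\<Prod>j<rr n. ?\<kappa> j) * (\<Prod>j\<in>{rr n..<r}. ?\<kappa> j)"
      by (simp only: ivl_disj_int prod.union_disjoint finite_lessThan finite_atLeastLessThan)
    then have "g n v = (\<Prod>j<r. ?\<kappa> j)" by (simp add: gk[OF v])
    then have "g n v * detk r (\<lambda>i j. if j < rr n then cf n (tld n v (Suc j)) (Phi n i) else cc i j)
       = detk r (\<lambda>i j. ?\<kappa> j * (if j < rr n then cf n (tld n v (Suc j)) (Phi n i) else cc i j))"
      by (simp only: detk_scale_cols)
    also have "\<dots> = detk r (\<lambda>i j. if j < rr n then cf n (tld n v (Suc j)) (Dz n (Phi n i)) else cc i j)"
      by (rule detk_cong) (simp add: cf_Dz[OF Phi_holo])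
    finally show "g n v * detk r (\<lambda>i j. if j < rr n then cf n (tld n v (Suc j)) (Phi n i) else cc i j)
       = detk r (\<lambda>i j. if j < rr n then cf n (tld n v (Suc j)) (Dz n (Phi n i)) else cc i j)" .
  next
    fix n i s assume n: "1 \<le> n" "n \<le> N" "odd n"
    show "tail n (Dz n (Phi n i)) (Suc s) = cf (n - 1) s (Phi (n - 1) i) + eps s * cc i (rr n - 1)"
      and "tail n (Dz n (Phi n i)) 0 = cc i (rr n - 1)"
      using n Phi_step[OF n(1,2), of i] by (auto simp: tail_def cc_def rr_def elim!: oddE)
  next
    fix n i s assume n: "1 \<le> n" "n \<le> N" "even n"
    then show "tail n (Dz n (Phi n i)) s = cf (n - 1) s (Phi (n - 1) i)"
      using Phi_step[OF n(1,2), of i] by (simp add: tail_def)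
  qed (use gb Phi_holo Dz_holo in \<open>auto intro!: tail_tendsto_0 cf_eq_tail_diff\<close>)
  have "(\<Prod>z\<in>set zs. if z \<in> pointset w then 1 + t else 1) = (\<Prod>m\<in>{1..N}. g m (w m))" for w
  proof -
    have "(\<Prod>m\<in>{1..N}. g m (w m)) = (\<Prod>m\<in>{1..N}. \<Prod>z\<in>{z \<in> set zs. snd z = m}. if z \<in> pointset w then 1 + t else 1)"
      unfolding g_def by (intro prod.cong refl) (use lev mem_pointset_iff in auto)
    also have "\<dots> = (\<Prod>z\<in>set zs. if z \<in> pointset w then 1 + t else 1)"
      by (rule prod.group) (use lev_range in auto)
    finally show ?thesis ..
  qed
  then show ?thesis using expectation_eq_detk detk_cc by simp
qed

lemma measurable_pointset: "1 \<le> snd z \<Longrightarrow> Measurable.pred M (\<lambda>w. z \<in> pointset w)"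
  unfolding mem_pointset_iff by measurable

text \<open>The weight \<open>(1 + t)\<close> per occupied point, divided by \<open>t\<close> per point, tends to the indicator that all
  points are occupied.\<close>
theorem correlation_KT:
  assumes dist: "distinct zs" and lev: "\<And>z. z \<in> set zs \<Longrightarrow> 1 \<le> snd z"
  shows "complex_of_real (measure M {w \<in> space M. set zs \<subseteq> pointset w})
       = detk (length zs) (\<lambda>i j. KT (zs ! i) (zs ! j))"
proof -
  let ?t = "\<lambda>R::nat. complex_of_nat (Suc R)"
  let ?f = "\<lambda>R w. \<Prod>z\<in>set zs. (if z \<in> pointset w then 1 + ?t R else 1) / ?t R"
  have tinf: "(\<lambda>R. 1 / ?t R) \<longlonglongrightarrow> 0"
    using LIMSEQ_Suc[OF lim_1_over_n[where 'a = complex]] by simp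
  have A: "(\<integral>w. ?f R w \<partial>M) = detk (length zs) (\<lambda>i j. (if i = j then 1 / ?t R else 0) + KT (zs ! i) (zs ! j))" for R
  proof -
    have "(\<integral>w. ?f R w \<partial>M) = (\<integral>w. (1 / ?t R ^ length zs) * (\<Prod>z\<in>set zs. if z \<in> pointset w then 1 + ?t R else 1) \<partial>M)"
      by (intro Bochner_Integration.integral_cong refl) (simp add: prod_dividef distinct_card[OF dist] del: of_nat_Suc)
    also have "\<dots> = (1 / ?t R ^ length zs) * detk (length zs) (\<lambda>i j. (if i = j then 1 else 0) + ?t R * KT (zs ! i) (zs ! j))"
      by (simp only: integral_mult_right_zero generating_function[OF dist lev])
    also have "\<dots> = detk (length zs) (\<lambda>i j. (1 / ?t R) * ((if i = j then 1 else 0) + ?t R * KT (zs ! i) (zs ! j)))"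
      by (subst detk_scale_rows) (simp add: power_one_over)
    also have "\<dots> = detk (length zs) (\<lambda>i j. (if i = j then 1 / ?t R else 0) + KT (zs ! i) (zs ! j))"
      by (rule detk_cong) (simp add: distrib_left del: of_nat_Suc)
    finally show ?thesis .
  qed
  have "(\<lambda>R. detk (length zs) (\<lambda>i j. (if i = j then 1 / ?t R else 0) + KT (zs ! i) (zs ! j)))
     \<longlonglongrightarrow> detk (length zs) (\<lambda>i j. KT (zs ! i) (zs ! j))"
  proof (rule tendsto_detk)
    fix i j
    have "(\<lambda>R. (if i = j then 1 / ?t R else 0) + KT (zs ! i) (zs ! j)) \<longlonglongrightarrow> 0 + KT (zs ! i) (zs ! j)"
      by (rule tendsto_add[OF _ tendsto_const], cases "i = j") (use tinf in simp_all)
    then show "(\<lambda>R. (if i = j then 1 / ?t R else 0) + KT (zs ! i) (zs ! j)) \<longlonglongrightarrow> KT (zs ! i) (zs ! j)" by simp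
  qed
  then have lim1: "(\<lambda>R. \<integral>w. ?f R w \<partial>M) \<longlonglongrightarrow> detk (length zs) (\<lambda>i j. KT (zs ! i) (zs ! j))"
    unfolding A .
  have m1: "Measurable.pred M (\<lambda>w. z \<in> pointset w)" if "z \<in> set zs" for z
    using lev[OF that] by (rule measurable_pointset)
  have "(\<lambda>R. \<integral>w. ?f R w \<partial>M) \<longlonglongrightarrow> (\<integral>w. (\<Prod>z\<in>set zs. if z \<in> pointset w then 1 else 0 :: complex) \<partial>M)"
  proof (rule integral_dominated_convergence[where w = "\<lambda>_. 2 ^ length zs"])
    show "?f R \<in> borel_measurable M" for R
      using m1 by (intro borel_measurable_prod borel_measurable_divide measurable_If) (auto simp: pred_def)
    show "(\<lambda>w. \<Prod>z\<in>set zs. if z \<in> pointset w then 1 else 0 :: complex) \<in> borel_measurable M"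
      using m1 by (intro borel_measurable_prod measurable_If) (auto simp: pred_def)
    show "AE w in M. (\<lambda>R. ?f R w) \<longlonglongrightarrow> (\<Prod>z\<in>set zs. if z \<in> pointset w then 1 else 0)"
    proof (rule AE_I2, rule tendsto_prod)
      fix w z
      have "(\<lambda>R. 1 / ?t R + 1) \<longlonglongrightarrow> 0 + 1" by (intro tendsto_intros tinf)
      then show "(\<lambda>R. (if z \<in> pointset w then 1 + ?t R else 1) / ?t R) \<longlonglongrightarrow> (if z \<in> pointset w then 1 else 0)"
        using tinf by (cases "z \<in> pointset w") (simp_all add: add_divide_distrib del: of_nat_Suc)
    qed
    show "AE w in M. norm (?f R w) \<le> 2 ^ length zs" for R
    proof (rule AE_I2)
      fix w
      have b: "norm (1 / ?t R) \<le> 1" by (simp add: norm_divide del: of_nat_Suc)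
      have "norm ((if z \<in> pointset w then 1 + ?t R else 1) / ?t R) \<le> 2" for z
        using b norm_triangle_ineq[of "1 / ?t R" 1]
        by (cases "z \<in> pointset w") (simp_all add: add_divide_distrib del: of_nat_Suc)
      then have "norm (?f R w) \<le> (\<Prod>z\<in>set zs. 2)"
        unfolding prod_norm[symmetric] by (intro prod_mono) auto
      then show "norm (?f R w) \<le> 2 ^ length zs" by (simp add: distinct_card[OF dist])
    qed
  qed simp
  then have "(\<integral>w. (\<Prod>z\<in>set zs. if z \<in> pointset w then 1 else 0 :: complex) \<partial>M) = detk (length zs) (\<lambda>i j. KT (zs ! i) (zs ! j))"
    using lim1 LIMSEQ_unique by blast
  moreover have "(\<integral>w. (\<Prod>z\<in>set zs. if z \<in> pointset w then 1 else 0 :: complex) \<partial>M)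
     = (\<integral>w. complex_of_real (indicator {w. set zs \<subseteq> pointset w} w) \<partial>M)"
    by (intro Bochner_Integration.integral_cong refl) (auto simp: indicator_def intro!: prod.neutral)
  moreover have "{w. set zs \<subseteq> pointset w} \<in> sets M"
  proof -
    have "{w \<in> space M. \<forall>z\<in>set zs. z \<in> pointset w} \<in> sets M"
      using m1 by (intro sets.sets_Collect_finite_All) (auto simp: pred_def)
    then show ?thesis by (simp add: subset_eq)
  qed
  ultimately show ?thesis by (simp add: integral_complex_of_real)
qed

end

section \<open>The contour integral\<close>

text \<open>For a simple pole at \<open>a\<close> the residues at \<open>a\<close> and
  \<open>x\<close> are opposite, and both points have winding number 1. For higher order a partial
  fraction step splits off a power of \<open>u - a\<close> that has a primitive.\<close>

lemma has_contour_integral_pole_power_simple: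
  assumes g: "valid_path g" "pathfinish g = pathstart g"
    and a: "a \<notin> path_image g" "winding_number g a = 1"
    and x: "x \<notin> path_image g" "winding_number g x = 1" and "x \<noteq> a"
  shows "((\<lambda>u. 1 / ((u - a) ^ Suc j * (x - u))) has_contour_integral 0) g"
proof (induction j)
  have wa: "((\<lambda>u. 1 / (u - a)) has_contour_integral (2 * pi * \<i>)) g"
    using has_contour_integral_winding_number[OF g(1) a(1)] a(2) by simp
  have wx: "((\<lambda>u. - (1 / (u - x))) has_contour_integral (- (2 * pi * \<i>))) g"
    using has_contour_integral_neg[OF has_contour_integral_winding_number[OF g(1) x(1)]] x(2) by simp
  case 0
  have "((\<lambda>u. (1 / (x - a)) * (1 / (u - a) + (- (1 / (u - x))))) has_contour_integral ((1 / (x - a)) * (2 * pi * \<i> + (- (2 * pi * \<i>))))) g"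
    by (intro has_contour_integral_lmul has_contour_integral_add wa wx)
  then have "((\<lambda>u. (1 / (x - a)) * (1 / (u - a) + (- (1 / (u - x))))) has_contour_integral 0) g" by simp
  then show ?case
  proof (rule has_contour_integral_eq)
    fix u assume "u \<in> path_image g"
    then have "u - a \<noteq> 0" "u - x \<noteq> 0" "x - u \<noteq> 0" "x - a \<noteq> 0" using a x \<open>x \<noteq> a\<close> by auto
    then show "(1 / (x - a)) * (1 / (u - a) + (- (1 / (u - x)))) = 1 / ((u - a) ^ Suc 0 * (x - u))"
      by (simp add: divide_simps) (simp add: algebra_simps)
  qed
next
  case (Suc j)
  have "((\<lambda>u. - (1 / of_nat (Suc j)) * (u - a) powi (- int (Suc j))) has_field_derivative 1 / (u - a) ^ Suc (Suc j)) (at u within path_image g)"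
    if "u \<in> path_image g" for u
  proof -
    have u: "u - a \<noteq> 0" using that a by auto
    have "((\<lambda>u. - (1 / of_nat (Suc j)) * (u - a) powi (- int (Suc j))) has_field_derivative
       (- (1 / of_nat (Suc j)) * (of_int (- int (Suc j)) * (u - a) powi (- int (Suc j) - 1) * 1))) (at u within path_image g)"
      by (rule derivative_eq_intros refl | use u in simp)+
    also have "- (1 / of_nat (Suc j)) * (of_int (- int (Suc j)) * (u - a) powi (- int (Suc j) - 1) * 1) = (u - a) powi (- int (Suc j) - 1)"
      by (simp add: field_simps del: of_nat_Suc)
    also have "- int (Suc j) - 1 = - int (Suc (Suc j))" by simp
    also have "(u - a) powi (- int (Suc (Suc j))) = 1 / (u - a) ^ Suc (Suc j)"
      by (simp only: power_int_minus power_int_of_nat inverse_eq_divide)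
    finally show ?thesis .
  qed
  then have p: "((\<lambda>u. 1 / (u - a) ^ Suc (Suc j)) has_contour_integral 0) g"
    by (rule Cauchy_theorem_primitive) (use g in auto)
  have "((\<lambda>u. (1 / (x - a)) * (1 / (u - a) ^ Suc (Suc j) + 1 / ((u - a) ^ Suc j * (x - u)))) has_contour_integral ((1 / (x - a)) * (0 + 0))) g"
    by (intro has_contour_integral_lmul has_contour_integral_add p Suc.IH)
  then have "((\<lambda>u. (1 / (x - a)) * (1 / (u - a) ^ Suc (Suc j) + 1 / ((u - a) ^ Suc j * (x - u)))) has_contour_integral 0) g" by simp
  then show ?case
  proof (rule has_contour_integral_eq)
    fix u assume "u \<in> path_image g"
    then have nz: "u - a \<noteq> 0" "x - u \<noteq> 0" "x - a \<noteq> 0" using a x \<open>x \<noteq> a\<close> by auto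
    define P where "P = (u - a) ^ Suc j"
    have P: "P \<noteq> 0" using nz by (simp add: P_def)
    have "(1 / (x - a)) * (1 / ((u - a) * P) + 1 / (P * (x - u))) = 1 / ((u - a) * P * (x - u))"
      using nz P by (simp add: divide_simps)
    then show "(1 / (x - a)) * (1 / (u - a) ^ Suc (Suc j) + 1 / ((u - a) ^ Suc j * (x - u))) = 1 / ((u - a) ^ Suc (Suc j) * (x - u))"
      by (simp only: P_def power_Suc)
  qed
qed

text \<open>Expand \<open>f\<close> at 1 to order \<open>q\<close>. The Taylor terms integrate to 0
  by the previous lemma; in the remainder the pole at 1 cancels and Cauchy's formula at
  \<open>x\<close> applies. The constant comes from
  \<open>(2 * (u - 1)) ^ q = (-2) ^ q * (1 - u) ^ q\<close>, its sign from
  \<open>x - u\<close>.\<close>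

lemma has_contour_integral_dq_pow:
  assumes "open Om" "f holomorphic_on Om" "1 \<in> Om" "x \<in> Om" "x \<noteq> 1"
    and g: "valid_path g" "pathfinish g = pathstart g" "path_image g \<subseteq> Om"
    and zero: "\<And>w. w \<notin> Om \<Longrightarrow> winding_number g w = 0"
    and a: "1 \<notin> path_image g" "winding_number g 1 = 1"
    and x: "x \<notin> path_image g" "winding_number g x = 1"
  shows "((\<lambda>u. f u / ((1 - u) ^ q * (x - u))) has_contour_integral (- (2 * pi * \<i>) * (- 2) ^ q * (dq ^^ q) f x)) g"
proof -
  let ?psi = "(dq ^^ q) f"
  have "((\<lambda>u. ?psi u / (u - x)) has_contour_integral (2 * pi * \<i> * winding_number g x * ?psi x)) g"
    by (rule Cauchy_integral_formula_global[OF assms(1)])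
      (use assms in \<open>auto intro: dq_pow_holomorphic\<close>)
  then have "((\<lambda>u. - ((-2) ^ q) * (?psi u / (u - x)) + (\<Sum>i<q. (dq ^^ i) f 1 * 2 ^ i * (-1) ^ q * (1 / ((u - 1) ^ Suc (q - Suc i) * (x - u)))))
     has_contour_integral (- ((-2) ^ q) * (2 * pi * \<i> * winding_number g x * ?psi x) + (\<Sum>i<q. (dq ^^ i) f 1 * 2 ^ i * (-1) ^ q * 0))) g"
    using assms by (intro has_contour_integral_add has_contour_integral_lmul has_contour_integral_sum
        has_contour_integral_pole_power_simple) auto
  then have "((\<lambda>u. - ((-2) ^ q) * (?psi u / (u - x)) + (\<Sum>i<q. (dq ^^ i) f 1 * 2 ^ i * (-1) ^ q * (1 / ((u - 1) ^ Suc (q - Suc i) * (x - u)))))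
     has_contour_integral (- (2 * pi * \<i>) * (- 2) ^ q * ?psi x)) g"
    using x by (simp add: mult_ac)
  then show ?thesis
  proof (rule has_contour_integral_eq)
    fix u assume u: "u \<in> path_image g"
    then have nz: "u - 1 \<noteq> 0" "x - u \<noteq> 0" "u - x \<noteq> 0" using a x by auto
    have m: "(1 - u) ^ q = (-1) ^ q * (u - 1) ^ q"
      by (simp only: power_mult_distrib[symmetric]) simp
    have tm: "(dq ^^ i) f 1 * 2 ^ i * (-1) ^ q * (1 / ((u - 1) ^ Suc (q - Suc i) * (x - u)))
       = (dq ^^ i) f 1 * (2 * (u - 1)) ^ i / ((1 - u) ^ q * (x - u))" if "i < q" for i
    proof -
      have "(u - 1) ^ q = (u - 1) ^ i * (u - 1) ^ Suc (q - Suc i)"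
        using that by (simp only: power_add[symmetric]) simp
      moreover have "((-1) ^ q * (-1) ^ q :: complex) = 1" by (simp add: power_mult_distrib[symmetric])
      ultimately show ?thesis unfolding m power_mult_distrib using nz by (simp add: divide_simps)
    qed
    have tp: "- ((-2) ^ q) * (?psi u / (u - x)) = (2 * (u - 1)) ^ q * ?psi u / ((1 - u) ^ q * (x - u))"
    proof -
      have "((-1) ^ q * (-1) ^ q :: complex) = 1" by (simp add: power_mult_distrib[symmetric])
      moreover have "(-2) ^ q = (-1) ^ q * (2 ^ q :: complex)" by (simp only: power_mult_distrib[symmetric]) simp
      ultimately show ?thesis unfolding m power_mult_distrib using nz by (simp add: divide_simps) (simp add: algebra_simps)
    qed
    have "- ((-2) ^ q) * (?psi u / (u - x)) + (\<Sum>i<q. (dq ^^ i) f 1 * 2 ^ i * (-1) ^ q * (1 / ((u - 1) ^ Suc (q - Suc i) * (x - u))))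
      = ((\<Sum>i<q. (dq ^^ i) f 1 * (2 * (u - 1)) ^ i) + (2 * (u - 1)) ^ q * ?psi u) / ((1 - u) ^ q * (x - u))"
      unfolding tp add_divide_distrib sum_divide_distrib
      by (subst add.commute, rule arg_cong2[where f = "(+)"]) (auto intro!: sum.cong simp only: tm lessThan_iff)
    then show "- ((-2) ^ q) * (?psi u / (u - x)) + (\<Sum>i<q. (dq ^^ i) f 1 * 2 ^ i * (-1) ^ q * (1 / ((u - 1) ^ Suc (q - Suc i) * (x - u))))
      = f u / ((1 - u) ^ q * (x - u))"
      by (simp only: dq_expansion[of f u q, symmetric])
  qed
qed

text \<open>At \<open>x = 1\<close> a real power of 0 is 0 for every exponent, so both sides vanish
  there.\<close>

lemma wt_add_power:
  assumes "x \<in> {-1..1}"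
  shows "(1 - x) powr (real q + a) * sqrt (1 + x) = (1 - x) ^ q * wt a x"
proof (cases "x = 1")
  case False
  then have "(1 - x) powr (real q + a) = (1 - x) ^ q * (1 - x) powr a"
    using assms by (simp add: powr_add powr_realpow)
  then show ?thesis by (simp add: wt_def)
qed (simp add: wt_def)

lemma (in level_system) Kern_eq_KT:
  assumes E: "\<And>x. x \<in> {-1..1::real} \<Longrightarrow> Eom al be ga (of_real x) = E (of_real x)"
    and G: "finite A" "\<And>u. u \<in> path_image g - A \<Longrightarrow> 1 / Eom al be ga u = G u"
    and g: "simple_path g" "valid_path g" "pathfinish g = pathstart g" "path_image g \<subseteq> Om"
    and zero: "\<And>w. w \<notin> Om \<Longrightarrow> winding_number g w = 0"
    and loop: "\<And>x. x \<in> {-1..1::real} \<Longrightarrow> complex_of_real x \<notin> path_image g \<and> winding_number g (of_real x) = 1"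
  shows "Kern al be ga g (s, n) (t, m) = (1 / (-2) ^ rr n) * KT (s, n) (t, m) / (1 / (-2) ^ rr m)"
proof -
  let ?c = "complex_of_real (2 powr (alph n + 1/2) / pi)"
  let ?h = "hz (t, m)"
  let ?psi = "(dq ^^ rr m) ?h"
  define Q where "Q = (\<lambda>x u. Eom al be ga (of_real x) / Eom al be ga u *
            chebJ s (alph n) (of_real x) * chebJ t (alph m) u *
            complex_of_real ((1 - x) powr (real (rr n) + alph n) * sqrt (1 + x)) /
            ((1 - u) ^ rr m * (of_real x - u)))"
  have pw: "(1 - x) ^ j = (1 / (-2) ^ j) * (2 * (x - 1)) ^ j" for x :: complex and j
  proof -
    have e: "1 - x = (1 / (-2)) * (2 * (x - 1))" by (simp add: field_simps)
    show ?thesis by (subst e) (simp only: power_mult_distrib power_one_over)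
  qed
  have inner: "contour_integral g (Q x) = - (2 * pi * \<i>) * (-2) ^ rr m * (1 / (-2) ^ rr n) *
      (chebJ s (alph n) (of_real x) * (E (of_real x) * ((2 * (of_real x - 1)) ^ rr n * ?psi (of_real x))) * of_real (wt (alph n) x))"
    if x: "x \<in> {-1..1}" for x
  \<comment> \<open>At \<open>x = 1\<close> the poles at 1 and \<open>x\<close> collide and the
    residue computation fails, but the weight factor is 0 there by the convention on powers of
    0.\<close>
  proof (cases "x = 1")
    case True
    then show ?thesis by (simp add: Q_def wt_def)
  next
    case False
    let ?w = "chebJ s (alph n) (of_real x) * E (of_real x) * of_real ((1 - x) ^ rr n * wt (alph n) x)"
    have one: "1 \<notin> path_image g" "winding_number g 1 = 1" using loop[of 1] by auto
    have h: "((\<lambda>u. ?h u / ((1 - u) ^ rr m * (of_real x - u))) has_contour_integral (- (2 * pi * \<i>) * (- 2) ^ rr m * ?psi (of_real x))) g"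
      by (rule has_contour_integral_dq_pow[OF open_Om hz_holo])
        (use one_in_Om seg x False g zero one loop[OF x] in auto)
    have "contour_integral g (Q x) = contour_integral g (\<lambda>u. ?w * (?h u / ((1 - u) ^ rr m * (of_real x - u))))"
    \<comment> \<open>A simple path meets each point of the finite set \<open>A\<close> only
      finitely often, so wrong values of \<open>1 / E\<close> there do not change the
      integral.\<close>
    proof (rule contour_integral_spike_finite_simple_path[OF G(1) g(1) refl])
      fix u assume "u \<in> path_image g - A"
      then have "?h u = chebJ t (alph m) u * (1 / Eom al be ga u)" using G(2) by (simp add: hz_def)
      then show "Q x u = ?w * (?h u / ((1 - u) ^ rr m * (of_real x - u)))"
        unfolding Q_def wt_add_power[OF x] E[OF x] by simp
    qed
    also have "\<dots> = ?w * (- (2 * pi * \<i>) * (- 2) ^ rr m * ?psi (of_real x))"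
      by (rule contour_integral_unique, rule has_contour_integral_lmul, rule h)
    also have "of_real ((1 - x) ^ rr n * wt (alph n) x) = (1 / (-2) ^ rr n) * (2 * (of_real x - 1)) ^ rr n * complex_of_real (wt (alph n) x)"
      unfolding pw[symmetric] by simp
    finally show ?thesis by (simp only: mult_ac)
  qed
  have "(LINT x:{-1..1}|lborel. contour_integral g (Q x)) = (LINT x:{-1..1}|lborel. - (2 * pi * \<i>) * (-2) ^ rr m * (1 / (-2) ^ rr n) *
      (chebJ s (alph n) (of_real x) * (E (of_real x) * ((2 * (of_real x - 1)) ^ rr n * ?psi (of_real x))) * of_real (wt (alph n) x)))"
    using inner by (intro set_lebesgue_integral_cong) auto
  also have "\<dots> = - (2 * pi * \<i>) * (-2) ^ rr m * (1 / (-2) ^ rr n) * (LINT x:{-1..1}|lborel. 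
      chebJ s (alph n) (of_real x) * (E (of_real x) * ((2 * (of_real x - 1)) ^ rr n * ?psi (of_real x))) * of_real (wt (alph n) x))"
    by (rule set_integral_mult_right)
  finally have t1: "?c * (1 / (2 * pi * \<i>)) * (LINT x:{-1..1}|lborel. contour_integral g (Q x))
     = - ((-2) ^ rr m * (1 / (-2) ^ rr n)) * cf n s (\<lambda>x. (2 * (x - 1)) ^ rr n * ?psi x)"
    unfolding cf_def Lp_def by (simp add: mult_ac)
  have t2: "?c * (LINT x:{-1..1}|lborel.
            chebJ s (alph n) (of_real x) * chebJ t (alph m) (of_real x) *
            complex_of_real ((1 - x) powr (real (rr n) - real (rr m) + alph n) * sqrt (1 + x)))
     = ((-2) ^ rr m * (1 / (-2) ^ rr n)) * cf n s (\<lambda>x. (2 * (x - 1)) ^ (rr n - rr m) * ?h x)" if nm: "m \<le> n"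
  proof -
    have rmn: "rr m \<le> rr n" using rr_mono[OF nm] .
    have "(LINT x:{-1..1}|lborel.
            chebJ s (alph n) (of_real x) * chebJ t (alph m) (of_real x) *
            complex_of_real ((1 - x) powr (real (rr n) - real (rr m) + alph n) * sqrt (1 + x)))
       = (LINT x:{-1..1}|lborel. (1 / (-2) ^ (rr n - rr m)) * (chebJ s (alph n) (of_real x) * (E (of_real x) * ((2 * (of_real x - 1)) ^ (rr n - rr m) * ?h (of_real x))) * of_real (wt (alph n) x)))"
    proof (intro set_lebesgue_integral_cong allI impI)
      fix x :: real assume x: "x \<in> {-1..1}"
      let ?x = "complex_of_real x"
      have e: "real (rr n) - real (rr m) + alph n = real (rr n - rr m) + alph n" using rmn by simp
      have "complex_of_real ((1 - x) powr (real (rr n) - real (rr m) + alph n) * sqrt (1 + x)) = (1 - ?x) ^ (rr n - rr m) * of_real (wt (alph n) x)"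
        unfolding e wt_add_power[OF x] by simp
      also have "\<dots> = (1 / (-2) ^ (rr n - rr m)) * (2 * (?x - 1)) ^ (rr n - rr m) * of_real (wt (alph n) x)"
        unfolding pw ..
      finally have *: "complex_of_real ((1 - x) powr (real (rr n) - real (rr m) + alph n) * sqrt (1 + x)) = \<dots>" .
      have "E ?x * ?h ?x = (E ?x * G ?x) * chebJ t (alph m) ?x" by (simp add: hz_def mult_ac)
      then have **: "E ?x * ?h ?x = chebJ t (alph m) ?x" using EG[OF x] by simp
      show "chebJ s (alph n) ?x * chebJ t (alph m) ?x * complex_of_real ((1 - x) powr (real (rr n) - real (rr m) + alph n) * sqrt (1 + x))
        = (1 / (-2) ^ (rr n - rr m)) * (chebJ s (alph n) ?x * (E ?x * ((2 * (?x - 1)) ^ (rr n - rr m) * ?h ?x)) * of_real (wt (alph n) x))"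
        unfolding * **[symmetric] by (simp only: mult_ac)
    qed auto
    also have "\<dots> = (1 / (-2) ^ (rr n - rr m)) * (LINT x:{-1..1}|lborel. chebJ s (alph n) (of_real x) * (E (of_real x) * ((2 * (of_real x - 1)) ^ (rr n - rr m) * ?h (of_real x))) * of_real (wt (alph n) x))"
      by (rule set_integral_mult_right)
    finally have "?c * (LINT x:{-1..1}|lborel.
            chebJ s (alph n) (of_real x) * chebJ t (alph m) (of_real x) *
            complex_of_real ((1 - x) powr (real (rr n) - real (rr m) + alph n) * sqrt (1 + x)))
       = (1 / (-2) ^ (rr n - rr m)) * cf n s (\<lambda>x. (2 * (x - 1)) ^ (rr n - rr m) * ?h x)"
      unfolding cf_def Lp_def by (simp only: mult_ac)
    moreover have "(1 / (-2) ^ (rr n - rr m)) = ((-2) ^ rr m * (1 / (-2) ^ rr n) :: complex)"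
      using rmn by (simp add: power_diff)
    ultimately show ?thesis by simp
  qed
  have "Kern al be ga g (s, n) (t, m) = ?c * (1 / (2 * pi * \<i>)) * (LINT x:{-1..1}|lborel. contour_integral g (Q x))
     + (if m \<le> n then ?c * (LINT x:{-1..1}|lborel.
            chebJ s (alph n) (of_real x) * chebJ t (alph m) (of_real x) *
            complex_of_real ((1 - x) powr (real (rr n) - real (rr m) + alph n) * sqrt (1 + x))) else 0)"
    unfolding Kern_def Q_def prod.case ..
  also have "\<dots> = ((-2) ^ rr m * (1 / (-2) ^ rr n)) * KT (s, n) (t, m)"
    unfolding t1 KT_def prod.case using t2 by (simp add: right_diff_distrib del: right_diff_distrib_numeral)
  finally show ?thesis by simp
qed

section \<open>The functions \<open>E\<close> as quotients of entire functions\<close>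

definition linprod :: "(nat \<Rightarrow> real) \<Rightarrow> complex \<Rightarrow> complex" where
  "linprod c x = (\<Prod>i. 1 + of_real (c i) * (x - 1))"

context
  fixes c :: "nat \<Rightarrow> real" assumes c: "summable (\<lambda>i. \<bar>c i\<bar>)"
begin

lemma linprod_convergent: "convergent_prod (\<lambda>i. 1 + of_real (c i) * (x - 1) :: complex)"
proof -
  have "summable (\<lambda>i. norm ((1 + of_real (c i) * (x - 1) :: complex) - 1))"
    using summable_mult2[OF c, of "norm (x - 1)"] by (simp add: norm_mult)
  then show ?thesis
    by (intro abs_convergent_prod_imp_convergent_prod summable_imp_abs_convergent_prod)
qed

lemma linprod_has_prod: "(\<lambda>i. 1 + of_real (c i) * (x - 1)) has_prod linprod c x"
  unfolding linprod_def by (rule convergent_prod_has_prod[OF linprod_convergent])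

lemma linprod_eq_0_iff: "linprod c x = 0 \<longleftrightarrow> (\<exists>i. 1 + of_real (c i) * (x - 1) = 0)"
  using has_prod_eq_0_iff[OF linprod_has_prod[of x]] by (auto simp: image_iff)

lemma linprod_LIMSEQ: "(\<lambda>n. \<Prod>i<n. 1 + of_real (c i) * (x - 1)) \<longlonglongrightarrow> linprod c x"
proof -
  have "(\<lambda>n. \<Prod>i\<le>n. 1 + of_real (c i) * (x - 1)) \<longlonglongrightarrow> linprod c x"
    unfolding linprod_def by (rule convergent_prod_LIMSEQ[OF linprod_convergent])
  then have "(\<lambda>n. \<Prod>i<Suc n. 1 + of_real (c i) * (x - 1)) \<longlonglongrightarrow> linprod c x"
    by (simp only: lessThan_Suc_atMost)
  then show ?thesis by (rule LIMSEQ_imp_Suc)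
qed

lemma linprod_holomorphic: "linprod c holomorphic_on A"
proof (rule holomorphic_on_subset)
  show "linprod c holomorphic_on UNIV"
  proof (rule holomorphic_uniform_sequence[where f = "\<lambda>n x. \<Prod>i<n. 1 + of_real (c i) * (x - 1)"])
    fix z :: complex
    have "uniformly_convergent_on (cball z 1) (\<lambda>N x. \<Sum>n<N. norm (complex_of_real (c n) * (x - 1)))"
    proof (rule Weierstrass_m_test'[where M = "\<lambda>n. \<bar>c n\<bar> * (norm (z - 1) + 1)"])
      fix n and x :: complex assume "x \<in> cball z 1"
      then have "norm (x - 1) \<le> norm (z - 1) + 1"
        using norm_triangle_ineq[of "x - z" "z - 1"] by (simp add: dist_norm norm_minus_commute)
      then show "norm (norm (complex_of_real (c n) * (x - 1))) \<le> \<bar>c n\<bar> * (norm (z - 1) + 1)"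
        by (simp add: norm_mult mult_left_mono)
    qed (use summable_mult2[OF c] in simp)
    then have "uniformly_convergent_on (cball z 1) (\<lambda>n x. \<Prod>i<n. 1 + of_real (c i) * (x - 1))"
      by (intro uniformly_convergent_on_prod) (auto intro!: continuous_intros)
    then obtain h where h: "uniform_limit (cball z 1) (\<lambda>n x. \<Prod>i<n. 1 + of_real (c i) * (x - 1)) h sequentially"
      by (auto simp: uniformly_convergent_on_def)
    have hx: "h x = linprod c x" if "x \<in> cball z 1" for x
      using tendsto_uniform_limitI[OF h that] linprod_LIMSEQ LIMSEQ_unique by blast
    have "uniform_limit (cball z 1) (\<lambda>n x. \<Prod>i<n. 1 + of_real (c i) * (x - 1)) (linprod c) sequentially"
      by (rule uniform_limit_cong'[THEN iffD1, OF _ _ h]) (auto simp: hx)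
    then show "\<exists>d>0. cball z d \<subseteq> UNIV \<and> uniform_limit (cball z d) (\<lambda>n x. \<Prod>i<n. 1 + of_real (c i) * (x - 1)) (linprod c) sequentially"
      by (intro exI[of _ 1]) auto
  qed (auto intro!: holomorphic_intros)
qed auto

lemma linprod_split:
  assumes "finite S"
  shows "linprod c x = (\<Prod>i\<in>S. 1 + of_real (c i) * (x - 1)) * linprod (\<lambda>i. if i \<in> S then 0 else c i) x"
proof -
  have s: "summable (\<lambda>i. \<bar>if i \<in> S then 0 else c i\<bar>)"
    by (rule summable_comparison_test'[OF c, of 0]) auto
  have 1: "(\<lambda>i. if i \<in> S then 1 + of_real (c i) * (x - 1) else 1) has_prod (\<Prod>i\<in>S. 1 + of_real (c i) * (x - 1))"
    using has_prod_If_finite_set[OF assms, of "\<lambda>i. 1 + of_real (c i) * (x - 1)"] by simp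
  have 2: "(\<lambda>i. 1 + of_real (if i \<in> S then 0 else c i) * (x - 1)) has_prod linprod (\<lambda>i. if i \<in> S then 0 else c i) x"
    unfolding linprod_def
  proof (rule convergent_prod_has_prod)
    have "summable (\<lambda>i. norm ((1 + of_real (if i \<in> S then 0 else c i) * (x - 1) :: complex) - 1))"
      using summable_mult2[OF s, of "norm (x - 1)"] by (simp add: norm_mult)
    then show "convergent_prod (\<lambda>i. 1 + of_real (if i \<in> S then 0 else c i) * (x - 1) :: complex)"
      by (intro abs_convergent_prod_imp_convergent_prod summable_imp_abs_convergent_prod)
  qed
  have "(\<lambda>i. 1 + of_real (c i) * (x - 1)) has_prod ((\<Prod>i\<in>S. 1 + of_real (c i) * (x - 1)) * linprod (\<lambda>i. if i \<in> S then 0 else c i) x)"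
    using has_prod_mult[OF 1 2] by (rule back_subst[where P = "\<lambda>f. f has_prod _"]) auto
  then show ?thesis using linprod_has_prod has_prod_unique2 by blast
qed

end

lemma linprod_1 [simp]: "linprod c 1 = 1"
  by (simp add: linprod_def)

text \<open>Holds for either root of the quadratic; the explicit root only supplies
  existence.\<close>

lemma zOf: "zOf x \<noteq> 0" "zOf x + inverse (zOf x) = 2 * x"
proof -
  define z where "z = x + csqrt (x\<^sup>2 - 1)"
  have "z * (x - csqrt (x\<^sup>2 - 1)) = x\<^sup>2 - (csqrt (x\<^sup>2 - 1))\<^sup>2"
    by (simp add: z_def power2_eq_square algebra_simps)
  then have z: "z * (x - csqrt (x\<^sup>2 - 1)) = 1" by simp
  then have "z \<noteq> 0" by auto
  moreover have "inverse z = x - csqrt (x\<^sup>2 - 1)" using z by (rule inverse_unique)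
  ultimately have "z \<noteq> 0 \<and> (z + inverse z) / 2 = x" by (simp add: z_def)
  then have "zOf x \<noteq> 0 \<and> (zOf x + inverse (zOf x)) / 2 = x"
    unfolding zOf_def by (rule someI)
  then show "zOf x \<noteq> 0" "zOf x + inverse (zOf x) = 2 * x" by auto
qed

text \<open>A pair of factors exchanged by \<open>z\<close> and \<open>1 / z\<close> depends only on
  \<open>z + 1 / z\<close> and is in fact linear in \<open>x\<close>. So, up to an exponential,
  \<open>E\<close> is a quotient of products of linear factors in \<open>x\<close>, whichever root
  was chosen.\<close>

lemma zOf_factor: "(1 + k * (zOf x - 1)) * (1 + k * (inverse (zOf x) - 1)) = 1 + (2 * k - 2 * k\<^sup>2) * (x - 1)"
proof -
  let ?z = "zOf x"
  have "(1 + k * (?z - 1)) * (1 + k * (inverse ?z - 1)) = 1 + k * ((?z + inverse ?z) - 2) + k\<^sup>2 * (?z * inverse ?z - (?z + inverse ?z) + 1)"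
    by (simp only: power2_eq_square) (simp add: algebra_simps)
  also have "\<dots> = 1 + (2 * k - 2 * k\<^sup>2) * (x - 1)"
    unfolding zOf(2) using zOf(1)[of x] by (simp add: algebra_simps)
  finally show ?thesis .
qed

text \<open>The value of \<open>2 k - 2 k^2\<close> at \<open>k = b / 2\<close>. For
  \<open>b >= 0\<close> it is negative exactly when \<open>b > 2\<close>, and only then does the
  factor vanish to the right of 1.\<close>

definition bcoef :: "(nat \<Rightarrow> real) \<Rightarrow> nat \<Rightarrow> real" where
  "bcoef be i = be i - (be i)\<^sup>2 / 2"

text \<open>Minus the value of \<open>2 k - 2 k^2\<close> at \<open>k = - a / 2\<close>. For
  \<open>a >= 0\<close> it is nonnegative, which places the zeros of the denominator on the real
  half line beyond 1.\<close>

definition acoef :: "(nat \<Rightarrow> real) \<Rightarrow> nat \<Rightarrow> real" where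
  "acoef al i = al i + (al i)\<^sup>2 / 2"

lemma Enum_eq: "Enum be ga x = exp (of_real ga * (x - 1)) * linprod (bcoef be) x"
proof -
  have "complex_of_real (ga / 2) * (zOf x + inverse (zOf x) - 2) = of_real ga * (x - 1)"
    unfolding zOf(2) by (simp add: algebra_simps)
  moreover have "(1 + complex_of_real (be i / 2) * (zOf x - 1)) * (1 + complex_of_real (be i / 2) * (inverse (zOf x) - 1))
     = 1 + of_real (bcoef be i) * (x - 1)" for i
    unfolding zOf_factor by (simp add: bcoef_def power2_eq_square field_simps)
  ultimately show ?thesis unfolding Enum_def Let_def linprod_def by (simp only:)
qed

lemma Eden_eq: "Eden al x = linprod (\<lambda>i. - acoef al i) x"
proof -
  have "(1 - complex_of_real (al i / 2) * (zOf x - 1)) * (1 - complex_of_real (al i / 2) * (inverse (zOf x) - 1))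
     = 1 + of_real (- acoef al i) * (x - 1)" for i
    using zOf_factor[of "- complex_of_real (al i / 2)" x] by (simp add: acoef_def power2_eq_square field_simps)
  then show ?thesis unfolding Eden_def Let_def linprod_def by simp
qed

lemma summable_quadratic:
  assumes "\<And>i. 0 \<le> b i" "antimono b" "summable b"
  shows "summable (\<lambda>i. \<bar>b i + k * (b i)\<^sup>2\<bar> :: real)"
proof (rule summable_comparison_test')
  show "summable (\<lambda>i. (1 + \<bar>k\<bar> * b 0) * b i)" using assms by (intro summable_mult)
  fix i
  have "b i \<le> b 0" using assms(2) by (simp add: antimonoD)
  then have "\<bar>k\<bar> * (b i)\<^sup>2 \<le> \<bar>k\<bar> * b 0 * b i"
    using assms(1)[of i] by (simp add: power2_eq_square mult.assoc mult_left_mono mult_right_mono)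
  then show "norm (\<bar>b i + k * (b i)\<^sup>2\<bar>) \<le> (1 + \<bar>k\<bar> * b 0) * b i"
    using assms(1)[of i] abs_triangle_ineq[of "b i" "k * (b i)\<^sup>2"] by (simp add: abs_mult algebra_simps)
qed

context
  fixes al be :: "nat \<Rightarrow> real" and ga :: real
  assumes params: "omega_params al be ga"
begin

lemma acoef_nonneg: "0 \<le> acoef al i"
  using params by (simp add: acoef_def omega_params_def)

lemma acoef_summable: "summable (\<lambda>i. \<bar>acoef al i\<bar>)"
  using params summable_quadratic[of al "1/2"] by (simp add: acoef_def omega_params_def)

lemma acoef_summable': "summable (\<lambda>i. \<bar>- acoef al i\<bar>)"
  using acoef_summable by simp

lemma bcoef_summable: "summable (\<lambda>i. \<bar>bcoef be i\<bar>)"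
  using params summable_quadratic[of be "-1/2"] by (simp add: bcoef_def omega_params_def)

lemma Enum_holomorphic: "Enum be ga holomorphic_on A"
proof -
  have "(\<lambda>x. exp (of_real ga * (x - 1)) * linprod (bcoef be) x) holomorphic_on A"
    by (intro holomorphic_intros linprod_holomorphic[OF bcoef_summable])
  then show ?thesis by (simp add: Enum_eq[abs_def])
qed

lemma Eden_holomorphic: "Eden al holomorphic_on A"
  using linprod_holomorphic[OF acoef_summable'] by (simp add: Eden_eq[abs_def])

lemma Enum_1 [simp]: "Enum be ga 1 = 1" by (simp add: Enum_eq)
lemma Eden_1 [simp]: "Eden al 1 = 1" by (simp add: Eden_eq)

lemma Eden_zero_iff: "Eden al x = 0 \<longleftrightarrow> (\<exists>i. 0 < acoef al i \<and> x = 1 + 1 / of_real (acoef al i))"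
proof -
  have "1 + complex_of_real (- acoef al i) * (x - 1) = 0 \<longleftrightarrow> 0 < acoef al i \<and> x = 1 + 1 / of_real (acoef al i)" for i
    using acoef_nonneg[of i] by (cases "acoef al i = 0") (auto simp: field_simps)
  then show ?thesis unfolding Eden_eq linprod_eq_0_iff[OF acoef_summable'] by auto
qed

lemma Eden_segment: "x \<in> {-1..1} \<Longrightarrow> Eden al (of_real x) \<noteq> 0"
proof
  assume x: "x \<in> {-1..1}" "Eden al (of_real x) = 0"
  then obtain i where i: "0 < acoef al i" "complex_of_real x = 1 + 1 / of_real (acoef al i)"
    by (auto simp: Eden_zero_iff)
  then have "x = 1 + 1 / acoef al i"
    by (metis of_real_1 of_real_add of_real_divide of_real_eq_iff)
  then show False using x i by simp
qed

end

section \<open>Total positivity and zeros of \<open>E\<close>\<close>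

lemma nonneg_Reals_tail:
  fixes A :: "nat \<Rightarrow> complex"
  assumes "\<And>t. A t - A (Suc t) \<in> \<real>\<^sub>\<ge>\<^sub>0" "A \<longlonglongrightarrow> 0"
  shows "A t \<in> \<real>\<^sub>\<ge>\<^sub>0"
proof -
  have "A t - A (t + k) \<in> \<real>\<^sub>\<ge>\<^sub>0" for k
  proof (induction k)
    case (Suc k)
    have "A t - A (t + Suc k) = (A t - A (t + k)) + (A (t + k) - A (Suc (t + k)))" by simp
    then show ?case using Suc assms(1) by (metis nonneg_Reals_add_I)
  qed simp
  moreover have "(\<lambda>k. A t - A (t + k)) \<longlonglongrightarrow> A t - 0"
    using LIMSEQ_ignore_initial_segment[OF assms(2), of t] by (intro tendsto_intros) (simp add: add.commute)
  ultimately show ?thesis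
    using closed_sequentially[OF closed_nonneg_Reals_complex, of "\<lambda>k. A t - A (t + k)"] by simp
qed

text \<open>Coefficients for the weight of odd levels. Two descent steps lead back to this weight,
  so odd levels suffice for the positivity argument.\<close>

definition wco :: "nat \<Rightarrow> (complex \<Rightarrow> complex) \<Rightarrow> complex" where
  "wco s f = Lp (-1/2) (\<lambda>x. chebJ s (-1/2) x * f x)"

lemma wco_linear:
  assumes "nice f" "nice h"
  shows "wco s (\<lambda>x. a * f x + b * h x) = a * wco s f + b * wco s h"
proof -
  have "wco s (\<lambda>x. a * f x + b * h x) = Lp (-1/2) (\<lambda>x. a * (chebJ s (-1/2) x * f x) + b * (chebJ s (-1/2) x * h x))"
    unfolding wco_def by (rule Lp_cong) (simp add: algebra_simps)
  also have "\<dots> = Lp (-1/2) (\<lambda>x. a * (chebJ s (-1/2) x * f x)) + Lp (-1/2) (\<lambda>x. b * (chebJ s (-1/2) x * h x))"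
    using assms by (intro Lp_add) auto
  finally show ?thesis by (simp add: wco_def Lp_cmult)
qed

lemma wco_cong: "(\<And>x. x \<in> {-1..1::real} \<Longrightarrow> f (of_real x) = h (of_real x)) \<Longrightarrow> wco s f = wco s h"
  unfolding wco_def by (rule Lp_cong) simp

text \<open>On coefficients, multiplication by \<open>x - 1\<close> is half the discrete Laplacian
  on the half line, reflected at 0.\<close>

lemma wco_shift:
  assumes "nice f"
  shows "wco 0 (\<lambda>x. (x - 1) * f x) = (wco 1 f - wco 0 f) / 2"
    "wco (Suc s) (\<lambda>x. (x - 1) * f x) = (wco (Suc (Suc s)) f + wco s f) / 2 - wco (Suc s) f"
proof -
  let ?J = "\<lambda>s x. chebJ s (-1/2) x * f x"
  have "wco 0 (\<lambda>x. (x - 1) * f x) = Lp (-1/2) (\<lambda>x. (1/2) * (?J (Suc 0) x - ?J 0 x))"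
    unfolding wco_def by (rule Lp_cong) (simp add: algebra_simps)
  also have "\<dots> = (1/2) * (Lp (-1/2) (?J (Suc 0)) - Lp (-1/2) (?J 0))"
    using assms by (subst Lp_cmult, simp, subst Lp_diff, auto)
  finally show "wco 0 (\<lambda>x. (x - 1) * f x) = (wco 1 f - wco 0 f) / 2" by (simp add: wco_def)
  have "wco (Suc s) (\<lambda>x. (x - 1) * f x) = Lp (-1/2) (\<lambda>x. (1/2) * (?J (Suc (Suc s)) x + ?J s x) - ?J (Suc s) x)"
    unfolding wco_def by (rule Lp_cong) (simp add: algebra_simps)
  also have "\<dots> = (1/2) * (Lp (-1/2) (?J (Suc (Suc s))) + Lp (-1/2) (?J s)) - Lp (-1/2) (?J (Suc s))"
    using assms by (simp only: Lp_diff Lp_cmult Lp_add nice_mult nice_chebJ nice_add nice_const insert_iff simp_thms)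
  finally show "wco (Suc s) (\<lambda>x. (x - 1) * f x) = (wco (Suc (Suc s)) f + wco s f) / 2 - wco (Suc s) f"
    by (simp add: wco_def)
qed

lemma wco_tendsto_0: "nice f \<Longrightarrow> (\<lambda>s. wco s f) \<longlonglongrightarrow> 0"
  unfolding wco_def by (rule Lp_chebJ_tendsto_0) auto

locale segment_domain =
  fixes Om :: "complex set"
  assumes open_Om: "open Om" and seg: "of_real ` {-1..1::real} \<subseteq> Om"
begin

text \<open>With \<open>E = 1\<close> the tail sums apply to the plain coefficients, and
  \<open>eps\<close> vanishes.\<close>

sublocale L: level_system "\<lambda>_. 1" "\<lambda>_. 0" "\<lambda>_. 1" Om
  by unfold_locales (use open_Om seg in auto)

text \<open>Tail sums of nonnegative coefficients are nonnegative, and they are the coefficients of \<open>dq f\<close>.\<close>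
lemma wco_dq_nonneg:
  assumes f: "f holomorphic_on Om" and nn: "\<And>s. wco s f \<in> \<real>\<^sub>\<ge>\<^sub>0"
  shows "f 1 \<in> \<real>\<^sub>\<ge>\<^sub>0" "wco s (dq f) \<in> \<real>\<^sub>\<ge>\<^sub>0"
proof -
  have al: "alph 1 = -1/2" "alph (2 - 1) = -1/2" "alph 2 = 1/2" "alph (1 - 1) = 1/2" by (simp_all add: alph_def)
  have c1: "L.cf 1 s f = wco s f" for s f unfolding L.cf_def wco_def al(1) by simp
  have c2: "L.cf 2 s f = L.cf (1 - 1) s f" for s f by (simp add: L.cf_def alph_def)
  have c3: "L.cf (2 - 1) s f = wco s f" for s f using c1 by simp
  have t1: "L.tail 1 f t \<in> \<real>\<^sub>\<ge>\<^sub>0" for t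
    by (rule nonneg_Reals_tail[where A = "L.tail 1 f"])
      (use L.cf_eq_tail_diff[OF f, of 1] c1 nn L.tail_tendsto_0[OF f, of 1] in \<open>simp_all flip: L.cf_eq_tail_diff[OF f]\<close>)
  have "L.tail 1 f 0 = f 1" by (simp add: L.tail_def)
  then show "f 1 \<in> \<real>\<^sub>\<ge>\<^sub>0" using t1[of 0] by simp
  have "L.eps t = 0" for t by (simp add: L.eps_def Lp_zero)
  then have c0: "L.cf 2 t (dq f) \<in> \<real>\<^sub>\<ge>\<^sub>0" for t
    using t1[of "Suc t"] unfolding c2 by (simp add: L.tail_def)
  have d: "dq f holomorphic_on Om" using f open_Om by (rule dq_holomorphic)
  have "L.tail 2 (dq f) s \<in> \<real>\<^sub>\<ge>\<^sub>0"
    by (rule nonneg_Reals_tail[where A = "L.tail 2 (dq f)"])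
      (use c0 L.tail_tendsto_0[OF d, of 2] in \<open>simp_all flip: L.cf_eq_tail_diff[OF d]\<close>)
  moreover have "L.tail 2 (dq f) s = wco s (dq f)" unfolding L.tail_def c3 by simp
  ultimately show "wco s (dq f) \<in> \<real>\<^sub>\<ge>\<^sub>0" by simp
qed

lemma dq_pow_nonneg:
  assumes f: "f holomorphic_on Om" and nn: "\<And>s. wco s f \<in> \<real>\<^sub>\<ge>\<^sub>0"
  shows "(dq ^^ k) f 1 \<in> \<real>\<^sub>\<ge>\<^sub>0"
proof -
  have "wco s ((dq ^^ k) f) \<in> \<real>\<^sub>\<ge>\<^sub>0" for s
  proof (induction k arbitrary: s)
    case (Suc k)
    then show ?case using wco_dq_nonneg(2)[OF dq_pow_holomorphic[OF f open_Om]] by simp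
  qed (simp add: nn)
  then show ?thesis using wco_dq_nonneg(1)[OF dq_pow_holomorphic[OF f open_Om]] by blast
qed

end

section \<open>Taylor series at 1 and values on the axis beyond 1\<close>

lemma sums_dq:
  assumes f: "f holomorphic_on ball 1 R" and R: "0 < R"
    and s: "\<And>w. w \<in> ball 1 R \<Longrightarrow> (\<lambda>k. a k * (w - 1) ^ k) sums f w"
    and w: "w \<in> ball 1 R"
  shows "(\<lambda>k. a (Suc k) / 2 * (w - 1) ^ k) sums dq f w"
proof -
  have a0: "a 0 = f 1"
  proof -
    have "(\<lambda>k. a k * (1 - 1) ^ k) sums a 0" using powser_sums_zero[of a] by simp
    from sums_unique2[OF this s[of 1]] R show ?thesis by simp
  qed
  have off: "(\<lambda>k. a (Suc k) / 2 * (w - 1) ^ k) sums dq f w" if w: "w \<in> ball 1 R" "w \<noteq> 1" for w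
  proof -
    have "(\<lambda>k. a (Suc k) * (w - 1) ^ Suc k) sums (f w - a 0)"
      using s[OF w(1)] by (subst sums_Suc_iff) simp
    then have "(\<lambda>k. a (Suc k) * (w - 1) ^ Suc k * (1 / (2 * (w - 1)))) sums ((f w - a 0) * (1 / (2 * (w - 1))))"
      by (rule sums_mult2)
    moreover have "a (Suc k) * (w - 1) ^ Suc k * (1 / (2 * (w - 1))) = a (Suc k) / 2 * (w - 1) ^ k" for k
      using w by (simp add: field_simps)
    ultimately show ?thesis using w by (simp add: dq_def a0 del: right_diff_distrib_numeral)
  qed
  show ?thesis
  proof (cases "w = 1")
    case False
    then show ?thesis using off w by blast
  next
    \<comment> \<open>At the centre the claim follows from the punctured disc by continuity of both
      sides.\<close>
    case True
    define K where "K = complex_of_real (R / 2)"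
    have "1 + K \<in> ball 1 R" "1 + K \<noteq> 1" using R by (auto simp: K_def dist_norm)
    then have "summable (\<lambda>k. a (Suc k) / 2 * K ^ k)" using off[of "1 + K"] by (auto simp: sums_iff)
    then have "isCont (\<lambda>v. \<Sum>k. a (Suc k) / 2 * v ^ k) 0"
      by (rule isCont_powser) (use R in \<open>simp add: K_def\<close>)
    then have "(\<lambda>v. \<Sum>k. a (Suc k) / 2 * v ^ k) \<midarrow>0\<rightarrow> a (Suc 0) / 2"
      unfolding isCont_def powser_zero[of "\<lambda>k. a (Suc k) / 2"] .
    then have "(\<lambda>x. \<Sum>k. a (Suc k) / 2 * (x - 1) ^ k) \<midarrow>1\<rightarrow> a (Suc 0) / 2"
      by (subst LIM_offset_zero_iff) simp_all
    moreover have "\<forall>\<^sub>F x in at 1. (\<Sum>k. a (Suc k) / 2 * (x - 1) ^ k) = dq f x"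
      unfolding eventually_at using R off by (intro exI[of _ R]) (auto simp: dist_commute sums_iff)
    ultimately have "dq f \<midarrow>1\<rightarrow> a (Suc 0) / 2" by (rule Lim_transform_eventually)
    moreover have "isCont (dq f) 1"
      using holomorphic_on_imp_continuous_on[OF dq_holomorphic[OF f open_ball]] R
      by (simp add: continuous_on_eq_continuous_at)
    ultimately have "dq f 1 = a (Suc 0) / 2" by (metis LIM_unique isCont_def)
    then show ?thesis unfolding True using powser_sums_zero[of "\<lambda>k. a (Suc k) / 2"] by (simp only: diff_self)
  qed
qed

text \<open>Each quotient drops the constant term and divides the series by
  \<open>2 * (w - 1)\<close>, so iterated quotients at 1 are rescaled Taylor coefficients.\<close>

lemma dq_taylor:
  assumes f: "f holomorphic_on ball 1 R" and w: "w \<in> ball 1 R"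
  shows "(\<lambda>k. 2 ^ k * (dq ^^ k) f 1 * (w - 1) ^ k) sums f w"
proof -
  have R: "0 < R" using w by (auto dest: order.strict_trans1[OF zero_le_dist])
  define a where "a = (\<lambda>k. (deriv ^^ k) f 1 / fact k)"
  have s: "(\<lambda>k. a k * (w - 1) ^ k) sums f w" if "w \<in> ball 1 R" for w
    unfolding a_def using holomorphic_power_series[OF f that] by simp
  have "(\<lambda>k. a (k + j) / 2 ^ j * (w - 1) ^ k) sums (dq ^^ j) f w" if "w \<in> ball 1 R" for j w
    using that
  proof (induction j arbitrary: w)
    case (Suc j)
    have "(\<lambda>k. a (Suc k + j) / 2 ^ j / 2 * (w - 1) ^ k) sums dq ((dq ^^ j) f) w"
      by (rule sums_dq[where R = R]) (use Suc f R in \<open>auto intro: dq_pow_holomorphic\<close>)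
    then show ?case by (simp add: mult.commute)
  qed (simp add: s)
  note * = this
  have "(dq ^^ j) f 1 = a j / 2 ^ j" for j
  proof -
    have "(\<lambda>k. a (k + j) / 2 ^ j * (1 - 1) ^ k) sums (a (0 + j) / 2 ^ j)"
      using powser_sums_zero[of "\<lambda>k. a (k + j) / 2 ^ j"] by simp
    from sums_unique2[OF this *[of 1]] R show ?thesis by simp
  qed
  then show ?thesis using s[OF w] by simp
qed

context segment_domain begin

text \<open>By \<open>dq_pow_nonneg\<close> all Taylor coefficients at 1 are nonnegative, so to the
  right of 1 the function is real and at least \<open>f 1\<close>. This forbids zeros there whenever
  \<open>f 1\<close> is not 0.\<close>

lemma nonneg_on_axis:
  assumes f: "f holomorphic_on Om" and nn: "\<And>s. wco s f \<in> \<real>\<^sub>\<ge>\<^sub>0"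
    and b: "ball 1 R \<subseteq> Om" and x: "1 \<le> x" "x < 1 + R"
  shows "f (of_real x) - f 1 \<in> \<real>\<^sub>\<ge>\<^sub>0" "f 1 \<in> \<real>\<^sub>\<ge>\<^sub>0"
proof -
  show f1: "f 1 \<in> \<real>\<^sub>\<ge>\<^sub>0" using wco_dq_nonneg(1)[OF f nn] .
  have xb: "complex_of_real x \<in> ball 1 R"
  proof -
    have "norm (complex_of_real x - 1) = x - 1"
      using x by (metis abs_of_nonneg diff_ge_0_iff_ge norm_of_real of_real_1 of_real_diff)
    then show ?thesis using x by (simp add: dist_norm norm_minus_commute)
  qed
  let ?t = "\<lambda>k. 2 ^ k * (dq ^^ k) f 1 * (complex_of_real x - 1) ^ k"
  have "?t sums f (of_real x)"
    by (rule dq_taylor[OF holomorphic_on_subset[OF f b] xb])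
  then have "(\<lambda>k. ?t (Suc k)) sums (f (of_real x) - f 1)"
    by (subst sums_Suc_iff) simp
  then have lim: "(\<lambda>n. \<Sum>k<n. ?t (Suc k)) \<longlonglongrightarrow> f (of_real x) - f 1" by (simp add: sums_def)
  have "?t k \<in> \<real>\<^sub>\<ge>\<^sub>0" for k
  proof -
    have "complex_of_real x - 1 \<in> \<real>\<^sub>\<ge>\<^sub>0" using x by (simp add: complex_nonneg_Reals_iff)
    then have "(complex_of_real x - 1) ^ k \<in> \<real>\<^sub>\<ge>\<^sub>0" by (rule nonneg_Reals_pow_I)
    moreover have "(2::complex) ^ k \<in> \<real>\<^sub>\<ge>\<^sub>0" by (intro nonneg_Reals_pow_I) simp
    ultimately show ?thesis using dq_pow_nonneg[OF f nn, of k] by (intro nonneg_Reals_mult_I)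
  qed
  then have "(\<Sum>k<n. ?t (Suc k)) \<in> \<real>\<^sub>\<ge>\<^sub>0" for n
    by (induction n) (simp_all only: sum.lessThan_Suc lessThan_0 sum.empty nonneg_Reals_zero_I nonneg_Reals_add_I)
  then show "f (of_real x) - f 1 \<in> \<real>\<^sub>\<ge>\<^sub>0"
    using closed_sequentially[OF closed_nonneg_Reals_complex _ lim] by blast
qed

text \<open>The finitely many coefficients of possibly wrong sign are compensated by a combination
  of Chebyshev polynomials, which is bounded on the compact interval.\<close>

lemma bounded_below_on_axis:
  assumes f: "f holomorphic_on Om" and re: "\<And>s. Im (wco s f) = 0" and nn: "\<And>s. s0 \<le> s \<Longrightarrow> 0 \<le> Re (wco s f)"
    and b: "ball 1 R \<subseteq> Om"
  shows "\<exists>B. \<forall>x. 1 \<le> x \<and> x < 1 + R \<longrightarrow> - B \<le> Re (f (of_real x))"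
proof -
  let ?P = "\<lambda>x. \<Sum>s<s0. of_real \<bar>Re (wco s f)\<bar> * chebJ s (-1/2) x"
  let ?f = "\<lambda>x. 1 * f x + 1 * ?P x"
  have nf: "nice f" using L.holo_nice[OF f] .
  have P: "wco t ?P = (if t < s0 then of_real \<bar>Re (wco t f)\<bar> else 0)" for t
  proof -
    have "wco t ?P = Lp (-1/2) (\<lambda>x. \<Sum>s<s0. of_real \<bar>Re (wco s f)\<bar> * (chebJ t (-1/2) x * chebJ s (-1/2) x))"
      unfolding wco_def[of t] by (rule Lp_cong) (simp add: sum_distrib_left mult_ac)
    also have "\<dots> = (\<Sum>s<s0. of_real \<bar>Re (wco s f)\<bar> * Lp (-1/2) (\<lambda>x. chebJ t (-1/2) x * chebJ s (-1/2) x))"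
      by (subst Lp_sum) (auto simp: Lp_cmult)
    also have "\<dots> = (\<Sum>s<s0. of_real \<bar>Re (wco s f)\<bar> * (if t = s then 1 else 0))"
      by (subst Lp_orthonormal) auto
    finally show ?thesis by (simp add: if_distrib[where f = "\<lambda>z. _ * z"] cong: if_cong)
  qed
  have hol: "?f holomorphic_on Om" by (intro holomorphic_intros holomorphic_chebJ f)
  have "wco s ?f = wco s f + wco s ?P" for s
    using wco_linear[OF nf, of ?P s 1 1] by auto
  then have nn': "wco s ?f \<in> \<real>\<^sub>\<ge>\<^sub>0" for s
    using re[of s] nn[of s] unfolding P complex_nonneg_Reals_iff by (cases "s < s0") auto
  have "compact ((\<lambda>x. Re (?P (of_real x))) ` {1..1+R})"
    by (intro compact_continuous_image continuous_intros holomorphic_on_imp_continuous_on[OF holomorphic_chebJ, THEN continuous_on_compose2]) auto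
  then obtain B where B: "\<And>x. x \<in> {1..1+R} \<Longrightarrow> Re (?P (of_real x)) \<le> B"
    using bounded_imp_bdd_above[OF compact_imp_bounded] by (meson bdd_above.E imageI)
  show ?thesis
  proof (intro exI allI impI)
    fix x assume x: "1 \<le> x \<and> x < 1 + R"
    have "?f (of_real x) - ?f 1 \<in> \<real>\<^sub>\<ge>\<^sub>0" "?f 1 \<in> \<real>\<^sub>\<ge>\<^sub>0"
      using nonneg_on_axis[OF hol nn' b] x by blast+
    from nonneg_Reals_add_I[OF this] have "?f (of_real x) \<in> \<real>\<^sub>\<ge>\<^sub>0" by (simp only: diff_add_cancel)
    then have "0 \<le> Re (?f (of_real x))" by (simp only: complex_nonneg_Reals_iff)
    moreover have "Re (?P (of_real x)) \<le> B" using x by (intro B) auto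
    ultimately show "- B \<le> Re (f (of_real x))" by simp
  qed
qed

end

section \<open>Totally positive coefficients and removal of poles\<close>

lemma detk_expand_first_col:
  "detk (Suc r) M = (\<Sum>i<Suc r. M i 0 * (-1) ^ i * detk r (\<lambda>i' j'. M (if i' < i then i' else Suc i') (Suc j')))"
proof -
  let ?A = "Matrix.mat (Suc r) (Suc r) (\<lambda>(i, j). M i j)"
  have "detk (Suc r) M = (\<Sum>i<Suc r. ?A $$ (i, 0) * cofactor ?A i 0)"
    unfolding detk_def by (rule laplace_expansion_column) auto
  also have "\<dots> = (\<Sum>i<Suc r. M i 0 * (-1) ^ i * detk r (\<lambda>i' j'. M (if i' < i then i' else Suc i') (Suc j')))"
  proof (rule sum.cong[OF refl])
    fix i assume i: "i \<in> {..<Suc r}"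
    have "mat_delete ?A i 0 = Matrix.mat r r (\<lambda>(i', j'). M (if i' < i then i' else Suc i') (Suc j'))"
      by (rule eq_matI) (auto simp: mat_delete_def)
    then show "?A $$ (i, 0) * cofactor ?A i 0 = M i 0 * (-1) ^ i * detk r (\<lambda>i' j'. M (if i' < i then i' else Suc i') (Suc j'))"
      using i by (simp add: cofactor_def detk_def)
  qed
  finally show ?thesis .
qed

lemma detk_1: "detk (Suc 0) M = M 0 0"
  by (simp add: detk_expand_first_col)

lemma detk_2: "detk 2 M = M 0 0 * M 1 1 - M 1 0 * M 0 1"
  by (simp add: numeral_2_eq_2 detk_expand_first_col)

text \<open>Up to a positive factor these minors are the cylinder weights at the odd levels
  \<open>2 * r - 1\<close>. Orders 1 and 2 give nonnegative coefficients and monotone ratios; all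
  higher orders are kept because removing a pole lowers the order by one.\<close>

definition TPf :: "(complex \<Rightarrow> complex) \<Rightarrow> bool" where
  "TPf F \<longleftrightarrow> (\<forall>r l. (\<forall>i j. i < j \<longrightarrow> j < r \<longrightarrow> l j < l i) \<longrightarrow>
     detk r (\<lambda>i j. wco (l j) (\<lambda>x. (x - 1) ^ (r - 1 - i) * F x)) \<in> \<real>\<^sub>\<ge>\<^sub>0)"

lemma TPfD: "TPf F \<Longrightarrow> (\<And>i j. i < j \<Longrightarrow> j < r \<Longrightarrow> l j < l i) \<Longrightarrow>
    detk r (\<lambda>i j. wco (l j) (\<lambda>x. (x - 1) ^ (r - 1 - i) * F x)) \<in> \<real>\<^sub>\<ge>\<^sub>0"
  unfolding TPf_def by blast

lemma TPf_cong:
  assumes "TPf F" "\<And>x. x \<in> {-1..1::real} \<Longrightarrow> F (of_real x) = H (of_real x)"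
  shows "TPf H"
proof -
  have "wco s (\<lambda>x. (x - 1) ^ k * H x) = wco s (\<lambda>x. (x - 1) ^ k * F x)" for s k
    by (rule wco_cong) (simp add: assms(2))
  then show ?thesis using assms(1) by (simp add: TPf_def)
qed

text \<open>The inequality bounds \<open>d\<close> at \<open>s\<close> by its value at
  \<open>s + 1\<close>, so it is iterated towards infinity, where boundedness of \<open>d\<close>
  kills the last term.\<close>

lemma backward_contraction_tendsto:
  fixes d e :: "nat \<Rightarrow> real"
  assumes th: "0 \<le> th" "th < 1" and d: "\<And>s. 0 \<le> d s" "\<And>s. d s \<le> 1"
    and e: "\<And>s. 0 \<le> e s" "decseq e" "e \<longlonglongrightarrow> 0"
    and step: "\<And>s. d s \<le> th * (e (Suc s) + d (Suc s))"
  shows "d \<longlonglongrightarrow> 0"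
proof -
  \<comment> \<open>Solution of \<open>K = th * (1 + K)\<close>, so that the bound in terms of
    \<open>e\<close> reproduces itself.\<close>
  define K where "K = th / (1 - th)"
  have K: "0 \<le> K" "th * (1 + K) = K" using th by (auto simp: K_def field_simps)
  have b: "d s \<le> K * e (Suc s) + th ^ n" for s n
  proof (induction n arbitrary: s)
    case 0
    then show ?case using d(2)[of s] K(1) e(1)[of "Suc s"] by (simp add: add_increasing)
  next
    case (Suc n)
    have "d s \<le> th * (e (Suc s) + d (Suc s))" by (rule step)
    also have "\<dots> \<le> th * (e (Suc s) + (K * e (Suc (Suc s)) + th ^ n))"
      using Suc[of "Suc s"] th by (intro mult_left_mono) auto
    also have "\<dots> \<le> th * (e (Suc s) + (K * e (Suc s) + th ^ n))"
      using e(2) K(1) th by (intro mult_left_mono add_left_mono add_right_mono) (auto simp: decseq_Suc_iff)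
    also have "\<dots> = th * (1 + K) * e (Suc s) + th ^ Suc n" by (simp add: algebra_simps)
    finally show ?case unfolding K(2) .
  qed
  have "d s \<le> K * e (Suc s)" for s
  proof (rule LIMSEQ_le_const)
    have "(\<lambda>n. K * e (Suc s) + th ^ n) \<longlonglongrightarrow> K * e (Suc s) + 0"
      using th by (intro tendsto_intros LIMSEQ_realpow_zero) auto
    then show "(\<lambda>n. K * e (Suc s) + th ^ n) \<longlonglongrightarrow> K * e (Suc s)" by simp
  qed (use b in auto)
  moreover have "(\<lambda>s. K * e (Suc s)) \<longlonglongrightarrow> 0"
    using tendsto_mult_left[OF LIMSEQ_Suc[OF e(3)], of K] by simp
  ultimately show ?thesis
    by (intro real_tendsto_sandwich[of "\<lambda>_. 0" d sequentially "\<lambda>s. K * e (Suc s)" 0]) (use d in auto)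
qed

text \<open>Only the decaying root \<open>z\<close> of \<open>z + 1/z = 2 + 2c\<close> is compatible with \<open>p\<close> tending to zero.\<close>
lemma ratio_tendsto:
  fixes p m :: "nat \<Rightarrow> real"
  assumes p: "\<And>s. 0 < p s" "p \<longlonglongrightarrow> 0" and c: "0 < c"
    and m: "incseq m" "m \<longlonglongrightarrow> c"
    and rec: "\<And>s. m (Suc s) * p (Suc s) = (p (Suc (Suc s)) + p s) / 2 - p (Suc s)"
  shows "\<exists>z. 0 < z \<and> z + 1 / z = 2 + 2 * c \<and> (\<lambda>s. p (Suc s) / p s) \<longlonglongrightarrow> z"
proof -
  \<comment> \<open>The smaller root of \<open>z + 1 / z = 2 + 2 * c\<close>, hence in
    \<open>(0, 1)\<close>.\<close>
  define z where "z = (1 + c) - sqrt ((1 + c)\<^sup>2 - 1)"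
  have "sqrt ((1 + c)\<^sup>2 - 1) < 1 + c" using c by (intro real_less_lsqrt) auto
  then have z0: "0 < z" by (simp add: z_def)
  have "z * ((1 + c) + sqrt ((1 + c)\<^sup>2 - 1)) = (1 + c)\<^sup>2 - (sqrt ((1 + c)\<^sup>2 - 1))\<^sup>2"
    by (simp add: z_def power2_eq_square algebra_simps)
  then have zz: "z * ((1 + c) + sqrt ((1 + c)\<^sup>2 - 1)) = 1" using c by (simp add: power2_eq_square algebra_simps)
  then have iz: "1 / z = (1 + c) + sqrt ((1 + c)\<^sup>2 - 1)" using z0 by (simp add: field_simps)
  then have zsum: "z + 1 / z = 2 + 2 * c" by (simp add: z_def)
  have z1: "z < 1"
  proof -
    have "1 < 1 / z" unfolding iz using c by (simp add: add_pos_nonneg power2_eq_square algebra_simps)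
    then show ?thesis using z0 by simp
  qed
  \<comment> \<open>Dividing the recurrence by \<open>p\<close> turns it into a first-order relation
    for the ratios, which is a contraction towards \<open>z\<close> when read backward.\<close>
  define rho where "rho = (\<lambda>s. p (Suc s) / p s)"
  have r0: "0 < rho s" for s using p by (simp add: rho_def)
  have rr: "rho (Suc s) + 1 / rho s = 2 + 2 * m (Suc s)" for s
    using rec[of s] p(1)[of s] p(1)[of "Suc s"] by (simp add: rho_def field_simps)
  obtain s1 where s1: "\<And>s. s1 \<le> s \<Longrightarrow> c / 2 < m s"
    using order_tendstoD(1)[OF m(2), of "c / 2"] c by (auto simp: eventually_sequentially)
  have mc: "m s \<le> c" for s using incseq_le[OF m] .
  \<comment> \<open>Once a ratio reaches 1, the recursion keeps all later ones at least 1, and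
    \<open>p\<close> could not tend to 0.\<close>
  have lt1: "rho s < 1" if "s1 \<le> s" for s
  proof (rule ccontr)
    assume "\<not> rho s < 1"
    then have base: "1 \<le> rho s" by simp
    have g1: "1 \<le> rho (s + k)" for k
    proof (induction k)
      case (Suc k)
      then have "1 / rho (s + k) \<le> 1" by simp
      moreover have "c / 2 < m (Suc (s + k))" using that by (intro s1) simp
      ultimately show ?case using rr[of "s + k"] c by simp
    qed (use base in simp)
    have "p (s + k) \<le> p (Suc (s + k))" for k using g1[of k] p(1)[of "s + k"] by (simp add: rho_def)
    then have "p s \<le> p (s + k)" for k
      by (induction k) (simp, metis add_Suc_right order_trans)
    moreover have "(\<lambda>k. p (s + k)) \<longlonglongrightarrow> 0"
      using LIMSEQ_ignore_initial_segment[OF p(2), of s] by (simp add: add.commute)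
    ultimately have "p s \<le> 0" by (intro LIMSEQ_le_const[where X = "\<lambda>k. p (s + k)"]) auto
    then show False using p(1)[of s] by simp
  qed
  \<comment> \<open>From \<open>m > c / 2\<close> and ratios below 1 the recursion gives
    \<open>1 / rho >= 1 + c\<close>, that is \<open>rho <= th\<close>.\<close>
  define th where "th = 1 / (1 + c)"
  define d where "d = (\<lambda>s. \<bar>rho (s + s1) - z\<bar>)"
  define e where "e = (\<lambda>s. 2 * (c - m (s + s1)))"
  have "d \<longlonglongrightarrow> 0"
  proof (rule backward_contraction_tendsto)
    show "0 \<le> th" "th < 1" using c by (auto simp: th_def)
    show "0 \<le> d s" for s by (simp add: d_def)
    show "d s \<le> 1" for s using lt1[of "s + s1"] r0[of "s + s1"] z0 z1 by (simp add: d_def)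
    show "0 \<le> e s" for s using mc by (simp add: e_def)
    show "decseq e" using m(1) by (auto simp: e_def decseq_def incseq_def)
    have "(\<lambda>s. 2 * (c - m (s + s1))) \<longlonglongrightarrow> 2 * (c - c)"
      by (intro tendsto_intros LIMSEQ_ignore_initial_segment m)
    then show "e \<longlonglongrightarrow> 0" by (simp add: e_def)
    show "d s \<le> th * (e (Suc s) + d (Suc s))" for s
    proof -
      let ?s = "s + s1"
      define k where "k = 2 + 2 * m (Suc ?s)"
      have k: "1 / rho ?s = k - rho (Suc ?s)" using rr[of ?s] by (simp add: k_def)
      have iz': "1 / z = (2 + 2 * c) - z" using zsum by simp
      have k1: "1 + c \<le> 1 / rho ?s"
      proof -
        have "c / 2 < m (Suc ?s)" by (intro s1) simp
        moreover have "rho (Suc ?s) < 1" by (intro lt1) simp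
        ultimately show ?thesis unfolding k k_def by simp
      qed
      have "rho ?s - z = rho ?s * z * (1 / z - 1 / rho ?s)" using r0[of ?s] z0 by (simp add: field_simps)
      also have "1 / z - 1 / rho ?s = 2 * (c - m (Suc ?s)) + (rho (Suc ?s) - z)" unfolding iz' k k_def by simp
      finally have "d s = rho ?s * z * \<bar>2 * (c - m (Suc ?s)) + (rho (Suc ?s) - z)\<bar>"
        using r0[of ?s] z0 by (simp add: d_def abs_mult)
      also have "\<dots> \<le> rho ?s * z * (e (Suc s) + d (Suc s))"
        using r0[of ?s] z0 mc[of "Suc ?s"] abs_triangle_ineq[of "2 * (c - m (Suc ?s))" "rho (Suc ?s) - z"]
        by (intro mult_left_mono) (auto simp: d_def e_def)
      also have "\<dots> \<le> th * (e (Suc s) + d (Suc s))"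
      proof (rule mult_right_mono)
        have "rho ?s \<le> th" using k1 r0[of ?s] c by (simp add: th_def field_simps)
        moreover have "rho ?s * z \<le> rho ?s" using z1 r0[of ?s] by (intro mult_left_le) auto
        ultimately show "rho ?s * z \<le> th" by (rule order_trans[rotated])
        show "0 \<le> e (Suc s) + d (Suc s)" using mc by (simp add: e_def d_def)
      qed
      finally show ?thesis .
    qed
  qed
  then have "(\<lambda>s. rho (s + s1) - z) \<longlonglongrightarrow> 0" unfolding d_def by (simp add: tendsto_rabs_zero_iff)
  then have "(\<lambda>s. rho (s + s1)) \<longlonglongrightarrow> z" by (simp add: LIM_zero_iff)
  then have "rho \<longlonglongrightarrow> z" by (rule LIMSEQ_offset)
  then show ?thesis using z0 zsum unfolding rho_def by blast
qed

context segment_domain begin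

text \<open>The first pole \<open>1 + c\<close> is read off the coefficients \<open>p\<close> as the limit of the increasing ratios
  \<open>q / p\<close>; sending the largest index to infinity turns a minor of order \<open>r + 1\<close> for \<open>F\<close> into a minor
  of order \<open>r\<close> for \<open>(c - (x - 1)) F\<close>.\<close>
lemma TPf_remove_pole:
  assumes F: "F holomorphic_on Om" and b: "ball 1 c \<subseteq> Om" and c: "0 < c" and F1: "F 1 \<noteq> 0"
    and blow: "filterlim (\<lambda>x::real. norm (F (of_real x))) at_top (at_left (1 + c))"
    and TP: "TPf F"
  shows "TPf (\<lambda>x. (of_real c - (x - 1)) * F x)"
proof -
  have nF: "nice F" using L.holo_nice[OF F] .
  define p where "p = (\<lambda>s. Re (wco s F))"
  define q where "q = (\<lambda>s. Re (wco s (\<lambda>x. (x - 1) * F x)))"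
  have pn: "wco s F \<in> \<real>\<^sub>\<ge>\<^sub>0" for s
    using TPfD[OF TP, of "Suc 0" "\<lambda>_. s"] by (simp add: detk_1)
  have p0: "0 \<le> p s" for s using pn[of s] by (simp add: p_def complex_nonneg_Reals_iff)
  have pc: "wco s F = of_real (p s)" for s
    using pn[of s] by (simp add: p_def complex_nonneg_Reals_iff complex_eq_iff)
  have qc: "wco s (\<lambda>x. (x - 1) * F x) = of_real (q s)" for s
    unfolding q_def by (cases s) (simp_all add: wco_shift[OF nF] pc complex_eq_iff)
  have q0: "q 0 = (p 1 - p 0) / 2" and qS: "q (Suc s) = (p (Suc (Suc s)) + p s) / 2 - p (Suc s)" for s
    unfolding q_def wco_shift[OF nF] pc by simp_all
  \<comment> \<open>The minor of order 2. It will say that \<open>q / p\<close> is nondecreasing,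
    but is stated without division because positivity of \<open>p\<close> comes later.\<close>
  have TP2: "q t * p s \<le> q s * p t" if "t < s" for s t
  proof -
    have "detk 2 (\<lambda>i j. wco (if j = 0 then s else t) (\<lambda>x. (x - 1) ^ (2 - 1 - i) * F x)) \<in> \<real>\<^sub>\<ge>\<^sub>0"
      using TPfD[OF TP, of 2 "\<lambda>j. if j = 0 then s else t"] that by auto
    then have "of_real (q s) * of_real (p t) - of_real (p s) * of_real (q t) \<in> (\<real>\<^sub>\<ge>\<^sub>0 :: complex set)"
      by (simp add: detk_2 pc qc)
    then show ?thesis by (simp add: complex_nonneg_Reals_iff mult.commute)
  qed
  have lin: "wco s (\<lambda>x. (a * (x - 1) + d) * F x) = of_real (a * q s + d * p s)" for a d :: real and s
  proof -
    have "wco s (\<lambda>x. (a * (x - 1) + d) * F x) = wco s (\<lambda>x. a * ((x - 1) * F x) + d * F x)"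
      by (rule wco_cong) (simp add: algebra_simps)
    also have "\<dots> = a * of_real (q s) + d * of_real (p s)"
      using nF by (subst wco_linear) (auto simp: pc qc)
    finally show ?thesis by simp
  qed
  have lin_holo: "(\<lambda>x. (complex_of_real a * (x - 1) + of_real d) * F x) holomorphic_on Om" for a d :: real
    by (intro holomorphic_intros F)
  have axis: "F (of_real x) \<in> \<real>\<^sub>\<ge>\<^sub>0" "Re (F 1) \<le> Re (F (of_real x))" "0 < Re (F 1)" if "1 \<le> x" "x < 1 + c" for x
  proof -
    note n = nonneg_on_axis[OF F pn b that]
    show "F (of_real x) \<in> \<real>\<^sub>\<ge>\<^sub>0" using nonneg_Reals_add_I[OF n] by simp
    show "Re (F 1) \<le> Re (F (of_real x))" using n(1) by (simp add: complex_nonneg_Reals_iff)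
    show "0 < Re (F 1)" using n(2) F1 by (auto simp: complex_nonneg_Reals_iff complex_eq_iff less_le)
  qed
  have big: "\<exists>x. 1 \<le> x \<and> x < 1 + c \<and> B < Re (F (of_real x))" for B
  proof -
    have "\<forall>\<^sub>F x in at_left (1 + c). B < norm (F (of_real x))"
      using blow by (simp add: filterlim_at_top_dense)
    moreover have "\<forall>\<^sub>F x in at_left (1 + c). x \<in> {1<..<1+c}"
      using c by (intro eventually_at_left_real) simp
    ultimately have "\<forall>\<^sub>F x in at_left (1 + c). B < norm (F (of_real x)) \<and> x \<in> {1<..<1+c}"
      by eventually_elim simp
    then obtain x where x: "B < norm (F (of_real x))" "x \<in> {1<..<1+c}"
      using eventually_happens[of _ "at_left (1 + c)"] by (auto simp: trivial_limit_at_left_real)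
    moreover have "norm (F (of_real x)) = Re (F (of_real x))"
      using axis(1)[of x] x(2) by (auto simp: complex_nonneg_Reals_iff cmod_def)
    ultimately show ?thesis by (intro exI[of _ x]) auto
  qed
  \<comment> \<open>If \<open>a * q + d * p\<close> is eventually nonnegative, then
    \<open>(a * (x - 1) + d) * F\<close> is bounded below on the axis; but \<open>F\<close> is
    unbounded there while the linear factor stays below \<open>- k\<close>.\<close>
  have not_upper: False
    if "\<And>s. s0 \<le> s \<Longrightarrow> 0 \<le> a * q s + d * p s" and neg: "\<And>x. 1 \<le> x \<Longrightarrow> x < 1 + c \<Longrightarrow> a * (x - 1) + d \<le> - k" and "0 < k"
    for s0 a d k
  proof -
    have "\<exists>B. \<forall>x. 1 \<le> x \<and> x < 1 + c \<longrightarrow> - B \<le> Re ((of_real a * (of_real x - 1) + of_real d) * F (of_real x))"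
      by (rule bounded_below_on_axis[OF lin_holo _ _ b]) (use that in \<open>auto simp: lin\<close>)
    then obtain B where B: "\<And>x. 1 \<le> x \<Longrightarrow> x < 1 + c \<Longrightarrow> - B \<le> Re ((of_real a * (of_real x - 1) + of_real d) * F (of_real x))"
      by blast
    obtain x where x: "1 \<le> x" "x < 1 + c" "B / k < Re (F (of_real x))" using big by blast
    have "Re ((of_real a * (of_real x - 1) + of_real d) * F (of_real x)) = (a * (x - 1) + d) * Re (F (of_real x))"
      by simp
    also have "\<dots> \<le> - k * Re (F (of_real x))"
      using neg[OF x(1,2)] axis(2,3)[OF x(1,2)] by (intro mult_right_mono) auto
    also have "\<dots> < - B" using x(3) \<open>0 < k\<close> by (simp add: field_simps)
    finally show False using B[OF x(1,2)] by simp
  qed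
  have inf: "\<exists>s>s0. 0 < p s" for s0
  proof (rule ccontr)
    assume "\<not> (\<exists>s>s0. 0 < p s)"
    then have "p s = 0" if "s > s0" for s using that p0[of s] by (auto simp: less_le)
    then show False by (intro not_upper[of "Suc s0" 0 "-1" 1]) auto
  qed
  \<comment> \<open>A zero of \<open>p\<close> would propagate upward through \<open>TP2\<close> and
    the recurrence, contradicting \<open>inf\<close>.\<close>
  have ppos: "0 < p s" for s
  proof (rule ccontr)
    assume "\<not> 0 < p s"
    then have z: "p s = 0" using p0[of s] by simp
    have "p (s + k) = 0" for k
    proof (induction k)
      case (Suc k)
      obtain t where t: "t > s + k" "0 < p t" using inf by blast
      have "q (s + k) * p t \<le> 0" using TP2[OF t(1)] Suc by simp
      then have "q (s + k) \<le> 0" using t(2) by (simp add: mult_le_0_iff)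
      then have "p (Suc (s + k)) \<le> 0"
        using Suc q0 qS[of "s + k - 1"] p0[of "s + k - 1"] by (cases "s + k") auto
      then show ?case using p0[of "Suc (s + k)"] by simp
    qed (simp add: z)
    moreover obtain t where "t > s" "0 < p t" using inf by blast
    ultimately show False by (metis less_imp_add_positive less_irrefl)
  qed
  define m where "m = (\<lambda>s. q s / p s)"
  have minc: "incseq m"
    unfolding m_def
  proof (rule incseq_SucI)
    fix s
    show "q s / p s \<le> q (Suc s) / p (Suc s)"
      using TP2[of s "Suc s"] ppos[of s] ppos[of "Suc s"] by (simp add: divide_simps mult.commute)
  qed
  have mle: "m s \<le> c" for s
  proof (rule ccontr)
    assume gt: "\<not> m s \<le> c"
    show False
    proof (rule not_upper[of s 1 "- m s" "m s - c"])
      fix t assume "s \<le> t"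
      then have "m s * p t \<le> m t * p t" using incseqD[OF minc] ppos[of t] by (intro mult_right_mono) (auto simp: less_imp_le)
      also have "\<dots> = q t" using ppos[of t] by (simp add: m_def)
      finally show "0 \<le> 1 * q t + - m s * p t" by simp
    qed (use gt in auto)
  qed
  obtain l where l: "m \<longlonglongrightarrow> l" "\<And>s. m s \<le> l"
    using incseq_convergent[OF minc, of c] mle by blast
  \<comment> \<open>If the limit were smaller, all coefficients of \<open>(l - (x - 1)) * F\<close>
    would be nonnegative, hence also its values on the axis, although the linear factor is negative
    just before the pole.\<close>
  have "l = c"
  proof (rule ccontr)
    assume "l \<noteq> c"
    then have lc: "l < c" using LIMSEQ_le_const2[OF l(1)] mle by force
    define x where "x = 1 + (max l 0 + c) / 2"
    have x: "1 \<le> x" "x < 1 + c" "l < x - 1" using lc c by (auto simp: x_def)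
    have nn: "wco s (\<lambda>x. (of_real (-1) * (x - 1) + of_real l) * F x) \<in> \<real>\<^sub>\<ge>\<^sub>0" for s
    proof -
      have "q s \<le> l * p s" using l(2)[of s] ppos[of s] by (simp add: m_def divide_simps)
      then show ?thesis unfolding lin by (simp add: complex_nonneg_Reals_iff)
    qed
    have "(of_real (-1) * (of_real x - 1) + of_real l) * F (of_real x) \<in> \<real>\<^sub>\<ge>\<^sub>0"
      using nonneg_Reals_add_I[OF nonneg_on_axis[OF lin_holo nn b x(1,2)]] by (simp only: diff_add_cancel)
    then have "0 \<le> (1 - x + l) * Re (F (of_real x))" by (simp add: complex_nonneg_Reals_iff)
    then show False using x(3) axis(2,3)[OF x(1,2)] by (simp add: zero_le_mult_iff)
  qed
  then have mlim: "m \<longlonglongrightarrow> c" using l by simp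
  have plim: "p \<longlonglongrightarrow> 0"
    using tendsto_Re[OF wco_tendsto_0[OF nF]] by (simp add: p_def)
  have rec: "m (Suc s) * p (Suc s) = (p (Suc (Suc s)) + p s) / 2 - p (Suc s)" for s
    using ppos[of "Suc s"] qS[of s] by (simp add: m_def)
  obtain z where z: "0 < z" "z + 1 / z = 2 + 2 * c" "(\<lambda>s. p (Suc s) / p s) \<longlonglongrightarrow> z"
    using ratio_tendsto[OF ppos plim c minc mlim rec] by blast
  \<comment> \<open>By \<open>wco_shift\<close> each factor \<open>x - 1\<close> multiplies the
    leading behaviour by \<open>(z + 1 / z) / 2 - 1\<close>, which is \<open>c\<close>.\<close>
  have ratio: "(\<lambda>s. wco s (\<lambda>x. (x - 1) ^ i * F x) / of_real (p s)) \<longlonglongrightarrow> of_real c ^ i" for i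
  proof (induction i)
    case 0
    have "wco s F / of_real (p s) = 1" for s using ppos[of s] by (simp add: pc)
    then show ?case by simp
  next
    case (Suc i)
    let ?a = "\<lambda>s. wco s (\<lambda>x. (x - 1) ^ i * F x)"
    have ni: "nice (\<lambda>x. (x - 1) ^ i * F x)" using nF by auto
    have r1: "(\<lambda>s. complex_of_real (p (Suc s) / p s)) \<longlonglongrightarrow> of_real z" using z(3) by (rule tendsto_of_real)
    have r2: "(\<lambda>s. complex_of_real (inverse (p (Suc s) / p s))) \<longlonglongrightarrow> of_real (inverse z)"
      using z by (intro tendsto_of_real tendsto_inverse) auto
    have "(\<lambda>s. (?a (Suc (Suc s)) / of_real (p (Suc (Suc s))) * of_real (p (Suc (Suc s)) / p (Suc s))
         + ?a s / of_real (p s) * of_real (inverse (p (Suc s) / p s))) / 2 - ?a (Suc s) / of_real (p (Suc s)))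
       \<longlonglongrightarrow> (of_real c ^ i * of_real z + of_real c ^ i * of_real (inverse z)) / 2 - of_real c ^ i"
      by (intro tendsto_intros r2 Suc LIMSEQ_Suc[OF r1] LIMSEQ_Suc[OF Suc] LIMSEQ_Suc[OF LIMSEQ_Suc[OF Suc]]) auto
    moreover have "(?a (Suc (Suc s)) / of_real (p (Suc (Suc s))) * of_real (p (Suc (Suc s)) / p (Suc s))
         + ?a s / of_real (p s) * of_real (inverse (p (Suc s) / p s))) / 2 - ?a (Suc s) / of_real (p (Suc s))
       = wco (Suc s) (\<lambda>x. (x - 1) ^ Suc i * F x) / of_real (p (Suc s))" for s
    proof -
      have "wco (Suc s) (\<lambda>x. (x - 1) ^ Suc i * F x) = (?a (Suc (Suc s)) + ?a s) / 2 - ?a (Suc s)"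
        using wco_shift(2)[OF ni, of s] by (simp add: mult.assoc)
      moreover have "(a2 / of_real p2 * of_real (p2 / p1) + a0 / of_real p0 * of_real (inverse (p1 / p0))) / 2 - a1 / of_real p1
         = ((a2 + a0) / 2 - a1) / complex_of_real p1" if "0 < p0" "0 < p1" "0 < p2" for a0 a1 a2 :: complex and p0 p1 p2
        using that by (simp add: field_simps)
      ultimately show ?thesis using ppos[of s] ppos[of "Suc s"] ppos[of "Suc (Suc s)"] by (simp only:)
    qed
    moreover have "(of_real c ^ i * of_real z + of_real c ^ i * of_real (inverse z)) / 2 - of_real c ^ i = complex_of_real c ^ Suc i"
    proof -
      have "complex_of_real z + of_real (inverse z) = of_real (2 + 2 * c)"
        unfolding z(2)[symmetric] by (simp add: inverse_eq_divide)
      then have "(of_real c ^ i * of_real z + of_real c ^ i * of_real (inverse z)) = complex_of_real c ^ i * of_real (2 + 2 * c)"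
        by (simp only: distrib_left[symmetric])
      then show ?thesis by (simp add: algebra_simps)
    qed
    ultimately have "(\<lambda>s. wco (Suc s) (\<lambda>x. (x - 1) ^ Suc i * F x) / of_real (p (Suc s))) \<longlonglongrightarrow> of_real c ^ Suc i"
      by simp
    then show ?case by (rule LIMSEQ_imp_Suc)
  qed
  show ?thesis
    unfolding TPf_def
  proof (intro allI impI)
    fix r and l :: "nat \<Rightarrow> nat" assume l: "\<forall>i j. i < j \<longrightarrow> j < r \<longrightarrow> l j < l i"
    let ?w = "\<lambda>s i. wco s (\<lambda>x. (x - 1) ^ i * F x)"
    \<comment> \<open>The first column belongs to the largest index \<open>S\<close>; scaled by
      \<open>1 / p S\<close> it converges to the powers of \<open>c\<close> in
      \<open>?D\<close>.\<close>
    let ?M = "\<lambda>S i j. if j = 0 then ?w S (r - i) / of_real (p S) else ?w (l (j - 1)) (r - i)"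
    let ?D = "\<lambda>i j. if j = 0 then of_real c ^ (r - i) else ?w (l (j - 1)) (r - i)"
    have lim_D: "(\<lambda>S. detk (Suc r) (?M S)) \<longlonglongrightarrow> detk (Suc r) ?D"
      by (intro tendsto_detk) (auto intro!: ratio)
    have ev_D: "\<forall>\<^sub>F S in sequentially. detk (Suc r) (?M S) \<in> \<real>\<^sub>\<ge>\<^sub>0"
      using eventually_gt_at_top[of "l 0"]
    proof eventually_elim
      case (elim S)
      let ?l = "\<lambda>j. if j = 0 then S else l (j - 1)"
      have l0: "l j \<le> l 0" if "j < r" for j using l that by (cases "j = 0") (auto simp: less_imp_le)
      have "detk (Suc r) (\<lambda>i j. ?w (?l j) (Suc r - 1 - i)) \<in> \<real>\<^sub>\<ge>\<^sub>0"
      proof (rule TPfD[OF TP])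
        fix i j assume ij: "i < j" "j < Suc r"
        then obtain j' where j': "j = Suc j'" by (cases j) auto
        then show "?l j < ?l i"
          using l elim l0[of j'] ij by (cases i) auto
      qed
      moreover have "complex_of_real (1 / p S) \<in> \<real>\<^sub>\<ge>\<^sub>0" using ppos[of S] by (simp add: complex_nonneg_Reals_iff)
      ultimately have "of_real (1 / p S) * detk (Suc r) (\<lambda>i j. ?w (?l j) (Suc r - 1 - i)) \<in> \<real>\<^sub>\<ge>\<^sub>0"
        by (intro nonneg_Reals_mult_I)
      moreover have "detk (Suc r) (\<lambda>i j. (if j = 0 then of_real (1 / p S) else 1) * ?w (?l j) (Suc r - 1 - i))
         = of_real (1 / p S) * detk (Suc r) (\<lambda>i j. ?w (?l j) (Suc r - 1 - i))"
        by (subst detk_scale_cols) (simp add: prod.lessThan_Suc_shift del: prod.lessThan_Suc)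
      moreover have "detk (Suc r) (?M S) = detk (Suc r) (\<lambda>i j. (if j = 0 then of_real (1 / p S) else 1) * ?w (?l j) (Suc r - 1 - i))"
        by (rule detk_cong) auto
      ultimately show ?case by simp
    qed
    have nn: "detk (Suc r) ?D \<in> \<real>\<^sub>\<ge>\<^sub>0"
      by (rule Lim_in_closed_set[OF closed_nonneg_Reals_complex ev_D sequentially_bot lim_D])
    \<comment> \<open>Subtracting \<open>c\<close> times the next row clears the first column except
      in the last row, and leaves minus the coefficients of \<open>(c - (x - 1)) * F\<close>
      elsewhere. The signs \<open>(-1) ^ r\<close> from the expansion and from the rows
      cancel.\<close>
    define V :: "nat \<Rightarrow> nat \<Rightarrow> complex" where "V = (\<lambda>i l. if i = l then 1 else if l = Suc i then - of_real c else 0)"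
    let ?H = "\<lambda>x. (of_real c - (x - 1)) * F x"
    let ?R = "\<lambda>i j. if i = r then ?D i j else if j = 0 then 0 else - wco (l (j - 1)) (\<lambda>x. (x - 1) ^ (r - 1 - i) * ?H x)"
    have "detk (Suc r) V = 1"
      by (rule detk_graded_unitriangular[where h = "\<lambda>i. r - i"]) (auto simp: V_def)
    then have "detk (Suc r) ?D = detk (Suc r) (\<lambda>i j. \<Sum>l<Suc r. V i l * ?D l j)"
      by (simp only: detk_mult mult_1_left)
    also have "\<dots> = detk (Suc r) ?R"
    proof (rule detk_cong)
      fix i j assume ij: "i < Suc r" "j < Suc r"
      have "(\<Sum>l<Suc r. V i l * ?D l j) = (\<Sum>l<Suc r. (if l = i then ?D l j else 0) + (if l = Suc i then - of_real c * ?D l j else 0))"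
        by (intro sum.cong) (auto simp: V_def)
      also have "\<dots> = ?D i j + (if Suc i < Suc r then - of_real c * ?D (Suc i) j else 0)"
        unfolding sum.distrib using ij by (simp only: sum.delta finite_lessThan lessThan_iff if_True)
      also have "\<dots> = ?R i j"
      proof (cases "i = r")
        case False
        then have ir: "i < r" and e: "r - i = Suc (r - Suc i)" using ij by auto
        show ?thesis
        proof (cases "j = 0")
          case True
          then show ?thesis using ir e by simp
        next
          case j: False
          let ?k = "r - Suc i"
          have "wco s (\<lambda>x. (x - 1) ^ ?k * ?H x) = of_real c * ?w s ?k + (-1) * ?w s (Suc ?k)" for s
          proof -
            have "wco s (\<lambda>x. (x - 1) ^ ?k * ?H x) = wco s (\<lambda>x. of_real c * ((x - 1) ^ ?k * F x) + (-1) * ((x - 1) ^ Suc ?k * F x))"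
              by (rule wco_cong) (simp add: algebra_simps)
            also have "\<dots> = of_real c * ?w s ?k + (-1) * ?w s (Suc ?k)"
              using nF by (intro wco_linear) auto
            finally show ?thesis .
          qed
          then show ?thesis using ir e j by simp
        qed
      qed simp
      finally show "(\<Sum>l<Suc r. V i l * ?D l j) = ?R i j" .
    qed
    also have "\<dots> = (\<Sum>i<Suc r. ?R i 0 * (-1) ^ i * detk r (\<lambda>i' j'. ?R (if i' < i then i' else Suc i') (Suc j')))"
      by (rule detk_expand_first_col)
    also have "\<dots> = (-1) ^ r * detk r (\<lambda>i' j'. ?R (if i' < r then i' else Suc i') (Suc j'))"
      unfolding sum.lessThan_Suc by simp
    also have "detk r (\<lambda>i' j'. ?R (if i' < r then i' else Suc i') (Suc j')) = detk r (\<lambda>i j. (-1) * wco (l j) (\<lambda>x. (x - 1) ^ (r - 1 - i) * ?H x))"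
      by (rule detk_cong) auto
    also have "\<dots> = (-1) ^ r * detk r (\<lambda>i j. wco (l j) (\<lambda>x. (x - 1) ^ (r - 1 - i) * ?H x))"
      by (subst detk_scale_rows) simp
    finally have "detk (Suc r) ?D = detk r (\<lambda>i j. wco (l j) (\<lambda>x. (x - 1) ^ (r - 1 - i) * ?H x))"
      by (simp add: power_mult_distrib[symmetric] flip: mult.assoc)
    then show "detk r (\<lambda>i j. wco (l j) (\<lambda>x. (x - 1) ^ (r - 1 - i) * ?H x)) \<in> \<real>\<^sub>\<ge>\<^sub>0"
      using nn by simp
  qed
qed

end

lemma prod_list_nonzero_ball:
  assumes "\<And>c. c \<in> set ys \<Longrightarrow> of_real c - (x - 1) \<noteq> (0::complex)"
  shows "(\<Prod>c\<leftarrow>ys. of_real c - (x - 1)) \<noteq> 0"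
  using assms by (induction ys) auto

lemma holomorphic_prod_list_linear: "(\<lambda>x. \<Prod>c\<leftarrow>ys. complex_of_real c - (x - 1)) holomorphic_on A"
  by (induction ys) (auto intro!: holomorphic_intros)

text \<open>Induction over the poles before the zero \<open>1 + y0\<close>, nearest first. Where
  \<open>N\<close> vanishes, the pole is only apparent and one factor is cancelled; otherwise it is
  genuine and is removed with positivity preserved. With no pole left, the zero contradicts
  \<open>nonneg_on_axis\<close>.\<close>

lemma (in segment_domain) no_hidden_zero:
  assumes "N holomorphic_on Om" and b: "ball 1 R \<subseteq> Om" and y0: "0 < y0" "y0 < R"
    and "N (1 + of_real y0) = 0" "N 1 \<noteq> 0" "sorted ys" "\<forall>c\<in>set ys. 0 < c \<and> c < y0"
    and "TPf (\<lambda>x. N x / (\<Prod>c\<leftarrow>ys. of_real c - (x - 1)))"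
  shows False
  using assms(1,5-)
proof (induction ys arbitrary: N)
  case Nil
  then have TP: "TPf N" by simp
  have nn: "wco s N \<in> \<real>\<^sub>\<ge>\<^sub>0" for s using TPfD[OF TP, of "Suc 0" "\<lambda>_. s"] by (simp add: detk_1)
  have "N (of_real (1 + y0)) - N 1 \<in> \<real>\<^sub>\<ge>\<^sub>0" "N 1 \<in> \<real>\<^sub>\<ge>\<^sub>0"
    using nonneg_on_axis[OF Nil(1) nn b, of "1 + y0"] y0 by auto
  then show False using Nil(2,3) by (auto simp: complex_nonneg_Reals_iff complex_eq_iff)
next
  case (Cons c ys)
  let ?P = "\<lambda>x. \<Prod>c\<leftarrow>ys. complex_of_real c - (x - 1)"
  let ?x1 = "1 + complex_of_real c"
  have c: "0 < c" "c < y0" and cmin: "\<And>c'. c' \<in> set (c # ys) \<Longrightarrow> c \<le> c'" using Cons.prems by auto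
  have segnz: "of_real c' - (complex_of_real x - 1) \<noteq> 0" if "c' \<in> set (c # ys)" "x \<in> {-1..1}" for c' x
  proof -
    have "0 < c' - (x - 1)" using that cmin[of c'] c by auto
    then have "complex_of_real (c' - (x - 1)) \<noteq> 0" by (simp only: of_real_eq_0_iff)
    then show ?thesis by simp
  qed
  show False
  proof (cases "N ?x1 = 0")
    case True
    \<comment> \<open>The minus sign is there because \<open>c - (x - 1)\<close> equals
      \<open>- (x - ?x1)\<close>.\<close>
    define N1 where "N1 = (\<lambda>x. - (if x = ?x1 then deriv N ?x1 else (N x - N ?x1) / (x - ?x1)))"
    have N1: "N1 x = N x / (of_real c - (x - 1))" if "x \<noteq> ?x1" for x
    proof -
      have "of_real c - (x - 1) = - (x - ?x1)" by simp
      then show ?thesis using that True unfolding N1_def by (simp only: if_False diff_0_right minus_divide_right)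
    qed
    show False
    proof (rule Cons.IH[of N1])
      show "N1 holomorphic_on Om" unfolding N1_def
        by (intro holomorphic_intros pole_lemma_open Cons.prems open_Om)
      have "1 + complex_of_real y0 \<noteq> ?x1" using c by simp
      then show "N1 (1 + of_real y0) = 0" by (subst N1) (use Cons.prems in auto)
      have "1 \<noteq> ?x1" using c by simp
      then show "N1 1 \<noteq> 0" by (subst N1) (use Cons.prems c in auto)
      show "TPf (\<lambda>x. N1 x / ?P x)"
      proof (rule TPf_cong[OF Cons.prems(6)])
        fix x :: real assume x: "x \<in> {-1..1}"
        have "complex_of_real x \<noteq> ?x1" using segnz[of c x] x by auto
        then show "N (of_real x) / (\<Prod>c\<leftarrow>c # ys. of_real c - (of_real x - 1)) = N1 (of_real x) / ?P (of_real x)"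
          by (simp add: N1)
      qed
    qed (use Cons.prems in auto)
  next
    case False
    let ?Q = "\<lambda>x. (of_real c - (x - 1)) * ?P x"
    let ?F = "\<lambda>x. N x / ?Q x"
    have Qh: "?Q holomorphic_on A" for A by (intro holomorphic_intros holomorphic_prod_list_linear)
    \<comment> \<open>The remaining poles are taken out of the domain; since \<open>c\<close> is the
      smallest, the ball of radius \<open>c\<close> about 1 is untouched.\<close>
    define Om' where "Om' = {x \<in> Om. ?Q x \<noteq> 0}"
    have Qnz: "?Q x \<noteq> 0" if "\<And>c'. c' \<in> set (c # ys) \<Longrightarrow> of_real c' - (x - 1) \<noteq> 0" for x
      using that prod_list_nonzero_ball[of ys x] by auto
    have pre: "open (Om \<inter> ?Q -` (- {0}))"
      using open_Om by (intro continuous_open_preimage holomorphic_on_imp_continuous_on Qh) auto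
    have "Om' = Om \<inter> ?Q -` (- {0})"
      unfolding Om'_def by blast
    then have oOm: "open Om'" using pre by (simp only:)
    interpret S: segment_domain Om'
    proof
      show "of_real ` {-1..1::real} \<subseteq> Om'"
      proof
        fix z assume z: "z \<in> complex_of_real ` {-1..1}"
        then obtain x where "z = of_real x" "x \<in> {-1..1}" by blast
        then show "z \<in> Om'" using seg Qnz[of z] segnz z by (auto simp: Om'_def)
      qed
    qed (rule oOm)
    have Fh: "?F holomorphic_on Om'"
      by (intro holomorphic_on_divide Qh holomorphic_on_subset[OF Cons.prems(1)]) (auto simp: Om'_def)
    have bc: "ball 1 c \<subseteq> Om'"
    proof
      fix x :: complex assume x: "x \<in> ball 1 c"
      have "of_real c' - (x - 1) \<noteq> 0" if "c' \<in> set (c # ys)" for c'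
      proof
        assume "of_real c' - (x - 1) = 0"
        then have "norm (x - 1) = norm (complex_of_real c')" by simp
        then show False using x cmin[OF that] c by (simp add: dist_norm norm_minus_commute)
      qed
      moreover have "x \<in> Om" using x b c y0 by (auto intro!: subsetD[OF b])
      ultimately show "x \<in> Om'" using Qnz[of x] by (auto simp: Om'_def)
    qed
    have x1: "?x1 \<in> Om" using c y0 by (intro subsetD[OF b]) (auto simp: dist_norm)
    have "TPf (\<lambda>x. (of_real c - (x - 1)) * ?F x)"
    proof (rule S.TPf_remove_pole[OF Fh bc c(1)])
      have "?Q 1 \<noteq> 0" using segnz[of _ 1] by (intro Qnz) auto
      then show "?F 1 \<noteq> 0" using Cons.prems(3) by simp
      show "TPf ?F" using Cons.prems(6) by simp
      have lim: "((\<lambda>x::real. complex_of_real x) \<longlongrightarrow> ?x1) (at_left (1 + c))"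
        by (intro tendsto_eq_intros) auto
      have cN: "isCont N ?x1" using Cons.prems(1) open_Om x1
        by (meson continuous_on_eq_continuous_at holomorphic_on_imp_continuous_on)
      have cQ: "isCont ?Q ?x1"
        using holomorphic_on_imp_continuous_on[OF Qh[of UNIV]] continuous_on_eq_continuous_at[OF open_UNIV] by blast
      have "((\<lambda>x. norm (?Q (of_real x))) \<longlongrightarrow> norm (?Q ?x1)) (at_left (1 + c))"
        by (intro tendsto_norm isCont_tendsto_compose[OF cQ lim])
      moreover have "?Q ?x1 = 0" by simp
      ultimately have "((\<lambda>x. norm (?Q (of_real x))) \<longlongrightarrow> 0) (at_left (1 + c))" by (simp only: norm_zero)
      moreover have "\<forall>\<^sub>F x in at_left (1 + c). 0 < norm (?Q (of_real x))"
      proof -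
        have "\<forall>\<^sub>F x in at_left (1 + c). x \<in> {1<..<1+c}"
          using c by (intro eventually_at_left_real) simp
        then show ?thesis
        proof eventually_elim
          case (elim x)
          have "norm (complex_of_real x - 1) = x - 1"
            using elim by (metis abs_of_nonneg diff_ge_0_iff_ge greaterThanLessThan_iff less_imp_le norm_of_real of_real_1 of_real_diff)
          then have "complex_of_real x \<in> ball 1 c" using elim by (simp add: dist_norm norm_minus_commute)
          then have "complex_of_real x \<in> Om'" using bc by blast
          then show ?case by (simp only: Om'_def mem_Collect_eq zero_less_norm_iff simp_thms)
        qed
      qed
      ultimately have "filterlim (\<lambda>x. inverse (norm (?Q (of_real x)))) at_top (at_left (1 + c))"
        by (rule filterlim_inverse_at_top)
      moreover have "((\<lambda>x. norm (N (of_real x))) \<longlongrightarrow> norm (N ?x1)) (at_left (1 + c))"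
        by (intro tendsto_norm isCont_tendsto_compose[OF cN lim])
      ultimately have "filterlim (\<lambda>x. norm (N (of_real x)) * inverse (norm (?Q (of_real x)))) at_top (at_left (1 + c))"
        using False by (intro filterlim_tendsto_pos_mult_at_top) auto
      then show "filterlim (\<lambda>x::real. norm (?F (of_real x))) at_top (at_left (1 + c))"
        unfolding divide_inverse[of "N _"] by (simp only: norm_mult[of "N _"] norm_inverse)
    qed
    then have "TPf (\<lambda>x. N x / ?P x)"
      by (rule TPf_cong) (use segnz[of c] in auto)
    then show False by (intro Cons.IH[of N]) (use Cons.prems in auto)
  qed
qed

text \<open>The weight of an admissible path depends only on its last partition, so every minor is
  reached once each partition ends some path. Keeping its first \<open>rr m\<close> rows at level
  \<open>m\<close> gives such a path.\<close>

lemma TPf_if_cylinder_nonneg: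
  assumes "\<And>n u. 1 \<le> n \<Longrightarrow> path_weight al be ga n u \<in> \<real>\<^sub>\<ge>\<^sub>0"
  shows "TPf (Eom al be ga)"
  unfolding TPf_def
proof (intro allI impI)
  fix r and l :: "nat \<Rightarrow> nat" assume l: "\<forall>i j. i < j \<longrightarrow> j < r \<longrightarrow> l j < l i"
  show "detk r (\<lambda>i j. wco (l j) (\<lambda>x. (x - 1) ^ (r - 1 - i) * Eom al be ga x)) \<in> \<real>\<^sub>\<ge>\<^sub>0"
  proof (cases "r = 0")
    case False
    \<comment> \<open>The lowest level with \<open>r\<close> rows; it is odd, as the weight in
      \<open>wco\<close> requires.\<close>
    define n where "n = 2 * r - 1"
    have n: "1 \<le> n" "rr n = r" "alph n = -1/2" using False by (auto simp: n_def rr_def alph_def)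
    define v where "v = map (\<lambda>j. l j - (r - 1 - j)) [0..<r]"
    have low: "r - 1 - j \<le> l j" if "j < r" for j
      using that
    proof (induction "r - 1 - j" arbitrary: j)
      case (Suc k)
      then have "k = r - 1 - Suc j" "Suc j < r" by auto
      then have "r - 1 - Suc j \<le> l (Suc j)" by (intro Suc.hyps(1))
      moreover have "l (Suc j) < l j" using l \<open>Suc j < r\<close> by blast
      ultimately show ?case using \<open>Suc j < r\<close> by linarith
    qed simp
    have srt: "sorted_wrt (\<ge>) v"
      unfolding sorted_wrt_iff_nth_Suc_transp[OF transp_on_ge]
    proof (intro allI impI)
      fix j assume "Suc j < length v"
      then have j: "Suc j < r" by (simp add: v_def)
      then have "l (Suc j) < l j" using l by blast
      then show "v ! j \<ge> v ! Suc j" using j low[of j] low[of "Suc j"] by (simp add: v_def)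
    qed
    have lv: "length v = r" by (simp add: v_def)
    have vJ: "v \<in> JJ n" using srt lv n by (simp add: JJ_def)
    have tl: "tld n v (Suc j) = l j" if "j < r" for j
      using tld_nth[OF vJ, of j] that low[OF that] n by (simp add: v_def)
    define u where "u = (\<lambda>m. take (rr m) v)"
    have rm: "rr m \<le> r" if "m \<le> n" for m using rr_mono[OF that] n by simp
    have vd: "v ! j \<le> v ! i" if "i \<le> j" "j < r" for i j
      using srt that lv sorted_wrt_nth_less[of "(\<ge>)" v i j] by (cases "i = j") auto
    have ok: "okpath n u"
      unfolding okpath_def
    proof (intro conjI ballI)
      fix m assume "m \<in> {1..n}"
      then show "u m \<in> JJ m" using rm[of m] lv srt by (auto simp: u_def JJ_def sorted_wrt_take)
    next
      fix m assume m: "m \<in> {1..<n}"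
      have r1: "rr m \<le> rr (m + 1)" "rr (m + 1) \<le> r" using m rm[of "m + 1"] by (auto intro: rr_mono)
      show "interlace m (u m) (u (m + 1))"
        unfolding interlace_def
      proof
        fix j assume j: "j \<in> {1..rr m}"
        then show "part (u (m + 1)) j \<ge> part (u m) j \<and> part (u m) j \<ge> part (u (m + 1)) (j + 1)"
          using r1 lv vd[of "j - 1" j] by (auto simp: part_def u_def)
      qed
    qed
    have un: "u n = v" using n lv by (simp add: u_def)
    have "path_weight al be ga n u = 2 ^ (r choose 2) * detk r (\<lambda>i j. wco (l j) (\<lambda>x. (x - 1) ^ (r - 1 - i) * Eom al be ga x))"
    proof -
      have "detk r (\<lambda>i j. ip (alph n) (chebJ (tld n (u n) (j + 1)) (alph n)) (\<lambda>x. (x - 1) ^ (rr n - (i + 1)) * Eom al be ga x))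
        = detk r (\<lambda>i j. wco (l j) (\<lambda>x. (x - 1) ^ (r - 1 - i) * Eom al be ga x))"
        by (rule detk_cong) (simp only: n un Suc_eq_plus1[symmetric] tl ip_eq_Lp wco_def diff_Suc_eq_diff_pred)
      moreover have "(\<forall>m\<in>{1..n}. u m \<in> JJ m) \<and> (\<forall>m\<in>{1..<n}. interlace m (u m) (u (m + 1)))"
        using ok unfolding okpath_def .
      ultimately show ?thesis unfolding path_weight_def by (simp only: if_P n(2))
    qed
    then have "2 ^ (r choose 2) * detk r (\<lambda>i j. wco (l j) (\<lambda>x. (x - 1) ^ (r - 1 - i) * Eom al be ga x)) \<in> \<real>\<^sub>\<ge>\<^sub>0"
      using assms[OF n(1), of u] by simp
    moreover have "inverse (2 ^ (r choose 2) :: complex) \<in> \<real>\<^sub>\<ge>\<^sub>0"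
      by (intro nonneg_Reals_inverse_I nonneg_Reals_pow_I) simp
    ultimately have "inverse (2 ^ (r choose 2)) * (2 ^ (r choose 2) * detk r (\<lambda>i j. wco (l j) (\<lambda>x. (x - 1) ^ (r - 1 - i) * Eom al be ga x))) \<in> \<real>\<^sub>\<ge>\<^sub>0"
      by (rule nonneg_Reals_mult_I[rotated])
    then show ?thesis by (simp flip: mult.assoc)
  qed (simp add: nonneg_Reals_one_I)
qed

section \<open>The determinantal formula\<close>

lemma acoef_finite_ge:
  assumes "omega_params al be ga" "0 < a"
  shows "finite {i. a \<le> acoef al i}"
proof -
  have "acoef al \<longlonglongrightarrow> 0"
    using summable_LIMSEQ_zero[OF acoef_summable[OF assms(1)]] by (simp add: tendsto_rabs_zero_iff)
  then have "\<forall>\<^sub>F i in sequentially. acoef al i < a" using assms(2) by (rule order_tendstoD)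
  then obtain n where "\<And>i. n \<le> i \<Longrightarrow> acoef al i < a" by (auto simp: eventually_sequentially)
  then have "{i. a \<le> acoef al i} \<subseteq> {..<n}" by (metis (mono_tags, lifting) lessThan_iff mem_Collect_eq not_le subsetI)
  then show ?thesis by (rule finite_subset) simp
qed

lemma bcoef_finite_eq:
  assumes "omega_params al be ga" "0 < a"
  shows "finite {i. bcoef be i = - a}"
proof -
  have "bcoef be \<longlonglongrightarrow> 0"
    using summable_LIMSEQ_zero[OF bcoef_summable[OF assms(1)]] by (simp add: tendsto_rabs_zero_iff)
  then have "\<forall>\<^sub>F i in sequentially. - a < bcoef be i" using assms(2) by (intro order_tendstoD) auto
  then obtain n where n: "\<And>i. n \<le> i \<Longrightarrow> - a < bcoef be i" by (auto simp: eventually_sequentially)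
  have "{i. bcoef be i = - a} \<subseteq> {..<n}"
  proof
    fix i assume "i \<in> {i. bcoef be i = - a}"
    then show "i \<in> {..<n}" using n[of i] by (cases "n \<le> i") auto
  qed
  then show ?thesis by (rule finite_subset) simp
qed

text \<open>At a common zero of numerator and denominator the plain quotient is 0 by the convention
  for division; where the singularity is removable, filling it restores the true inverse of
  \<open>E\<close>.\<close>

definition Ginv :: "(nat \<Rightarrow> real) \<Rightarrow> (nat \<Rightarrow> real) \<Rightarrow> real \<Rightarrow> complex \<Rightarrow> complex" where
  "Ginv al be ga = remove_sings (\<lambda>u. Eden al u / Enum be ga u)"

lemma Ginv_at_nonzero:
  assumes "omega_params al be ga" "Enum be ga z \<noteq> 0"
  shows "Ginv al be ga analytic_on {z}" "Ginv al be ga z = Eden al z / Enum be ga z"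
proof -
  have "(\<lambda>u. Eden al u / Enum be ga u) analytic_on {z}"
    using assms(2) Eden_holomorphic[OF assms(1), of UNIV] Enum_holomorphic[OF assms(1), of UNIV]
    by (intro analytic_intros) (auto simp: analytic_on_open analytic_on_subset[of _ UNIV])
  then show "Ginv al be ga analytic_on {z}" "Ginv al be ga z = Eden al z / Enum be ga z"
    unfolding Ginv_def by (auto intro: remove_sings_analytic_on)
qed

text \<open>If the numerator vanished to higher order than the denominator at a common zero, then \<open>E\<close> would have
  a zero \<open>1 + y0\<close> with \<open>y0 > 0\<close>, which total positivity of its coefficients forbids.\<close>
lemma Ginv_at_common_zero:
  assumes params: "omega_params al be ga" and TP: "TPf (Eom al be ga)"
    and w: "Eden al w = 0"
  shows "Ginv al be ga analytic_on {w}"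
proof -
  obtain i0 where i0: "0 < acoef al i0" "w = 1 + 1 / of_real (acoef al i0)"
    using w Eden_zero_iff[OF params] by blast
  define a where "a = acoef al i0"
  have a: "0 < a" and wa: "w = 1 + 1 / of_real a" using i0 by (auto simp: a_def)
  note as = acoef_summable'[OF params] and bs = bcoef_summable[OF params]
  \<comment> \<open>Multiplicities at \<open>w\<close>: \<open>S\<close> for the denominator,
    \<open>S'\<close> for the numerator. \<open>S2\<close> collects the denominator zeros between 1
    and \<open>w\<close>, which must be dealt with before positivity can reach
    \<open>w\<close>.\<close>
  define S where "S = {i. acoef al i = a}"
  define S2 where "S2 = {i. a < acoef al i}"
  define S' where "S' = {i. bcoef be i = - a}"
  have fin: "finite S" "finite S2" "finite S'"
    using acoef_finite_ge[OF params a] bcoef_finite_eq[OF params a]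
    by (auto simp: S_def S2_def S'_def elim: finite_subset[rotated])
  let ?l = "\<lambda>x. 1 - of_real a * (x - 1)"
  have lz: "?l x = 0 \<longleftrightarrow> x = w" for x using a by (auto simp: wa field_simps)
  define b' where "b' = (\<lambda>i. if i \<in> S' then 0 else bcoef be i)"
  define N' where "N' = (\<lambda>x. exp (of_real ga * (x - 1)) * linprod b' x)"
  have b's: "summable (\<lambda>i. \<bar>b' i\<bar>)" by (rule summable_comparison_test'[OF bs, of 0]) (auto simp: b'_def)
  have N'h: "N' holomorphic_on A" for A
    unfolding N'_def by (intro holomorphic_intros linprod_holomorphic[OF b's])
  have Enum_fac: "Enum be ga x = ?l x ^ card S' * N' x" for x
  proof -
    have "(\<Prod>i\<in>S'. 1 + of_real (bcoef be i) * (x - 1)) = (\<Prod>i\<in>S'. ?l x)"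
      by (rule prod.cong) (auto simp: S'_def)
    then show ?thesis
      unfolding Enum_eq linprod_split[OF bs fin(3)] N'_def b'_def by simp
  qed
  have N'w: "N' w \<noteq> 0"
  proof -
    have "linprod b' w \<noteq> 0"
      unfolding linprod_eq_0_iff[OF b's] wa
    proof
      assume "\<exists>i. 1 + of_real (b' i) * (1 + 1 / complex_of_real a - 1) = 0"
      then obtain i where "1 + complex_of_real (b' i) * (1 / of_real a) = 0" by auto
      then have "complex_of_real (1 + b' i / a) = 0" by simp
      then have "1 + b' i / a = 0" by (simp only: of_real_eq_0_iff)
      then have "b' i = - a" using a by (simp add: field_simps)
      then show False using a by (auto simp: b'_def S'_def split: if_splits)
    qed
    then show ?thesis by (simp add: N'_def)
  qed
  define a' where "a' = (\<lambda>i. if i \<in> S2 \<union> S then 0 else - acoef al i)"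
  have a's: "summable (\<lambda>i. \<bar>a' i\<bar>)" by (rule summable_comparison_test'[OF as, of 0]) (auto simp: a'_def)
  let ?P2 = "\<lambda>x. \<Prod>i\<in>S2. 1 - of_real (acoef al i) * (x - 1)"
  have Eden_fac: "Eden al x = ?P2 x * ?l x ^ card S * linprod a' x" for x
  proof -
    have "S2 \<inter> S = {}" by (auto simp: S2_def S_def)
    then have "(\<Prod>i\<in>S2 \<union> S. 1 + of_real (- acoef al i) * (x - 1)) = ?P2 x * (\<Prod>i\<in>S. 1 - of_real (acoef al i) * (x - 1))"
      using fin by (subst prod.union_disjoint) auto
    also have "(\<Prod>i\<in>S. 1 - of_real (acoef al i) * (x - 1)) = (\<Prod>i\<in>S. ?l x)"
      by (rule prod.cong) (auto simp: S_def)
    finally show ?thesis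
      unfolding Eden_eq linprod_split[OF as finite_UnI[OF fin(2,1)]] a'_def by simp
  qed
  have D2z: "linprod a' x = 0 \<Longrightarrow> \<exists>i. 0 < acoef al i \<and> acoef al i < a \<and> x = 1 + 1 / of_real (acoef al i)" for x
  proof -
    assume "linprod a' x = 0"
    then obtain i where i: "1 + of_real (a' i) * (x - 1) = 0" using linprod_eq_0_iff[OF a's] by blast
    then have "i \<notin> S2 \<union> S" by (auto simp: a'_def)
    then have "acoef al i < a" by (auto simp: S2_def S_def)
    moreover have "acoef al i \<noteq> 0" using i \<open>i \<notin> S2 \<union> S\<close> by (auto simp: a'_def)
    moreover have "x = 1 + 1 / of_real (acoef al i)"
      using i \<open>i \<notin> S2 \<union> S\<close> \<open>acoef al i \<noteq> 0\<close> by (auto simp: a'_def field_simps)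
    ultimately show ?thesis using acoef_nonneg[OF params, of i] by (auto simp: less_le)
  qed
  show ?thesis
  proof (cases "card S' \<le> card S")
    case True
    define h where "h = (\<lambda>x. ?P2 x * ?l x ^ (card S - card S') * linprod a' x / N' x)"
    define T where "T = {x. N' x \<noteq> 0}"
    have "open (UNIV \<inter> N' -` (- {0}))"
      by (intro continuous_open_preimage holomorphic_on_imp_continuous_on N'h) auto
    moreover have "T = UNIV \<inter> N' -` (- {0})" unfolding T_def by blast
    ultimately have oT: "open T" by (simp only:)
    have wT: "w \<in> T" using N'w by (simp add: T_def)
    have hh: "h holomorphic_on T"
      unfolding h_def by (intro holomorphic_intros linprod_holomorphic[OF a's] N'h) (auto simp: T_def)
    have Enz: "Enum be ga x \<noteq> 0" if "x \<in> T - {w}" for x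
      using that lz[of x] unfolding Enum_fac T_def by simp
    have fh: "Eden al x / Enum be ga x = h x" if "x \<in> T - {w}" for x
    proof -
      have "?l x \<noteq> 0" using that lz[of x] by simp
      moreover have "?l x ^ card S = ?l x ^ (card S - card S') * ?l x ^ card S'"
        using True by (simp flip: power_add)
      ultimately show ?thesis unfolding h_def Enum_fac Eden_fac by simp
    qed
    have ana: "h analytic_on {w}" using hh oT wT by (auto simp: analytic_at)
    have "\<forall>\<^sub>F x in at w. Eden al x / Enum be ga x = h x"
      using eventually_at_in_open[OF oT wT] by eventually_elim (rule fh)
    then have "Ginv al be ga w = remove_sings h w" unfolding Ginv_def by (rule remove_sings_cong) simp
    then have "Ginv al be ga w = h w" using ana by simp
    then have "h x = Ginv al be ga x" if "x \<in> T" for x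
      using that Enz[of x] fh[of x] Ginv_at_nonzero(2)[OF params, of x] by (cases "x = w") auto
    then have "Ginv al be ga holomorphic_on T" using hh by (rule holomorphic_transform[rotated])
    then show ?thesis using oT wT by (auto simp: analytic_at)
  next
    case False
    define y0 where "y0 = 1 / a"
    have y0: "0 < y0" using a by (simp add: y0_def)
    define ys where "ys = sort (map (\<lambda>i. 1 / acoef al i) (sorted_list_of_set S2))"
    have ys: "sorted ys" "\<forall>c\<in>set ys. 0 < c \<and> c < y0"
      using a fin by (auto simp: ys_def y0_def S2_def frac_less2)
    define K where "K = (\<Prod>i\<in>S2. complex_of_real (acoef al i))"
    have K: "K \<noteq> 0" using a fin by (auto simp: K_def S2_def)
    have P2: "?P2 x = K * (\<Prod>c\<leftarrow>ys. of_real c - (x - 1))" for x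
    proof -
      have "(\<Prod>c\<leftarrow>ys. of_real c - (x - 1)) = (\<Prod>c\<in>#mset ys. of_real c - (x - 1))"
        by (simp flip: prod_mset_prod_list)
      also have "mset ys = image_mset (\<lambda>i. 1 / acoef al i) (mset_set S2)"
        using fin mset_set_set[OF distinct_sorted_list_of_set[of S2]] by (simp add: ys_def)
      also have "(\<Prod>c\<in>#\<dots>. of_real c - (x - 1)) = (\<Prod>i\<in>S2. of_real (1 / acoef al i) - (x - 1))"
        by (simp add: image_mset.compositionality o_def prod_unfold_prod_mset)
      finally have "K * (\<Prod>c\<leftarrow>ys. of_real c - (x - 1)) = (\<Prod>i\<in>S2. of_real (acoef al i) * (of_real (1 / acoef al i) - (x - 1)))"
        by (simp add: K_def prod.distrib)
      also have "\<dots> = ?P2 x"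
        by (rule prod.cong) (use a in \<open>auto simp: S2_def field_simps\<close>)
      finally show ?thesis ..
    qed
    \<comment> \<open>Only the denominator zeros beyond \<open>w\<close> are excluded; those before
      it are kept as explicit factors for \<open>no_hidden_zero\<close>.\<close>
    define Om2 where "Om2 = {x. linprod a' x \<noteq> 0}"
    have "open (UNIV \<inter> linprod a' -` (- {0}))"
      by (intro continuous_open_preimage holomorphic_on_imp_continuous_on linprod_holomorphic[OF a's]) auto
    moreover have "Om2 = UNIV \<inter> linprod a' -` (- {0})" unfolding Om2_def by blast
    ultimately have oOm2: "open Om2" by (simp only:)
    have Eseg: "Eden al (of_real x) \<noteq> 0" if "x \<in> {-1..1}" for x
      using Eden_segment[OF params that] .
    interpret segment_domain Om2
    proof
      show "of_real ` {-1..1::real} \<subseteq> Om2" using Eseg unfolding Eden_fac Om2_def by auto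
    qed (rule oOm2)
    define N where "N = (\<lambda>x. ?l x ^ (card S' - card S) * N' x / (K * linprod a' x))"
    \<comment> \<open>A bound below \<open>a\<close> for all coefficients below \<open>a\<close>;
      inserting \<open>a / 2\<close> makes the set nonempty and the bound positive. Denominator
      zeros beyond \<open>w\<close> are thus at distance at least \<open>1 / mx > 1 / a\<close> from
      1.\<close>
    define mx where "mx = Max (insert (a / 2) (acoef al ` {i. a / 2 \<le> acoef al i \<and> acoef al i < a}))"
    have finm: "finite {i. a / 2 \<le> acoef al i \<and> acoef al i < a}"
      by (rule finite_subset[OF _ acoef_finite_ge[OF params, of "a / 2"]]) (use a in auto)
    have mx: "0 < mx" "mx < a"
    proof -
      have "a / 2 \<le> mx" unfolding mx_def using finm by (intro Max_ge) auto
      then show "0 < mx" using a by linarith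
      show "mx < a" unfolding mx_def using finm a by (subst Max_less_iff) auto
    qed
    have mxge: "acoef al i \<le> mx" if "acoef al i < a" for i
    proof (cases "a / 2 \<le> acoef al i")
      case True
      then show ?thesis unfolding mx_def using finm that by (intro Max_ge) auto
    next
      case False
      then have "acoef al i \<le> a / 2" by simp
      also have "\<dots> \<le> mx" unfolding mx_def using finm by (intro Max_ge) auto
      finally show ?thesis .
    qed
    have "False"
    proof (rule no_hidden_zero[of N "1 / mx" y0 ys])
      show "N holomorphic_on Om2"
        unfolding N_def using K by (intro holomorphic_intros linprod_holomorphic[OF a's] N'h) (auto simp: Om2_def)
      show "ball 1 (1 / mx) \<subseteq> Om2"
      proof
        fix x :: complex assume x: "x \<in> ball 1 (1 / mx)"
        show "x \<in> Om2"
          unfolding Om2_def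
        proof (rule CollectI, rule notI)
          assume "linprod a' x = 0"
          then obtain i where i: "0 < acoef al i" "acoef al i < a" "x = 1 + 1 / of_real (acoef al i)" using D2z by blast
          then have "norm (x - 1) = 1 / acoef al i" by (simp add: norm_divide)
          moreover have "1 / mx \<le> 1 / acoef al i" using mxge[OF i(2)] i(1) by (intro divide_left_mono) auto
          ultimately show False using x by (simp add: dist_norm norm_minus_commute)
        qed
      qed
      show "0 < y0" by (rule y0)
      show "y0 < 1 / mx" using mx by (simp add: y0_def frac_less2)
      have "1 + complex_of_real y0 = w" by (simp add: wa y0_def)
      then have "?l (1 + complex_of_real y0) = 0" using lz by (simp only:)
      then show "N (1 + of_real y0) = 0" using False unfolding N_def by simp
      show "N 1 \<noteq> 0" using K by (simp add: N_def N'_def)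
      show "sorted ys" "\<forall>c\<in>set ys. 0 < c \<and> c < y0" by (fact ys)+
      show "TPf (\<lambda>x. N x / (\<Prod>c\<leftarrow>ys. of_real c - (x - 1)))"
      proof (rule TPf_cong[OF TP])
        fix x :: real assume x: "x \<in> {-1..1}"
        let ?x = "complex_of_real x"
        have nz: "?P2 ?x \<noteq> 0" "?l ?x ^ card S \<noteq> 0" "linprod a' ?x \<noteq> 0"
          using Eseg[OF x] unfolding Eden_fac by auto
        have "?l ?x \<noteq> 0"
        proof
          assume "?l ?x = 0"
          then show False using Eseg[OF x] w lz by metis
        qed
        moreover have "?l ?x ^ card S' = ?l ?x ^ (card S' - card S) * ?l ?x ^ card S"
          using False by (simp flip: power_add)
        ultimately have "Eom al be ga ?x = ?l ?x ^ (card S' - card S) * N' ?x / (?P2 ?x * linprod a' ?x)"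
          unfolding Eom_def Enum_fac Eden_fac by simp
        then show "Eom al be ga ?x = N ?x / (\<Prod>c\<leftarrow>ys. of_real c - (?x - 1))"
          unfolding P2 N_def by (simp add: mult_ac)
      qed
    qed
    then show ?thesis ..
  qed
qed

lemma sum_choose_2: "(\<Sum>i<r. r - 1 - i) = r choose 2"
proof -
  have "(\<Sum>i<r. r - 1 - i) = (\<Sum>i<r. i)" using sum.nat_diff_reindex[of "\<lambda>i. i" r] by simp
  also have "\<dots> = r choose 2" by (induction r) (simp_all add: numeral_2_eq_2)
  finally show ?thesis .
qed

theorem theorem4p1:
  fixes al be :: "nat \<Rightarrow> real" and ga :: real
    and g :: "real \<Rightarrow> complex"
    and M :: "(nat \<Rightarrow> nat list) measure"
  assumes params: "omega_params al be ga"
    and loop: "good_loop al be ga g"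
    and prob: "prob_space M"
    and sets_M: "sets M = sets (PiM UNIV (\<lambda>_::nat. count_space (UNIV :: nat list set)))"
    and cyl: "\<And>n u. n \<ge> 1 \<Longrightarrow>
        complex_of_real (measure M {w \<in> space M. \<forall>m\<in>{1..n}. w m = u m}) = path_weight al be ga n u"
  shows "\<forall>k \<ge> 1. \<forall>zs :: (nat \<times> nat) list. length zs = k \<longrightarrow> distinct zs \<longrightarrow>
           (\<forall>z\<in>set zs. snd z \<ge> 1) \<longrightarrow>
           complex_of_real (measure M {w \<in> space M. set zs \<subseteq> pointset w}) =
           detk k (\<lambda>i j. Kern al be ga g (zs ! i) (zs ! j))"
proof -
  have gl: "valid_path g" "simple_path g" "pathfinish g = pathstart g"
    "\<And>x. x \<in> {-1..1::real} \<Longrightarrow> complex_of_real x \<notin> path_image g \<and> winding_number g (of_real x) = 1"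
    "\<And>w. w \<in> path_image g \<or> winding_number g w \<noteq> 0 \<Longrightarrow> w \<notin> Ezeros al be ga"
    using loop by (auto simp: good_loop_def)
  have Eseg: "Eden al (of_real x) \<noteq> 0" "Enum be ga (of_real x) \<noteq> 0" if "x \<in> {-1..1}" for x
  proof -
    show *: "Eden al (of_real x) \<noteq> 0" by (rule Eden_segment[OF params that])
    \<comment> \<open>The loop winds once around each point of the segment, so its zero condition
      applies there as well.\<close>
    show "Enum be ga (of_real x) \<noteq> 0" using gl(5)[of "of_real x"] gl(4)[OF that] * by (auto simp: Ezeros_def)
  qed
  \<comment> \<open>Nonnegativity of the weights is inherited from the measure; it cannot be read
    off \<open>omega_params\<close>.\<close>
  have "path_weight al be ga n u \<in> \<real>\<^sub>\<ge>\<^sub>0" if "1 \<le> n" for n u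
    unfolding cyl[OF that, symmetric] by (simp add: complex_nonneg_Reals_iff)
  then have TP: "TPf (Eom al be ga)" by (rule TPf_if_cylinder_nonneg)
  define E where "E = Eom al be ga"
  define G where "G = Ginv al be ga"
  define Om where "Om = {z. G analytic_on {z}}"
  have oOm: "open Om"
    unfolding open_subopen[of Om]
  proof
    fix z assume "z \<in> Om"
    then obtain T where "open T" "z \<in> T" "G holomorphic_on T" by (auto simp: Om_def analytic_at)
    then show "\<exists>T. open T \<and> z \<in> T \<and> T \<subseteq> Om" by (auto simp: Om_def analytic_at)
  qed
  \<comment> \<open>The loop condition leaves two cases: a nonzero numerator, or a common zero,
    where total positivity is needed.\<close>
  have inOm: "w \<in> Om" if "w \<in> path_image g \<or> winding_number g w \<noteq> 0" for w
  proof (cases "Enum be ga w = 0")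
    case False
    then show ?thesis using Ginv_at_nonzero(1)[OF params] by (simp add: Om_def G_def)
  next
    case True
    then have "Eden al w = 0" using gl(5)[OF that] by (simp add: Ezeros_def)
    then show ?thesis using Ginv_at_common_zero[OF params TP] by (simp add: Om_def G_def)
  qed
  define U where "U = {x. Eden al x \<noteq> 0}"
  have "open (UNIV \<inter> Eden al -` (- {0}))"
    by (intro continuous_open_preimage holomorphic_on_imp_continuous_on Eden_holomorphic[OF params]) auto
  moreover have "U = UNIV \<inter> Eden al -` (- {0})" unfolding U_def by blast
  ultimately have oU: "open U" by (simp only:)
  have EU: "E holomorphic_on U"
    unfolding E_def Eom_def[abs_def]
    by (intro holomorphic_on_divide Enum_holomorphic[OF params] Eden_holomorphic[OF params]) (simp add: U_def)
  have E1: "E 1 = 1" using params by (simp add: E_def Eom_def)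
  interpret level_system E "dq E" G Om
  proof
    show "of_real ` {-1..1::real} \<subseteq> Om" using gl(4) inOm by (metis (no_types, lifting) imageE subsetI zero_neq_one)
    show "G holomorphic_on Om"
      by (rule analytic_imp_holomorphic, subst analytic_on_analytic_at) (simp add: Om_def)
    show "E (of_real x) * G (of_real x) = 1" if "x \<in> {-1..1}" for x :: real
      using Eseg[OF that] Ginv_at_nonzero(2)[OF params Eseg(2)[OF that]] by (simp add: E_def G_def Eom_def)
    show "nice (dq E)"
      by (intro niceI holomorphic_on_imp_continuous_on holomorphic_on_subset[OF dq_holomorphic[OF EU oU]])
        (use Eseg(1) in \<open>auto simp: U_def\<close>)
    show "E (of_real x) = 1 + 2 * (of_real x - 1) * dq E (of_real x)" for x :: real
      by (subst dq_decomp) (simp only: E1)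
  qed (rule oOm)
  interpret path_measure M
    using prob sets_M by (simp add: path_measure_def path_measure_axioms_def)
  \<comment> \<open>Row \<open>i\<close> absorbs \<open>2 ^ (r - 1 - i)\<close>; these exponents add
    up to the binomial coefficient of the cylinder formula.\<close>
  have cw: "path_weight al be ga n u =
     (if okpath n u then detk (rr n) (\<lambda>i j. cf n (tld n (u n) (Suc j)) (\<lambda>x. (2 * (x - 1)) ^ (rr n - 1 - i))) else 0)" for n u
  proof -
    let ?r = "rr n"
    have "detk ?r (\<lambda>i j. cf n (tld n (u n) (Suc j)) (\<lambda>x. (2 * (x - 1)) ^ (?r - 1 - i)))
       = detk ?r (\<lambda>i j. 2 ^ (?r - 1 - i) * ip (alph n) (chebJ (tld n (u n) (j + 1)) (alph n)) (\<lambda>x. (x - 1) ^ (?r - (i + 1)) * Eom al be ga x))"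
    proof (rule detk_cong)
      fix i j
      have "cf n (tld n (u n) (Suc j)) (\<lambda>x. (2 * (x - 1)) ^ (?r - 1 - i))
         = Lp (alph n) (\<lambda>x. 2 ^ (?r - 1 - i) * (chebJ (tld n (u n) (j + 1)) (alph n) x * ((x - 1) ^ (?r - (i + 1)) * Eom al be ga x)))"
        unfolding cf_def by (rule Lp_cong) (simp add: power_mult_distrib E_def del: right_diff_distrib_numeral)
      then show "cf n (tld n (u n) (Suc j)) (\<lambda>x. (2 * (x - 1)) ^ (?r - 1 - i))
         = 2 ^ (?r - 1 - i) * ip (alph n) (chebJ (tld n (u n) (j + 1)) (alph n)) (\<lambda>x. (x - 1) ^ (?r - (i + 1)) * Eom al be ga x)"
        by (simp only: Lp_cmult[OF alph_cases] ip_eq_Lp)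
    qed
    also have "\<dots> = 2 ^ (?r choose 2) * detk ?r (\<lambda>i j. ip (alph n) (chebJ (tld n (u n) (j + 1)) (alph n)) (\<lambda>x. (x - 1) ^ (?r - (i + 1)) * Eom al be ga x))"
      unfolding detk_scale_rows power_sum[symmetric] sum_choose_2 ..
    finally show ?thesis unfolding path_weight_def okpath_def by (simp only:)
  qed
  interpret plancherel_process E "dq E" G Om M
    by unfold_locales (simp only: cyl cw)
  \<comment> \<open>The loop may run through common zeros, where the coded \<open>E\<close> has the
    value 0 by convention. They are finitely many, being zeros on a compact set of an entire
    function with value 1 at 1.\<close>
  define A where "A = {u \<in> path_image g. Enum be ga u = 0}"
  have finA: "finite A"
  proof (cases "Enum be ga constant_on UNIV")
    case True
    then have "Enum be ga u = Enum be ga 1" for u by (metis UNIV_I constant_on_def)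
    then have "A = {}" using params by (auto simp: A_def)
    then show ?thesis by simp
  next
    case False
    then show ?thesis unfolding A_def
      using gl(1) by (intro holomorphic_compact_finite_zeros[OF Enum_holomorphic[OF params, of UNIV]])
        (auto simp: compact_valid_path_image)
  qed
  have K: "Kern al be ga g z z' = (1 / (-2) ^ rr (snd z)) * KT z z' / (1 / (-2) ^ rr (snd z'))" for z z'
  proof -
    obtain s n t m where z: "z = (s, n)" "z' = (t, m)" by fastforce
    show ?thesis unfolding z snd_conv
    proof (rule Kern_eq_KT[OF _ finA _ gl(2,1,3)])
      fix u assume "u \<in> path_image g - A"
      then have "Enum be ga u \<noteq> 0" by (simp add: A_def)
      then show "1 / Eom al be ga u = G u"
        using Ginv_at_nonzero(2)[OF params, of u] by (simp add: G_def Eom_def)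
    qed (use inOm gl(4) in \<open>auto simp: E_def\<close>)
  qed
  show ?thesis
  proof (intro allI impI)
    fix k and zs :: "(nat \<times> nat) list"
    assume zs: "length zs = k" "distinct zs" "\<forall>z\<in>set zs. snd z \<ge> 1"
    have "complex_of_real (measure M {w \<in> space M. set zs \<subseteq> pointset w}) = detk k (\<lambda>i j. KT (zs ! i) (zs ! j))"
      using correlation_KT[OF zs(2)] zs by simp
    also have "\<dots> = detk k (\<lambda>i j. (1 / (-2) ^ rr (snd (zs ! i))) * KT (zs ! i) (zs ! j) / (1 / (-2) ^ rr (snd (zs ! j))))"
      by (rule detk_gauge[symmetric]) simp
    finally show "complex_of_real (measure M {w \<in> space M. set zs \<subseteq> pointset w}) = detk k (\<lambda>i j. Kern al be ga g (zs ! i) (zs ! j))"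
      unfolding K .
  qed
qed

end
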